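(* Let $K$ be a field. For all $n\geq 1$, let $\mathcal{P}(n)$ be the $K$-vector space with basis $\mathcal{WNP}^{Ind}(n)$. A structure of operad on $\mathcal{P}=(\mathcal{P}(n))_{n\geq 1}$ is defined in the following way: for all $Q\in\mathcal{WNP}^{Ind}(k)$ and all $P_1\in\mathcal{WNP}^{Ind}(n_1),\ldots,P_k\in\mathcal{WNP}^{Ind}(n_k)$, put $Q\circ(P_1,\ldots,P_k)=\Xi(Q)$, where $$\Xi:(\mathcal{H}_{\mathcal{WNP}}^{\{1,\ldots,k\}},\star,\rightsquigarrow)\longrightarrow(\mathcal{H}_{\mathcal{WNP}}^{\mathbb{N}},\star,\rightsquigarrow)$$ is the unique morphism of $2$-$As$ algebras sending $\bullet_1$ to $P_1$, $\bullet_2$ to $P_2[n_1]$, $\ldots$, and $\bullet_k$ to $P_k[n_1+\cdots+n_{k-1}]$; the action of the symmetric group $\mathfrak{S}_n$ on $\mathcal{P}(n)$ is given by permutation of the indices. This operad is isomorphic to the operad of $2$-$As$ algebras.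
   Context: A double poset is a triple $(P,\leq_1,\leq_2)$ where $P$ is a finite set and $\leq_1,\leq_2$ are two partial orders on $P$; a plane poset is a double poset $(P,\leq_h,\leq_r)$ (with $\leq_h=\leq_1$, $\leq_r=\leq_2$) such that for all $x\neq y$ in $P$, $x$ and $y$ are comparable for $\leq_h$ if and only if they are not comparable for $\leq_r$. Let $N_1$ and $N_2$ be the following plane posets on $\{a,b,c,d\}$ (listing all strict relations): $N_1$: $a<_h c$, $a<_h d$, $b<_h d$; $a<_r b$, $c<_r b$, $c<_r d$. $N_2$: $a<_h c$, $b<_h c$, $b<_h d$; $a<_r b$, $a<_r d$, $c<_r d$. A double poset is WN if it is plane and has no subposet (subset with restricted orders) isomorphic to $N_1$ or $N_2$. For a set $\mathcal{D}$, $\mathcal{WNP}^{\mathcal{D}}$ is the set of (isomorphism classes of) WN posets decorated by $\mathcal{D}$, i.e. pairs $(P,d)$ with $P$ a WN poset and $d:P\to\mathcal{D}$ a map; $\bullet_d$ is the one-element poset decorated by $d$. $\mathcal{WNP}^{Ind}(n)$ is the set of (isomorphism classes of) pairs $(P,d)$ with $P$ a WN poset of cardinality $n$ and $d:P\to\{1,\ldots,n\}$ a bijection. For $P\in\mathcal{WNP}^{\mathbb{N}}$ and $k\in\mathbb{N}$, $P[k]$ is obtained from $P$ by adding $k$ to all decorations. $\mathcal{H}_{\mathcal{WNP}}^{\mathcal{D}}$ is the $K$-vector space with basis $\mathcal{WNP}^{\mathcal{D}}$, with two bilinear associative products whose unit is the empty poset: $P\rightsquigarrow Q$ is the disjoint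 union of $P$ and $Q$ (keeping decorations), with $P,Q$ as double subposets and, for all $x\in P$, $y\in Q$, $x\leq_r y$ and $x,y$ not $\leq_h$-comparable; and $P\star Q=\sum_{R\in\mathcal{WNP}^{\mathcal{D}}}n(P,Q;R)R$, where $n(P,Q;R)$ is the number of ideals $I$ of $R$ (subsets such that $x\in I$, $y\in R$, $x\leq_h y$ imply $y\in I$) such that $R\setminus I$ is isomorphic to $P$ and $I$ is isomorphic to $Q$ as decorated double posets. A $2$-$As$ algebra is a $K$-vector space with two associative products sharing the same unit (morphisms preserve both products, in order, and the unit). $(\mathcal{H}_{\mathcal{WNP}}^{\mathcal{D}},\star,\rightsquigarrow)$ is freely generated, as a $2$-$As$ algebra, by the $\bullet_d$, $d\in\mathcal{D}$, so $\Xi$ is well defined. The operad of $2$-$As$ algebras is the symmetric operad (in arities $n\geq 1$) generated by two associative binary operations with no other relation. *)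

theory Defs
  imports
    "HOL-Algebra.Algebraic_Closure_Type"
    "HOL-Algebra.AbelCoset"
    "HOL-Algebra.Module"
    "HOL-Combinatorics.Permutations"
    "HOL-Library.Poly_Mapping"
    "HOL-Library.FuncSet"
begin

section \<open>Free vector spaces and multilinear extension\<close>

text \<open>
  The vector space with basis \<open>B\<close> consists of the finitely supported functions whose support lies
  in \<open>B\<close>; the basis vector of \<open>b\<close> is \<open>basis b\<close>.  The fields \<open>mult\<close> and \<open>one\<close>, which the record type
  of modules inherits from rings, carry no meaning for a vector space.
\<close>

abbreviation basis :: "'b \<Rightarrow> ('b \<Rightarrow>\<^sub>0 'k::field)" where
  "basis b \<equiv> Poly_Mapping.single b 1"

definition scale :: "'k::field \<Rightarrow> ('b \<Rightarrow>\<^sub>0 'k) \<Rightarrow> ('b \<Rightarrow>\<^sub>0 'k)" where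
  "scale c x = Poly_Mapping.map (\<lambda>a. c * a) x"

definition free_space :: "'b set \<Rightarrow> ('k::field, 'b \<Rightarrow>\<^sub>0 'k) module" where
  "free_space B = \<lparr> carrier = {x. Poly_Mapping.keys x \<subseteq> B},
     monoid.mult = undefined, monoid.one = undefined,
     zero = 0, add = (+), module.smult = scale \<rparr>"

definition lin_maps :: "('k, 'a, 'm) module_scheme \<Rightarrow> ('k, 'b, 'n) module_scheme \<Rightarrow> ('a \<Rightarrow> 'b) set"
  where
  "lin_maps M N = {f \<in> carrier M \<rightarrow> carrier N.
     (\<forall>x\<in>carrier M. \<forall>y\<in>carrier M. f (x \<oplus>\<^bsub>M\<^esub> y) = f x \<oplus>\<^bsub>N\<^esub> f y) \<and>
     (\<forall>c. \<forall>x\<in>carrier M. f (c \<odot>\<^bsub>M\<^esub> x) = c \<odot>\<^bsub>N\<^esub> f x)}"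

definition lin_ext :: "('a \<Rightarrow> ('b \<Rightarrow>\<^sub>0 'k)) \<Rightarrow> ('a \<Rightarrow>\<^sub>0 'k) \<Rightarrow> ('b \<Rightarrow>\<^sub>0 'k::field)" where
  "lin_ext F x = (\<Sum>a\<in>Poly_Mapping.keys x. scale (Poly_Mapping.lookup x a) (F a))"

definition bilin_ext ::
    "('a \<Rightarrow> 'b \<Rightarrow> ('c \<Rightarrow>\<^sub>0 'k)) \<Rightarrow> ('a \<Rightarrow>\<^sub>0 'k) \<Rightarrow> ('b \<Rightarrow>\<^sub>0 'k) \<Rightarrow> ('c \<Rightarrow>\<^sub>0 'k::field)" where
  "bilin_ext F x y = lin_ext (\<lambda>a. lin_ext (F a) y) x"

definition multilin_ext ::
    "('a \<Rightarrow> 'b list \<Rightarrow> ('c \<Rightarrow>\<^sub>0 'k)) \<Rightarrow> ('a \<Rightarrow>\<^sub>0 'k) \<Rightarrow> ('b \<Rightarrow>\<^sub>0 'k) list \<Rightarrow> ('c \<Rightarrow>\<^sub>0 'k::field)" where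
  "multilin_ext F x ys =
     lin_ext (\<lambda>a. \<Sum>bs\<in>listset (map Poly_Mapping.keys ys).
       scale (\<Prod>i<length ys. Poly_Mapping.lookup (ys ! i) (bs ! i)) (F a bs)) x"


section \<open>Plane posets and WN posets\<close>

record 'v dposet =
  verts :: "'v set"
  le_h :: "'v rel"
  le_r :: "'v rel"

record ('v, 'd) ddposet = "'v dposet" +
  dec :: "'v \<Rightarrow> 'd"

definition double_poset :: "('v, 'm) dposet_scheme \<Rightarrow> bool" where
  "double_poset P \<longleftrightarrow> finite (verts P) \<and>
     partial_order_on (verts P) (le_h P) \<and> partial_order_on (verts P) (le_r P)"

definition h_comparable :: "('v, 'm) dposet_scheme \<Rightarrow> 'v \<Rightarrow> 'v \<Rightarrow> bool" where
  "h_comparable P x y \<longleftrightarrow> (x, y) \<in> le_h P \<or> (y, x) \<in> le_h P"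

definition r_comparable :: "('v, 'm) dposet_scheme \<Rightarrow> 'v \<Rightarrow> 'v \<Rightarrow> bool" where
  "r_comparable P x y \<longleftrightarrow> (x, y) \<in> le_r P \<or> (y, x) \<in> le_r P"

definition plane_poset :: "('v, 'm) dposet_scheme \<Rightarrow> bool" where
  "plane_poset P \<longleftrightarrow> double_poset P \<and>
     (\<forall>x\<in>verts P. \<forall>y\<in>verts P. x \<noteq> y \<longrightarrow> (h_comparable P x y \<longleftrightarrow> \<not> r_comparable P x y))"

definition subposet :: "('v, 'm) dposet_scheme \<Rightarrow> 'v set \<Rightarrow> ('v, 'm) dposet_scheme" where
  "subposet P A = P\<lparr> verts := A, le_h := le_h P \<inter> A \<times> A, le_r := le_r P \<inter> A \<times> A \<rparr>"

definition dp_iso :: "('v, 'm) dposet_scheme \<Rightarrow> ('w, 'n) dposet_scheme \<Rightarrow> ('v \<Rightarrow> 'w) \<Rightarrow> bool" where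
  "dp_iso P Q f \<longleftrightarrow> bij_betw f (verts P) (verts Q) \<and>
     (\<forall>x\<in>verts P. \<forall>y\<in>verts P.
        ((x, y) \<in> le_h P \<longleftrightarrow> (f x, f y) \<in> le_h Q) \<and> ((x, y) \<in> le_r P \<longleftrightarrow> (f x, f y) \<in> le_r Q))"

definition dp_isomorphic :: "('v, 'm) dposet_scheme \<Rightarrow> ('w, 'n) dposet_scheme \<Rightarrow> bool" where
  "dp_isomorphic P Q \<longleftrightarrow> (\<exists>f. dp_iso P Q f)"

definition ddp_isomorphic :: "('v, 'd) ddposet \<Rightarrow> ('w, 'd) ddposet \<Rightarrow> bool" where
  "ddp_isomorphic P Q \<longleftrightarrow> (\<exists>f. dp_iso P Q f \<and> (\<forall>x\<in>verts P. dec Q (f x) = dec P x))"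

datatype four = Pt_a | Pt_b | Pt_c | Pt_d

definition N1 :: "four dposet" where
  "N1 = \<lparr> verts = UNIV,
     le_h = Id \<union> {(Pt_a, Pt_c), (Pt_a, Pt_d), (Pt_b, Pt_d)},
     le_r = Id \<union> {(Pt_a, Pt_b), (Pt_c, Pt_b), (Pt_c, Pt_d)} \<rparr>"

definition N2 :: "four dposet" where
  "N2 = \<lparr> verts = UNIV,
     le_h = Id \<union> {(Pt_a, Pt_c), (Pt_b, Pt_c), (Pt_b, Pt_d)},
     le_r = Id \<union> {(Pt_a, Pt_b), (Pt_a, Pt_d), (Pt_c, Pt_d)} \<rparr>"

definition WN :: "('v, 'm) dposet_scheme \<Rightarrow> bool" where
  "WN P \<longleftrightarrow> plane_poset P \<and>
     \<not> (\<exists>A\<subseteq>verts P. dp_isomorphic (subposet P A) N1 \<or> dp_isomorphic (subposet P A) N2)"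


subsection \<open>Isomorphism classes of decorated WN posets\<close>

lemma dp_iso_id: "dp_iso P P id"
  by (simp add: dp_iso_def)

lemma ddp_isomorphic_refl: "ddp_isomorphic P P"
  unfolding ddp_isomorphic_def using dp_iso_id by (intro exI[of _ id]) auto

lemma ddp_isomorphic_sym:
  assumes "ddp_isomorphic P Q" shows "ddp_isomorphic Q P"
proof -
  obtain f where f: "dp_iso P Q f" and d: "\<forall>x\<in>verts P. dec Q (f x) = dec P x"
    using assms unfolding ddp_isomorphic_def by blast
  have bij: "bij_betw f (verts P) (verts Q)" using f by (simp add: dp_iso_def)
  define g where "g = the_inv_into (verts P) f"
  have g: "bij_betw g (verts Q) (verts P)"
    unfolding g_def by (rule bij_betw_the_inv_into[OF bij])
  have fg: "f (g y) = y" if "y \<in> verts Q" for y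
    using f_the_inv_into_f_bij_betw[OF bij] that unfolding g_def by blast
  have gP: "g y \<in> verts P" if "y \<in> verts Q" for y using g that bij_betwE by blast
  show ?thesis
    unfolding ddp_isomorphic_def dp_iso_def
    using f d g fg gP unfolding dp_iso_def by (intro exI[of _ g]) metis
qed

lemma ddp_isomorphic_trans:
  assumes "ddp_isomorphic P Q" "ddp_isomorphic Q R" shows "ddp_isomorphic P R"
proof -
  obtain f where f: "dp_iso P Q f" and df: "\<forall>x\<in>verts P. dec Q (f x) = dec P x"
    using assms unfolding ddp_isomorphic_def by blast
  obtain g where g: "dp_iso Q R g" and dg: "\<forall>x\<in>verts Q. dec R (g x) = dec Q x"
    using assms unfolding ddp_isomorphic_def by blast
  have fQ: "f x \<in> verts Q" if "x \<in> verts P" for x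
    using f that bij_betwE unfolding dp_iso_def by blast
  have bij: "bij_betw (g \<circ> f) (verts P) (verts R)"
    using f g bij_betw_trans unfolding dp_iso_def by blast
  have "dp_iso P R (g \<circ> f) \<and> (\<forall>x\<in>verts P. dec R ((g \<circ> f) x) = dec P x)"
    using f g df dg fQ bij unfolding dp_iso_def by simp
  then show ?thesis unfolding ddp_isomorphic_def by blast
qed

definition empty_ddposet :: "('v, 'd) ddposet" where
  "empty_ddposet = \<lparr> verts = {}, le_h = {}, le_r = {}, dec = (\<lambda>_. undefined) \<rparr>"

lemma WN_empty: "WN empty_ddposet"
  by (auto simp: WN_def plane_poset_def double_poset_def empty_ddposet_def dp_isomorphic_def
      dp_iso_def subposet_def N1_def N2_def bij_betw_def)

text \<open>
  Since posets are finite, every class has representatives with vertices in \<open>nat\<close>; the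
  values of \<open>dec\<close> outside the vertex set are ignored by isomorphisms.
\<close>

quotient_type 'd wnp = "(nat, 'd) ddposet" / partial: "\<lambda>P Q. WN P \<and> WN Q \<and> ddp_isomorphic P Q"
proof (rule part_equivpI)
  show "\<exists>P :: (nat, 'd) ddposet. WN P \<and> WN P \<and> ddp_isomorphic P P"
    using WN_empty ddp_isomorphic_refl by blast
  show "symp (\<lambda>P Q :: (nat, 'd) ddposet. WN P \<and> WN Q \<and> ddp_isomorphic P Q)"
    by (auto intro: sympI ddp_isomorphic_sym)
  show "transp (\<lambda>P Q :: (nat, 'd) ddposet. WN P \<and> WN Q \<and> ddp_isomorphic P Q)"
    by (auto intro: transpI ddp_isomorphic_trans)
qed

definition rp :: "'d wnp \<Rightarrow> (nat, 'd) ddposet" where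
  "rp P = rep_wnp P"

text \<open>The isomorphism class of a decorated WN poset with vertices of an arbitrary type.\<close>

definition cls :: "('v, 'd) ddposet \<Rightarrow> 'd wnp" where
  "cls S = (THE P. ddp_isomorphic (rp P) S)"

definition decs :: "'d wnp \<Rightarrow> 'd set" where
  "decs P = dec (rp P) ` verts (rp P)"

definition dot :: "'d \<Rightarrow> 'd wnp" where
  "dot d = cls \<lparr> verts = {()}, le_h = {((), ())}, le_r = {((), ())}, dec = (\<lambda>_. d) \<rparr>"

definition empty_wnp :: "'d wnp" where
  "empty_wnp = cls (empty_ddposet :: (unit, 'd) ddposet)"

definition redecorate :: "('d \<Rightarrow> 'e) \<Rightarrow> 'd wnp \<Rightarrow> 'e wnp" where
  "redecorate f P = cls \<lparr> verts = verts (rp P), le_h = le_h (rp P), le_r = le_r (rp P),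
     dec = f \<circ> dec (rp P) \<rparr>"

definition shift :: "nat \<Rightarrow> nat wnp \<Rightarrow> nat wnp" where
  "shift k P = redecorate (\<lambda>d. d + k) P"

definition WNP_Ind :: "nat \<Rightarrow> nat wnp set" where
  "WNP_Ind n = {P. card (verts (rp P)) = n \<and> bij_betw (dec (rp P)) (verts (rp P)) {1..n}}"


section \<open>The 2-As algebra of decorated WN posets\<close>

definition squig_union :: "('v, 'd) ddposet \<Rightarrow> ('w, 'd) ddposet \<Rightarrow> ('v + 'w, 'd) ddposet" where
  "squig_union P Q = \<lparr>
     verts = Inl ` verts P \<union> Inr ` verts Q,
     le_h = map_prod Inl Inl ` le_h P \<union> map_prod Inr Inr ` le_h Q,
     le_r = map_prod Inl Inl ` le_r P \<union> map_prod Inr Inr ` le_r Q \<union>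
            (Inl ` verts P) \<times> (Inr ` verts Q),
     dec = case_sum (dec P) (dec Q) \<rparr>"

definition squig :: "'d wnp \<Rightarrow> 'd wnp \<Rightarrow> 'd wnp" where
  "squig P Q = cls (squig_union (rp P) (rp Q))"

definition h_ideal :: "('v, 'm) dposet_scheme \<Rightarrow> 'v set \<Rightarrow> bool" where
  "h_ideal R I \<longleftrightarrow> I \<subseteq> verts R \<and>
     (\<forall>x\<in>I. \<forall>y\<in>verts R. (x, y) \<in> le_h R \<longrightarrow> y \<in> I)"

definition ideal_count :: "'d wnp \<Rightarrow> 'd wnp \<Rightarrow> 'd wnp \<Rightarrow> nat" where
  "ideal_count P Q R = card {I. h_ideal (rp R) I \<and>
     ddp_isomorphic (subposet (rp R) (verts (rp R) - I)) (rp P) \<and>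
     ddp_isomorphic (subposet (rp R) I) (rp Q)}"

text \<open>
  The sum ranges over the \<open>R\<close> with \<open>ideal_count P Q R \<noteq> 0\<close>.  There are finitely many of them: such
  an \<open>R\<close> has \<open>|P| + |Q|\<close> vertices and takes its decorations from \<open>P\<close> and \<open>Q\<close>.
\<close>

definition star :: "'d wnp \<Rightarrow> 'd wnp \<Rightarrow> ('d wnp \<Rightarrow>\<^sub>0 'k::field)" where
  "star P Q = (\<Sum>R | ideal_count P Q R \<noteq> 0. scale (of_nat (ideal_count P Q R)) (basis R))"

text \<open>
  The data of a 2-As algebra: the ring fields \<open>mult\<close> and \<open>one\<close> of the module record hold the first
  product and the common unit, \<open>mult2\<close> the second product.
\<close>

record ('k, 'a) twoas_algebra = "('k, 'a) module" +
  mult2 :: "'a \<Rightarrow> 'a \<Rightarrow> 'a"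

definition H_WNP :: "'d set \<Rightarrow> ('k::field, 'd wnp \<Rightarrow>\<^sub>0 'k) twoas_algebra" where
  "H_WNP D = \<lparr> carrier = {x. Poly_Mapping.keys x \<subseteq> {P. decs P \<subseteq> D}},
     monoid.mult = bilin_ext star, monoid.one = basis empty_wnp,
     zero = 0, add = (+), module.smult = scale,
     mult2 = bilin_ext (\<lambda>P Q. basis (squig P Q)) \<rparr>"

definition twoas_hom ::
    "('k, 'a, 'm) twoas_algebra_scheme \<Rightarrow> ('k, 'b, 'n) twoas_algebra_scheme \<Rightarrow> ('a \<Rightarrow> 'b) set" where
  "twoas_hom A B = {f \<in> lin_maps A B.
     (\<forall>x\<in>carrier A. \<forall>y\<in>carrier A. f (x \<otimes>\<^bsub>A\<^esub> y) = f x \<otimes>\<^bsub>B\<^esub> f y) \<and>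
     (\<forall>x\<in>carrier A. \<forall>y\<in>carrier A. f (mult2 A x y) = mult2 B (f x) (f y)) \<and>
     f \<one>\<^bsub>A\<^esub> = \<one>\<^bsub>B\<^esub>}"


section \<open>Symmetric operads in arities at least 1\<close>

text \<open>
  \<open>op_comp \<O> [n\<^sub>1,\<dots>,n\<^sub>k] q [p\<^sub>1,\<dots>,p\<^sub>k]\<close> is the composition of \<open>q\<close> of arity \<open>k\<close> with the \<open>p\<^sub>i\<close> of arities
  \<open>n\<^sub>i\<close>.  The symmetric group of \<open>{1..n}\<close> acts from the left, \<open>op_act \<O> n \<sigma>\<close> being
  thought of as replacing each input index \<open>i\<close> by \<open>\<sigma> i\<close>; the corresponding right action is that of
  the inverse permutation.  Everything is meaningful in arities at least 1 only.
\<close>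

record ('k, 'a) operad =
  op_space :: "nat \<Rightarrow> ('k, 'a) module"
  op_ident :: 'a
  op_comp :: "nat list \<Rightarrow> 'a \<Rightarrow> 'a list \<Rightarrow> 'a"
  op_act :: "nat \<Rightarrow> (nat \<Rightarrow> nat) \<Rightarrow> 'a \<Rightarrow> 'a"

definition op_args :: "('k, 'a, 'm) operad_scheme \<Rightarrow> nat list \<Rightarrow> 'a list \<Rightarrow> bool" where
  "op_args \<O> ns ps \<longleftrightarrow> ns \<noteq> [] \<and> (\<forall>n\<in>set ns. 1 \<le> n) \<and>
     list_all2 (\<lambda>n p. p \<in> carrier (op_space \<O> n)) ns ps"

definition offset :: "nat list \<Rightarrow> nat \<Rightarrow> nat" where
  "offset ns i = sum_list (take i ns)"

text \<open>
  \<open>{1..sum_list ns}\<close> is cut into consecutive blocks of lengths given by \<open>ns\<close>; \<open>block_of ns x\<close> is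
  the (0-based) number of the block of \<open>x\<close>, the elements of block \<open>i\<close> being \<open>offset ns i + j\<close>
  for \<open>j \<in> {1..ns ! i}\<close>.
\<close>

definition block_of :: "nat list \<Rightarrow> nat \<Rightarrow> nat" where
  "block_of ns x = (LEAST i. x \<le> offset ns (Suc i))"

text \<open>The sum of the permutations \<open>\<tau>s ! i\<close> of \<open>{1..ns ! i}\<close>.\<close>

definition perm_sum :: "nat list \<Rightarrow> (nat \<Rightarrow> nat) list \<Rightarrow> nat \<Rightarrow> nat" where
  "perm_sum ns \<tau>s x = (if x \<in> {1..sum_list ns}
     then (let i = block_of ns x in offset ns i + (\<tau>s ! i) (x - offset ns i)) else x)"

definition reindex :: "(nat \<Rightarrow> nat) \<Rightarrow> 'c list \<Rightarrow> 'c list" where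
  "reindex \<sigma> xs = map (\<lambda>i. xs ! (\<sigma> i - 1)) [1..<Suc (length xs)]"

text \<open>
  The block permutation: for \<open>i \<in> {1..k}\<close> it maps, preserving the order, the \<open>i\<close>-th block with
  respect to the lengths \<open>[n\<^bsub>\<sigma> 1\<^esub>,\<dots>,n\<^bsub>\<sigma> k\<^esub>]\<close> onto the \<open>\<sigma> i\<close>-th block with respect to the lengths
  \<open>[n\<^sub>1,\<dots>,n\<^sub>k]\<close>.
\<close>

definition block_perm :: "nat list \<Rightarrow> (nat \<Rightarrow> nat) \<Rightarrow> nat \<Rightarrow> nat" where
  "block_perm ns \<sigma> x = (if x \<in> {1..sum_list ns}
     then (let ns' = reindex \<sigma> ns; i = block_of ns' x
           in offset ns (\<sigma> (Suc i) - 1) + (x - offset ns' i)) else x)"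

definition symmetric_operad :: "('k::field, 'a, 'm) operad_scheme \<Rightarrow> bool" where
  "symmetric_operad \<O> \<longleftrightarrow>
     (\<forall>n\<ge>1. module (ring_of_type_algebra :: 'k ring) (op_space \<O> n)) \<and>
     op_ident \<O> \<in> carrier (op_space \<O> 1) \<and>
     \<comment> \<open>the composition is multilinear\<close>
     (\<forall>ns ps. op_args \<O> ns ps \<longrightarrow>
        (\<lambda>q. op_comp \<O> ns q ps) \<in> lin_maps (op_space \<O> (length ns)) (op_space \<O> (sum_list ns))) \<and>
     (\<forall>ns ps q i. op_args \<O> ns ps \<and> q \<in> carrier (op_space \<O> (length ns)) \<and> i < length ns \<longrightarrow>
        (\<lambda>x. op_comp \<O> ns q (ps[i := x])) \<in> lin_maps (op_space \<O> (ns ! i)) (op_space \<O> (sum_list ns))) \<and>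
     \<comment> \<open>unit\<close>
     (\<forall>n\<ge>1. \<forall>p\<in>carrier (op_space \<O> n).
        op_comp \<O> [n] (op_ident \<O>) [p] = p \<and> op_comp \<O> (replicate n 1) p (replicate n (op_ident \<O>)) = p) \<and>
     \<comment> \<open>associativity\<close>
     (\<forall>mss ps rss q. op_args \<O> (map length mss) ps \<and> q \<in> carrier (op_space \<O> (length mss)) \<and>
        list_all2 (op_args \<O>) mss rss \<longrightarrow>
        op_comp \<O> (concat mss) (op_comp \<O> (map length mss) q ps) (concat rss) =
        op_comp \<O> (map sum_list mss) q
          (map (\<lambda>i. op_comp \<O> (mss ! i) (ps ! i) (rss ! i)) [0..<length mss])) \<and>
     \<comment> \<open>linear left action of the symmetric groups\<close>
     (\<forall>n\<ge>1. \<forall>\<sigma>. \<sigma> permutes {1..n} \<longrightarrow> op_act \<O> n \<sigma> \<in> lin_maps (op_space \<O> n) (op_space \<O> n)) \<and>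
     (\<forall>n\<ge>1. \<forall>x\<in>carrier (op_space \<O> n). op_act \<O> n id x = x) \<and>
     (\<forall>n\<ge>1. \<forall>\<sigma> \<tau>. \<forall>x\<in>carrier (op_space \<O> n). \<sigma> permutes {1..n} \<and> \<tau> permutes {1..n} \<longrightarrow>
        op_act \<O> n (\<sigma> \<circ> \<tau>) x = op_act \<O> n \<sigma> (op_act \<O> n \<tau> x)) \<and>
     \<comment> \<open>equivariance\<close>
     (\<forall>ns ps q \<tau>s. op_args \<O> ns ps \<and> q \<in> carrier (op_space \<O> (length ns)) \<and>
        list_all2 (\<lambda>n \<tau>. \<tau> permutes {1..n}) ns \<tau>s \<longrightarrow>
        op_comp \<O> ns q (map (\<lambda>i. op_act \<O> (ns ! i) (\<tau>s ! i) (ps ! i)) [0..<length ns]) =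
        op_act \<O> (sum_list ns) (perm_sum ns \<tau>s) (op_comp \<O> ns q ps)) \<and>
     (\<forall>ns ps q \<sigma>. op_args \<O> ns ps \<and> q \<in> carrier (op_space \<O> (length ns)) \<and>
        \<sigma> permutes {1..length ns} \<longrightarrow>
        op_comp \<O> ns (op_act \<O> (length ns) \<sigma> q) ps =
        op_act \<O> (sum_list ns) (block_perm ns \<sigma>) (op_comp \<O> (reindex \<sigma> ns) q (reindex \<sigma> ps)))"

definition operad_hom ::
    "('k, 'a, 'm) operad_scheme \<Rightarrow> ('k, 'b, 'n) operad_scheme \<Rightarrow> (nat \<Rightarrow> 'a \<Rightarrow> 'b) \<Rightarrow> bool" where
  "operad_hom \<O> \<O>' f \<longleftrightarrow>
     (\<forall>n\<ge>1. f n \<in> lin_maps (op_space \<O> n) (op_space \<O>' n)) \<and>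
     f 1 (op_ident \<O>) = op_ident \<O>' \<and>
     (\<forall>ns q ps. op_args \<O> ns ps \<and> q \<in> carrier (op_space \<O> (length ns)) \<longrightarrow>
        f (sum_list ns) (op_comp \<O> ns q ps) =
        op_comp \<O>' ns (f (length ns) q) (map2 f ns ps)) \<and>
     (\<forall>n\<ge>1. \<forall>\<sigma>. \<forall>x\<in>carrier (op_space \<O> n). \<sigma> permutes {1..n} \<longrightarrow>
        f n (op_act \<O> n \<sigma> x) = op_act \<O>' n \<sigma> (f n x))"

definition operad_isomorphic ::
    "('k, 'a, 'm) operad_scheme \<Rightarrow> ('k, 'b, 'n) operad_scheme \<Rightarrow> bool" where
  "operad_isomorphic \<O> \<O>' \<longleftrightarrow>
     (\<exists>f. operad_hom \<O> \<O>' f \<and>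
        (\<forall>n\<ge>1. bij_betw (f n) (carrier (op_space \<O> n)) (carrier (op_space \<O>' n))))"


subsection \<open>Ideals and quotients\<close>

definition operad_ideal ::
    "('k::field, 'a, 'm) operad_scheme \<Rightarrow> (nat \<Rightarrow> 'a set) \<Rightarrow> bool" where
  "operad_ideal \<O> J \<longleftrightarrow>
     (\<forall>n\<ge>1. submodule (J n) (ring_of_type_algebra :: 'k ring) (op_space \<O> n)) \<and>
     (\<forall>n\<ge>1. \<forall>\<sigma>. \<sigma> permutes {1..n} \<longrightarrow> op_act \<O> n \<sigma> ` J n \<subseteq> J n) \<and>
     (\<forall>ns q ps. op_args \<O> ns ps \<and> q \<in> carrier (op_space \<O> (length ns)) \<and>
        (q \<in> J (length ns) \<or> (\<exists>i<length ns. ps ! i \<in> J (ns ! i))) \<longrightarrow>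
        op_comp \<O> ns q ps \<in> J (sum_list ns))"

definition generated_ideal ::
    "('k::field, 'a, 'm) operad_scheme \<Rightarrow> (nat \<Rightarrow> 'a set) \<Rightarrow> nat \<Rightarrow> 'a set" where
  "generated_ideal \<O> R n = \<Inter>{J n | J. operad_ideal \<O> J \<and> (\<forall>m\<ge>1. R m \<subseteq> J m)}"

definition quotient_space :: "('k, 'a, 'm) module_scheme \<Rightarrow> 'a set \<Rightarrow> ('k, 'a set) module" where
  "quotient_space M J = \<lparr> carrier = a_rcosets\<^bsub>M\<^esub> J,
     monoid.mult = undefined, monoid.one = undefined,
     zero = J, add = set_add M, module.smult = (\<lambda>c A. \<Union>x\<in>A. J +>\<^bsub>M\<^esub> (c \<odot>\<^bsub>M\<^esub> x)) \<rparr>"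

definition quotient_operad ::
    "('k, 'a, 'm) operad_scheme \<Rightarrow> (nat \<Rightarrow> 'a set) \<Rightarrow> ('k, 'a set) operad" where
  "quotient_operad \<O> J = \<lparr>
     op_space = (\<lambda>n. quotient_space (op_space \<O> n) (J n)),
     op_ident = J 1 +>\<^bsub>op_space \<O> 1\<^esub> op_ident \<O>,
     op_comp = (\<lambda>ns A Bs. \<Union>q\<in>A. \<Union>ps\<in>listset Bs.
       J (sum_list ns) +>\<^bsub>op_space \<O> (sum_list ns)\<^esub> op_comp \<O> ns q ps),
     op_act = (\<lambda>n \<sigma> A. \<Union>x\<in>A. J n +>\<^bsub>op_space \<O> n\<^esub> op_act \<O> n \<sigma> x) \<rparr>"


subsection \<open>The operad of 2-As algebras\<close>

text \<open>
  The free symmetric operad on a type \<open>'g\<close> of binary operations without symmetry: in arity \<open>n\<close> it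
  has as basis the binary trees with nodes labelled by \<open>'g\<close> whose leaves are indexed bijectively
  by \<open>{1..n}\<close>.
\<close>

datatype ('g, 'l) optree = Leaf 'l | Node 'g "('g, 'l) optree" "('g, 'l) optree"

fun leaves :: "('g, 'l) optree \<Rightarrow> 'l list" where
  "leaves (Leaf l) = [l]"
| "leaves (Node g s t) = leaves s @ leaves t"

fun graft :: "('l \<Rightarrow> ('g, 'm) optree) \<Rightarrow> ('g, 'l) optree \<Rightarrow> ('g, 'm) optree" where
  "graft f (Leaf l) = f l"
| "graft f (Node g s t) = Node g (graft f s) (graft f t)"

definition op_trees :: "nat \<Rightarrow> ('g, nat) optree set" where
  "op_trees n = {t. distinct (leaves t) \<and> set (leaves t) = {1..n}}"

definition tree_comp ::
    "nat list \<Rightarrow> ('g, nat) optree \<Rightarrow> ('g, nat) optree list \<Rightarrow> ('g, nat) optree" where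
  "tree_comp ns t us =
     graft (\<lambda>i. map_optree id (\<lambda>l. l + offset ns (i - 1)) (us ! (i - 1))) t"

definition free_operad :: "('k::field, ('g, nat) optree \<Rightarrow>\<^sub>0 'k) operad" where
  "free_operad = \<lparr>
     op_space = (\<lambda>n. free_space (op_trees n)),
     op_ident = basis (Leaf 1),
     op_comp = (\<lambda>ns. multilin_ext (\<lambda>t us. basis (tree_comp ns t us))),
     op_act = (\<lambda>n \<sigma>. lin_ext (\<lambda>t. basis (map_optree id \<sigma> t))) \<rparr>"

definition assoc_relator :: "('k, 'a, 'm) operad_scheme \<Rightarrow> 'a \<Rightarrow> 'a" where
  "assoc_relator \<O> \<mu> =
     op_comp \<O> [2, 1] \<mu> [\<mu>, op_ident \<O>] \<ominus>\<^bsub>op_space \<O> 3\<^esub> op_comp \<O> [1, 2] \<mu> [op_ident \<O>, \<mu>]"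

datatype two_ops = Op1 | Op2

definition generator :: "'g \<Rightarrow> (('g, nat) optree \<Rightarrow>\<^sub>0 'k::field)" where
  "generator g = basis (Node g (Leaf 1) (Leaf 2))"

definition TwoAs_operad :: "('k::field, ((two_ops, nat) optree \<Rightarrow>\<^sub>0 'k) set) operad" where
  "TwoAs_operad = quotient_operad free_operad
     (generated_ideal free_operad
        (\<lambda>n. if n = 3 then {assoc_relator free_operad (generator Op1),
                            assoc_relator free_operad (generator Op2)} else {}))"


section \<open>The operad of indexed WN posets\<close>

definition Xi_spec ::
    "nat list \<Rightarrow> nat wnp list \<Rightarrow> ((nat wnp \<Rightarrow>\<^sub>0 'k) \<Rightarrow> (nat wnp \<Rightarrow>\<^sub>0 'k::field)) \<Rightarrow> bool" where
  "Xi_spec ns Ps f \<longleftrightarrow>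
     f \<in> twoas_hom (H_WNP {1..length ns}) (H_WNP UNIV) \<and>
     f \<in> extensional (carrier (H_WNP {1..length ns})) \<and>
     (\<forall>i\<in>{1..length ns}. f (basis (dot i)) = basis (shift (offset ns (i - 1)) (Ps ! (i - 1))))"

definition Xi :: "nat list \<Rightarrow> nat wnp list \<Rightarrow> (nat wnp \<Rightarrow>\<^sub>0 'k) \<Rightarrow> (nat wnp \<Rightarrow>\<^sub>0 'k::field)" where
  "Xi ns Ps = (THE f. Xi_spec ns Ps f)"

text \<open>
  The composition is defined on basis elements and extended multilinearly; its unit is the
  one-element poset.
\<close>

definition WNP_operad :: "('k::field, nat wnp \<Rightarrow>\<^sub>0 'k) operad" where
  "WNP_operad = \<lparr>
     op_space = (\<lambda>n. free_space (WNP_Ind n)),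
     op_ident = basis (dot 1),
     op_comp = (\<lambda>ns. multilin_ext (\<lambda>Q Ps. Xi ns Ps (basis Q))),
     op_act = (\<lambda>n \<sigma>. lin_ext (\<lambda>P. basis (redecorate \<sigma> P))) \<rparr>"

end

theory Submission
  imports Defs
begin

text \<open>
  The statement amounts to the freeness of the 2-As algebra of decorated WN posets, read off arity by
  arity.

  A WN poset with at least two vertices splits into two nonempty layers, the first one entirely below
  the second one for one of the two orders (\<open>wn_split\<close>).  The order is unique (\<open>layered_op_unique\<close>) and
  two splittings for the same order are nested (\<open>layered_linear\<close>).  Therefore the nonempty WN posets
  form the free set with two associative operations, namely the two joins that put one poset below
  another for \<open>h\<close> or for \<open>r\<close>: they correspond to binary trees with two kinds of nodes, taken up to
  associativity (\<open>lead_surj\<close>, \<open>lead_eq_imp_equiv\<close>).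

  The product \<open>squig\<close> is the join for \<open>r\<close>.  The product \<open>star\<close> of two posets is their join for \<open>h\<close> plus
  posets with fewer \<open>h\<close>-relations and the same decorations, and so the value of a tree in the algebra is
  the corresponding poset plus terms with fewer \<open>h\<close>-relations (\<open>leads_evalt\<close>).  By triangularity, the
  values of trees span everything but the unit (\<open>basis_in_span_evalt\<close>), and associativity accounts for all
  linear relations between them (\<open>kernel_subset_assoc_space\<close>).  This is freeness: every choice of
  images \<open>g\<close> of the generators extends to a unique morphism \<open>Phi g\<close>.

  The composition of the operad is \<open>Phi g q\<close>, where \<open>g\<close> maps the generator \<open>i\<close> to the shifted \<open>i\<close>-th
  argument (\<open>op_comp_WNP\<close>), and permutations and shifts of indices are morphisms of this kind as well.
  As \<open>Phi g\<close> after \<open>Phi h\<close> is the morphism that maps \<open>d\<close> to \<open>Phi g (h d)\<close>, the axioms of an operad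
  become identities between positions in blocks of indices.

  Evaluation of trees maps the free operad onto the operad of WN posets and respects the operad
  structures (\<open>Ev_comp\<close>).  Its kernel is spanned by the differences of trees that agree up to
  associativity, which is the ideal generated by the two associativity relators
  (\<open>generated_ideal_eq_kernel\<close>).  So the elements of the quotient operad are the fibres of the evaluation,
  and mapping an element to the fibre over it is the desired isomorphism.
\<close>

section \<open>WN posets elementwise\<close>

text \<open>
  \<open>N\<^sub>1\<close> is the pattern for the pair \<open>(h, r)\<close>.  Exchanging the two orders of \<open>N\<^sub>2\<close> gives a copy of \<open>N\<^sub>1\<close>,
  so that avoiding both posets becomes a condition symmetric in \<open>h\<close> and \<open>r\<close>.
\<close>

definition no_N :: "'v rel \<Rightarrow> 'v rel \<Rightarrow> bool" where
  "no_N h r \<longleftrightarrow> \<not> (\<exists>x w v b. distinct [x, w, v, b] \<and>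
     (x, w) \<in> h \<and> (x, v) \<in> h \<and> (b, v) \<in> h \<and> (x, b) \<in> r \<and> (w, b) \<in> r \<and> (w, v) \<in> r)"

definition wn_rels :: "'v set \<Rightarrow> 'v rel \<Rightarrow> 'v rel \<Rightarrow> bool" where
  "wn_rels V h r \<longleftrightarrow> finite V \<and> h \<subseteq> V \<times> V \<and> r \<subseteq> V \<times> V \<and> refl_on V h \<and> refl_on V r \<and>
     trans h \<and> trans r \<and> antisym h \<and> antisym r \<and>
     (\<forall>x\<in>V. \<forall>y\<in>V. x \<noteq> y \<longrightarrow> ((x, y) \<in> h \<or> (y, x) \<in> h) = (\<not> ((x, y) \<in> r \<or> (y, x) \<in> r))) \<and>
     no_N h r \<and> no_N r h"

lemma wn_rels_swap: "wn_rels V h r \<Longrightarrow> wn_rels V r h"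
  unfolding wn_rels_def by blast

lemma wn_rels_restrict:
  assumes "wn_rels V h r" "A \<subseteq> V"
  shows "wn_rels A (h \<inter> A \<times> A) (r \<inter> A \<times> A)"
proof -
  have "no_N (h \<inter> A \<times> A) (r \<inter> A \<times> A)" "no_N (r \<inter> A \<times> A) (h \<inter> A \<times> A)"
    using assms(1) unfolding wn_rels_def no_N_def by blast+
  moreover have "finite A" using assms unfolding wn_rels_def by (auto intro: finite_subset)
  moreover have "refl_on A (h \<inter> A \<times> A)" "refl_on A (r \<inter> A \<times> A)"
    using assms unfolding wn_rels_def refl_on_def by blast+
  moreover have "trans (h \<inter> A \<times> A)" "trans (r \<inter> A \<times> A)"
    using assms(1) unfolding wn_rels_def trans_def by blast+
  moreover have "antisym (h \<inter> A \<times> A)" "antisym (r \<inter> A \<times> A)"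
    using assms(1) unfolding wn_rels_def antisym_def by blast+
  moreover have "\<forall>x\<in>A. \<forall>y\<in>A. x \<noteq> y \<longrightarrow>
      ((x, y) \<in> h \<inter> A \<times> A \<or> (y, x) \<in> h \<inter> A \<times> A) = (\<not> ((x, y) \<in> r \<inter> A \<times> A \<or> (y, x) \<in> r \<inter> A \<times> A))"
    using assms unfolding wn_rels_def by blast
  ultimately show ?thesis unfolding wn_rels_def by blast
qed

lemma no_N_pullback:
  assumes "no_N h r"
    and "\<And>x y. (x, y) \<in> h' \<Longrightarrow> x \<in> V \<and> y \<in> V \<and> (f x, f y) \<in> h"
    and "\<And>x y. (x, y) \<in> r' \<Longrightarrow> (f x, f y) \<in> r"
    and "\<And>x y. x \<in> V \<Longrightarrow> y \<in> V \<Longrightarrow> f x = f y \<Longrightarrow> x = y"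
  shows "no_N h' r'"
  unfolding no_N_def
proof (intro notI, elim exE conjE)
  fix x w v b
  assume a: "distinct [x, w, v, b]" "(x, w) \<in> h'" "(x, v) \<in> h'" "(b, v) \<in> h'"
    "(x, b) \<in> r'" "(w, b) \<in> r'" "(w, v) \<in> r'"
  then have "x \<in> V" "w \<in> V" "v \<in> V" "b \<in> V" using assms(2) by blast+
  then have "distinct [f x, f w, f v, f b]" using a(1) assms(4) by auto
  then show False using a assms(1,2,3) unfolding no_N_def by blast
qed

lemma wn_rels_transport:
  assumes wn: "wn_rels V h r" and bij: "bij_betw f V V'"
    and h: "\<And>x y. x \<in> V \<Longrightarrow> y \<in> V \<Longrightarrow> (x, y) \<in> h \<longleftrightarrow> (f x, f y) \<in> h'" "h' \<subseteq> V' \<times> V'"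
    and r: "\<And>x y. x \<in> V \<Longrightarrow> y \<in> V \<Longrightarrow> (x, y) \<in> r \<longleftrightarrow> (f x, f y) \<in> r'" "r' \<subseteq> V' \<times> V'"
  shows "wn_rels V' h' r'"
proof -
  define g where "g = the_inv_into V f"
  have gV: "g y \<in> V" if "y \<in> V'" for y
    using bij_betw_the_inv_into[OF bij] that bij_betwE unfolding g_def by blast
  have fg: "f (g y) = y" if "y \<in> V'" for y
    using f_the_inv_into_f_bij_betw[OF bij] that unfolding g_def by blast
  have H: "(x, y) \<in> h' \<longleftrightarrow> x \<in> V' \<and> y \<in> V' \<and> (g x, g y) \<in> h" for x y
    using h(1)[OF gV gV, of x y] h(2) fg by auto
  have R: "(x, y) \<in> r' \<longleftrightarrow> x \<in> V' \<and> y \<in> V' \<and> (g x, g y) \<in> r" for x y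
    using r(1)[OF gV gV, of x y] r(2) fg by auto
  have inj: "g x = g y \<Longrightarrow> x = y" if "x \<in> V'" "y \<in> V'" for x y
    using fg that by metis
  have tr: "(\<forall>a b c. (a, b) \<in> h \<longrightarrow> (b, c) \<in> h \<longrightarrow> (a, c) \<in> h)"
    "(\<forall>a b c. (a, b) \<in> r \<longrightarrow> (b, c) \<in> r \<longrightarrow> (a, c) \<in> r)"
    using wn unfolding wn_rels_def trans_def by blast+
  have an: "(\<forall>a b. (a, b) \<in> h \<longrightarrow> (b, a) \<in> h \<longrightarrow> a = b)"
    "(\<forall>a b. (a, b) \<in> r \<longrightarrow> (b, a) \<in> r \<longrightarrow> a = b)"
    using wn unfolding wn_rels_def antisym_def by blast+
  have nn: "no_N h r" "no_N r h" using wn by (auto simp: wn_rels_def)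
  have "finite V'" using wn bij bij_betw_finite unfolding wn_rels_def by blast
  moreover have "refl_on V' h'" "refl_on V' r'"
    unfolding refl_on_def H R using wn gV by (auto simp: wn_rels_def refl_on_def)
  moreover have "trans h'" "trans r'"
    unfolding trans_def H R using tr by blast+
  moreover have "antisym h'" "antisym r'"
    unfolding antisym_def H R using an inj by metis+
  moreover have "\<forall>x\<in>V'. \<forall>y\<in>V'. x \<noteq> y \<longrightarrow>
      ((x, y) \<in> h' \<or> (y, x) \<in> h') = (\<not> ((x, y) \<in> r' \<or> (y, x) \<in> r'))"
    unfolding H R using wn gV inj unfolding wn_rels_def by metis
  moreover have "no_N h' r'" "no_N r' h'"
    by (rule no_N_pullback[OF nn(1), where f = g and V = V'], use H R inj in blast,
        use H R inj in blast, use inj in blast)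
      (rule no_N_pullback[OF nn(2), where f = g and V = V'], use H R inj in blast,
        use H R inj in blast, use inj in blast)
  ultimately show ?thesis using h(2) r(2) unfolding wn_rels_def by blast
qed

lemma dp_iso_sym:
  assumes "dp_iso S T f"
  shows "dp_iso T S (the_inv_into (verts S) f)"
proof -
  have bij: "bij_betw f (verts S) (verts T)" using assms by (simp add: dp_iso_def)
  have g: "bij_betw (the_inv_into (verts S) f) (verts T) (verts S)"
    by (rule bij_betw_the_inv_into[OF bij])
  have fg: "f (the_inv_into (verts S) f y) = y" if "y \<in> verts T" for y
    using f_the_inv_into_f_bij_betw[OF bij] that by blast
  have gS: "the_inv_into (verts S) f y \<in> verts S" if "y \<in> verts T" for y
    using g that bij_betwE by blast
  show ?thesis using assms g fg gS unfolding dp_iso_def by metis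
qed

text \<open>
  In a plane poset the six strict relations of the pattern determine every other relation between
  its four points, because each pair is comparable for exactly one order and in one direction only;
  so they already give an isomorphic copy.  The relabelling \<open>s\<close> makes the lemma apply to \<open>N\<^sub>2\<close> with
  its orders exchanged as well.
\<close>

lemma iso_N_iff:
  assumes plane: "plane_poset P"
    and N: "verts N = UNIV" "bij s"
      "le_h N = Id \<union> {(s Pt_a, s Pt_c), (s Pt_a, s Pt_d), (s Pt_b, s Pt_d)}"
      "le_r N = Id \<union> {(s Pt_a, s Pt_b), (s Pt_c, s Pt_b), (s Pt_c, s Pt_d)}"
  shows "(\<exists>A\<subseteq>verts P. dp_isomorphic (subposet P A) (N :: 'w dposet)) \<longleftrightarrow> \<not> no_N (le_h P) (le_r P)"
proof
  have s: "s p = s q \<longleftrightarrow> p = q" for p q using N(2) by (simp add: bij_def inj_eq)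
  assume "\<exists>A\<subseteq>verts P. dp_isomorphic (subposet P A) N"
  then obtain A f where f: "dp_iso (subposet P A) N f" unfolding dp_isomorphic_def by blast
  define g where "g = the_inv_into A f \<circ> s"
  have iso: "dp_iso N (subposet P A) (the_inv_into A f)"
    using dp_iso_sym[OF f] by (simp add: subposet_def)
  have "inj (the_inv_into A f)"
    using iso N(1) by (auto simp: dp_iso_def subposet_def bij_betw_def)
  then have g: "g p = g q \<longleftrightarrow> p = q" for p q
    using s by (simp add: g_def inj_eq)
  have h: "(s p, s q) \<in> le_h N \<Longrightarrow> (g p, g q) \<in> le_h P"
    "(s p, s q) \<in> le_r N \<Longrightarrow> (g p, g q) \<in> le_r P" for p q
    using iso N(1) by (auto simp: dp_iso_def subposet_def g_def)
  show "\<not> no_N (le_h P) (le_r P)"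
    unfolding no_N_def not_not
    by (rule exI[of _ "g Pt_a"], rule exI[of _ "g Pt_c"], rule exI[of _ "g Pt_d"],
        rule exI[of _ "g Pt_b"]) (auto simp: g N intro!: h)
next
  assume "\<not> no_N (le_h P) (le_r P)"
  then obtain x w v b where d: "distinct [x, w, v, b]"
    and h: "(x, w) \<in> le_h P" "(x, v) \<in> le_h P" "(b, v) \<in> le_h P"
    and r: "(x, b) \<in> le_r P" "(w, b) \<in> le_r P" "(w, v) \<in> le_r P"
    unfolding no_N_def by blast
  have dp: "antisym (le_h P)" "antisym (le_r P)" "le_h P \<subseteq> verts P \<times> verts P"
    "le_r P \<subseteq> verts P \<times> verts P" "refl_on (verts P) (le_h P)" "refl_on (verts P) (le_r P)"
    using plane by (auto simp: plane_poset_def double_poset_def partial_order_on_def preorder_on_def)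
  have V: "x \<in> verts P" "w \<in> verts P" "v \<in> verts P" "b \<in> verts P" using h r dp by auto
  have pl: "((y, z) \<in> le_h P \<or> (z, y) \<in> le_h P) = (\<not> ((y, z) \<in> le_r P \<or> (z, y) \<in> le_r P))"
    if "y \<in> verts P" "z \<in> verts P" "y \<noteq> z" for y z
    using plane that by (auto simp: plane_poset_def h_comparable_def r_comparable_def)
  have nh: "(w, x) \<notin> le_h P" "(v, x) \<notin> le_h P" "(v, b) \<notin> le_h P"
    and nr: "(b, x) \<notin> le_r P" "(b, w) \<notin> le_r P" "(v, w) \<notin> le_r P"
    using h r d dp(1,2) unfolding antisym_def by auto
  have n2: "(w, x) \<notin> le_r P" "(v, x) \<notin> le_r P" "(v, b) \<notin> le_r P"
     "(x, w) \<notin> le_r P" "(x, v) \<notin> le_r P" "(b, v) \<notin> le_r P"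
     "(b, x) \<notin> le_h P" "(b, w) \<notin> le_h P" "(v, w) \<notin> le_h P"
     "(x, b) \<notin> le_h P" "(w, b) \<notin> le_h P" "(w, v) \<notin> le_h P"
    using pl[of x w] pl[of x v] pl[of b v] pl[of x b] pl[of w b] pl[of w v] h r d V by auto
  have rf: "(y, y) \<in> le_h P" "(y, y) \<in> le_r P" if "y \<in> verts P" for y
    using dp that by (auto simp: refl_on_def)
  define t where "t = the_inv s"
  have t: "t (s p) = p" for p unfolding t_def using N(2) by (simp add: bij_def the_inv_f_f)
  have st: "s (t y) = y" for y
    unfolding t_def using N(2) by (simp add: bij_def f_the_inv_into_f)
  define g where "g = case_four x b w v"
  define A where "A = {x, w, v, b}"
  have gA: "g p \<in> A" for p by (cases p) (auto simp: g_def A_def)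
  have ginj: "inj g"
  proof (rule injI)
    fix p q assume "g p = g q" then show "p = q" using d by (cases p; cases q) (auto simp: g_def)
  qed
  have gs: "range g = A"
  proof
    show "A \<subseteq> range g"
    proof
      fix y assume "y \<in> A"
      then have "y = g Pt_a \<or> y = g Pt_c \<or> y = g Pt_d \<or> y = g Pt_b" by (auto simp: g_def A_def)
      then show "y \<in> range g" by blast
    qed
  qed (use gA in blast)
  have H: "(s p, s q) \<in> le_h N \<longleftrightarrow> (g p, g q) \<in> le_h P" "(s p, s q) \<in> le_r N \<longleftrightarrow> (g p, g q) \<in> le_r P" for p q
  proof -
    have s: "s p = s q \<longleftrightarrow> p = q" for p q using N(2) by (simp add: bij_def inj_eq)
    show "(s p, s q) \<in> le_h N \<longleftrightarrow> (g p, g q) \<in> le_h P"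
      by (cases p; cases q) (auto simp: g_def s N h nh n2 rf V)
    show "(s p, s q) \<in> le_r N \<longleftrightarrow> (g p, g q) \<in> le_r P"
      by (cases p; cases q) (auto simp: g_def s N r nr n2 rf V)
  qed
  have "bij t" using N(2) t_def bij_betw_the_inv_into by metis
  then have "bij_betw (g \<circ> t) UNIV A"
    using ginj gs by (metis bij_betw_trans inj_on_imp_bij_betw)
  moreover have "A \<subseteq> verts P" using V by (auto simp: A_def)
  moreover have H': "(y, z) \<in> le_h N \<longleftrightarrow> (g (t y), g (t z)) \<in> le_h P" "(y, z) \<in> le_r N \<longleftrightarrow> (g (t y), g (t z)) \<in> le_r P" for y z
    using H[of "t y" "t z"] by (simp_all only: st)
  moreover have gA': "g (t y) \<in> A" for y by (rule gA)
  ultimately have "dp_iso N (subposet P A) (g \<circ> t)"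
    unfolding dp_iso_def by (simp add: H' gA' N(1) subposet_def)
  then have "dp_isomorphic (subposet P A) N"
    unfolding dp_isomorphic_def using dp_iso_sym by blast
  then show "\<exists>A\<subseteq>verts P. dp_isomorphic (subposet P A) N" using \<open>A \<subseteq> verts P\<close> by blast
qed

lemma iso_swap: "dp_isomorphic (P :: ('v, 'm) dposet_scheme) (Q :: ('w, 'n) dposet_scheme) \<longleftrightarrow>
    dp_isomorphic (\<lparr>verts = verts P, le_h = le_r P, le_r = le_h P\<rparr>) (\<lparr>verts = verts Q, le_h = le_r Q, le_r = le_h Q\<rparr>)"
  unfolding dp_isomorphic_def dp_iso_def by (rule iff_exI) auto

lemma WN_iff: "WN P \<longleftrightarrow> wn_rels (verts P) (le_h P) (le_r P)"
proof -
  let ?P' = "\<lparr>verts = verts P, le_h = le_r P, le_r = le_h P\<rparr>"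
  let ?N' = "\<lparr>verts = verts N2, le_h = le_r N2, le_r = le_h N2\<rparr>"
  have pl: "plane_poset P \<longleftrightarrow> finite (verts P) \<and> le_h P \<subseteq> verts P \<times> verts P \<and> le_r P \<subseteq> verts P \<times> verts P \<and>
     refl_on (verts P) (le_h P) \<and> refl_on (verts P) (le_r P) \<and>
     trans (le_h P) \<and> trans (le_r P) \<and> antisym (le_h P) \<and> antisym (le_r P) \<and>
     (\<forall>x\<in>verts P. \<forall>y\<in>verts P. x \<noteq> y \<longrightarrow> ((x, y) \<in> le_h P \<or> (y, x) \<in> le_h P) = (\<not> ((x, y) \<in> le_r P \<or> (y, x) \<in> le_r P)))"
    by (auto simp: plane_poset_def double_poset_def partial_order_on_def preorder_on_def h_comparable_def r_comparable_def)
  have 1: "(\<exists>A\<subseteq>verts P. dp_isomorphic (subposet P A) N1) \<longleftrightarrow> \<not> no_N (le_h P) (le_r P)" if "plane_poset P"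
    by (rule iso_N_iff[OF that, where s = id]) (auto simp: N1_def)
  have 2: "(\<exists>A\<subseteq>verts P. dp_isomorphic (subposet P A) N2) \<longleftrightarrow> \<not> no_N (le_r P) (le_h P)" if p: "plane_poset P"
  proof -
    have p': "plane_poset ?P'"
      using p by (auto simp: plane_poset_def double_poset_def h_comparable_def r_comparable_def)
    \<comment> \<open>the relabelling that exchanges \<open>b\<close> and \<open>c\<close> turns \<open>N\<^sub>1\<close> into \<open>N\<^sub>2\<close> with its orders exchanged\<close>
    let ?s = "case_four Pt_a Pt_c Pt_b Pt_d"
    have "bij ?s"
    proof (rule bijI)
      have "?s (?s p) = p" for p by (cases p) auto
      then show "inj ?s" "surj ?s" by (metis injI, metis surjI)
    qed
    then have "(\<exists>A\<subseteq>verts ?P'. dp_isomorphic (subposet ?P' A) ?N') \<longleftrightarrow> \<not> no_N (le_h ?P') (le_r ?P')"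
      by (intro iso_N_iff[OF p', where s = ?s]) (auto simp: N2_def)
    then show ?thesis
      by (subst iso_swap) (simp add: subposet_def)
  qed
  show ?thesis
  proof (cases "plane_poset P")
    case True
    then have "WN P \<longleftrightarrow> no_N (le_h P) (le_r P) \<and> no_N (le_r P) (le_h P)"
      unfolding WN_def using 1 2 by meson
    moreover have "wn_rels (verts P) (le_h P) (le_r P) \<longleftrightarrow> no_N (le_h P) (le_r P) \<and> no_N (le_r P) (le_h P)"
      using True unfolding pl wn_rels_def by simp
    ultimately show ?thesis by simp
  next
    case False
    moreover from this have "\<not> wn_rels (verts P) (le_h P) (le_r P)" unfolding pl wn_rels_def by simp
    ultimately show ?thesis by (simp add: WN_def)
  qed
qed

section \<open>Decomposition\<close>

lemma total_rel_has_max: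
  assumes "finite V" "V \<noteq> {}" "\<And>x y z. x \<in> V \<Longrightarrow> y \<in> V \<Longrightarrow> z \<in> V \<Longrightarrow> (x, y) \<in> R \<Longrightarrow> (y, z) \<in> R \<Longrightarrow> (x, z) \<in> R"
    "\<And>x y. x \<in> V \<Longrightarrow> y \<in> V \<Longrightarrow> (x, y) \<in> R \<or> (y, x) \<in> R"
  shows "\<exists>v\<in>V. \<forall>x\<in>V. (x, v) \<in> R"
  using assms
proof (induction V rule: finite_ne_induct)
  case (singleton x)
  then show ?case by blast
next
  case (insert a F)
  have "\<exists>v\<in>F. \<forall>x\<in>F. (x, v) \<in> R" by (rule insert.IH) (use insert.prems in blast)+
  then obtain v where v: "v \<in> F" "\<forall>x\<in>F. (x, v) \<in> R" by blast
  show ?case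
  proof (cases "(a, v) \<in> R")
    case True then show ?thesis using v by blast
  next
    case False
    then have "(v, a) \<in> R" "(a, a) \<in> R" using insert.prems(2) v by blast+
    moreover have "(x, a) \<in> R" if "x \<in> F" for x
      using insert.prems(1)[of x v a] v that \<open>(v, a) \<in> R\<close> by blast
    ultimately show ?thesis by blast
  qed
qed

text \<open>
  The union of the two orders is a total order.  Totality is planarity; for transitivity, if
  \<open>x <\<^sub>h y <\<^sub>r z\<close> and \<open>z\<close> were below \<open>x\<close>, then \<open>z <\<^sub>h y\<close> or \<open>y <\<^sub>r x\<close>, against planarity; the case
  \<open>x <\<^sub>r y <\<^sub>h z\<close> is similar.
\<close>

lemma wn_has_max:
  assumes wn: "wn_rels V h r" and "V \<noteq> {}"
  shows "\<exists>v\<in>V. \<forall>x\<in>V. (x, v) \<in> h \<or> (x, v) \<in> r"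
proof -
  have trh: "(x, z) \<in> h" if "(x, y) \<in> h" "(y, z) \<in> h" for x y z
    using wn that unfolding wn_rels_def trans_def by blast
  have trr: "(x, z) \<in> r" if "(x, y) \<in> r" "(y, z) \<in> r" for x y z
    using wn that unfolding wn_rels_def trans_def by blast
  have pl: "x \<noteq> y \<Longrightarrow> ((x, y) \<in> h \<or> (y, x) \<in> h) = (\<not> ((x, y) \<in> r \<or> (y, x) \<in> r))" if "x \<in> V" "y \<in> V" for x y
    using wn that unfolding wn_rels_def by blast
  have rf: "(x, x) \<in> h" "(x, x) \<in> r" if "x \<in> V" for x
    using wn that unfolding wn_rels_def refl_on_def by blast+
  have hr: "(x, z) \<in> h \<union> r"
    if V: "x \<in> V" "y \<in> V" "z \<in> V" and xy: "(x, y) \<in> h" and yz: "(y, z) \<in> r" for x y z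
  proof (rule ccontr)
    assume n: "(x, z) \<notin> h \<union> r"
    then have d: "x \<noteq> y" "y \<noteq> z" "x \<noteq> z" using xy yz rf V by auto
    then have "(z, x) \<in> h \<or> (z, x) \<in> r" using pl[of x z] V n by blast
    then have "(z, y) \<in> h \<or> (y, x) \<in> r" using trh trr xy yz by blast
    then show False using pl[of x y] pl[of y z] V d xy yz by blast
  qed
  have rh: "(x, z) \<in> h \<union> r"
    if V: "x \<in> V" "y \<in> V" "z \<in> V" and xy: "(x, y) \<in> r" and yz: "(y, z) \<in> h" for x y z
  proof (rule ccontr)
    assume n: "(x, z) \<notin> h \<union> r"
    then have d: "x \<noteq> y" "y \<noteq> z" "x \<noteq> z" using xy yz rf V by auto
    then have "(z, x) \<in> h \<or> (z, x) \<in> r" using pl[of x z] V n by blast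
    then have "(z, y) \<in> r \<or> (y, x) \<in> h" using trh trr xy yz by blast
    then show False using pl[of x y] pl[of y z] V d xy yz by blast
  qed
  have "\<exists>v\<in>V. \<forall>x\<in>V. (x, v) \<in> h \<union> r"
  proof (rule total_rel_has_max)
    fix x y z assume V: "x \<in> V" "y \<in> V" "z \<in> V" and xy: "(x, y) \<in> h \<union> r" and yz: "(y, z) \<in> h \<union> r"
    show "(x, z) \<in> h \<union> r"
      using hr[OF V] rh[OF V] trh trr xy yz by blast
  next
    fix x y assume "x \<in> V" "y \<in> V"
    then show "(x, y) \<in> h \<union> r \<or> (y, x) \<in> h \<union> r" using pl[of x y] rf by blast
  qed (use assms in \<open>auto simp: wn_rels_def\<close>)
  then show ?thesis by blast
qed

definition splits :: "'v rel \<Rightarrow> 'v set \<Rightarrow> 'v set \<Rightarrow> 'v set \<Rightarrow> bool" where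
  "splits h V A B \<longleftrightarrow> A \<noteq> {} \<and> B \<noteq> {} \<and> A \<union> B = V \<and> A \<inter> B = {} \<and> A \<times> B \<subseteq> h"

text \<open>
  The inductive step of the decomposition theorem, \<open>v\<close> being the largest element of the total order.
  Take the splitting of the rest with the smallest lower part \<open>A\<close>.  If \<open>A\<close> lies \<open>r\<close>-below \<open>v\<close>, then
  \<open>v\<close> joins the upper part; if everything lies \<open>h\<close>-below \<open>v\<close>, then \<open>v\<close> is an upper part on its own.
  Otherwise \<open>A\<close> has at least two points and splits itself: not for \<open>r\<close>, by minimality, hence for \<open>h\<close>;
  then transitivity yields points of both parts of \<open>A\<close> that form a forbidden pattern together with \<open>v\<close>
  and a point of the upper part.
\<close>

lemma wn_split_step:
  assumes wn: "wn_rels V h r" and v: "v \<in> V" "\<forall>x\<in>V. (x, v) \<in> h \<or> (x, v) \<in> r"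
    and spl: "splits r (V - {v}) A0 B0"
    and IH: "\<And>A. A \<subset> V \<Longrightarrow> 2 \<le> card A \<Longrightarrow> \<exists>A1 A2. splits h A A1 A2 \<or> splits r A A1 A2"
  shows "\<exists>A B. splits h V A B \<or> splits r V A B"
proof -
  have trh: "(x, z) \<in> h" if "(x, y) \<in> h" "(y, z) \<in> h" for x y z
    using wn that unfolding wn_rels_def trans_def by blast
  have trr: "(x, z) \<in> r" if "(x, y) \<in> r" "(y, z) \<in> r" for x y z
    using wn that unfolding wn_rels_def trans_def by blast
  have fin: "finite V" using wn by (simp add: wn_rels_def)
  obtain A B where AB: "splits r (V - {v}) A B"
    and least: "\<And>A' B'. splits r (V - {v}) A' B' \<Longrightarrow> card A \<le> card A'"
  proof -
    let ?S = "\<lambda>A. \<exists>B. splits r (V - {v}) A B"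
    have "?S A0" using spl by blast
    from ex_has_least_nat[of ?S, OF this, of card]
    show ?thesis using that by blast
  qed
  note AB' = AB[unfolded splits_def]
  show ?thesis
  proof (cases "(\<forall>x\<in>A. (x, v) \<in> r) \<or> (\<forall>x\<in>V - {v}. (x, v) \<in> h)")
    case True
    then show ?thesis
    proof
      assume "\<forall>x\<in>A. (x, v) \<in> r"
      then have "splits r V A (insert v B)" using AB' v unfolding splits_def by blast
      then show ?thesis by blast
    next
      assume "\<forall>x\<in>V - {v}. (x, v) \<in> h"
      then have "splits h V (V - {v}) {v}" using AB' v unfolding splits_def by blast
      then show ?thesis by blast
    qed
  next
    case False
    then obtain x0 w0 where x0: "x0 \<in> A" "(x0, v) \<notin> r" and w0: "w0 \<in> V - {v}" "(w0, v) \<notin> h" by blast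
    have x0h: "(x0, v) \<in> h" and w0r: "(w0, v) \<in> r" using x0 w0 v AB' by blast+
    have Bh: "(y, v) \<in> h" "(y, v) \<notin> r" if "y \<in> B" for y
    proof -
      have "(x0, y) \<in> r" using that x0 AB' by blast
      then show "(y, v) \<notin> r" using trr x0 by blast
      then show "(y, v) \<in> h" using v that AB' by blast
    qed
    then have w0A: "w0 \<in> A" using w0 AB' by blast
    have "x0 \<noteq> w0" using x0h w0 by blast
    moreover have finA: "finite A" using AB' fin by (metis Un_upper1 finite_Diff finite_subset)
    ultimately have "2 \<le> card A"
      using x0 w0A card_mono[of A "{x0, w0}"] by simp
    moreover have "A \<subset> V" using AB' v by blast
    ultimately obtain A1 A2 where "splits h A A1 A2 \<or> splits r A A1 A2" using IH by blast
    then show ?thesis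
    proof
      assume "splits r A A1 A2"
      note spA' = this[unfolded splits_def]
      have "splits r (V - {v}) A1 (A2 \<union> B)"
        unfolding splits_def using spA' AB' by (intro conjI) blast+
      then have "card A \<le> card A1" by (rule least)
      moreover have "card A1 < card A"
        by (rule psubset_card_mono[OF finA]) (use spA' in blast)
      ultimately show ?thesis by simp
    next
      assume spA: "splits h A A1 A2"
      note spA' = spA[unfolded splits_def]
      obtain a2 where a2: "a2 \<in> A2" using spA' by blast
      have "\<exists>w\<in>A2. (w, v) \<notin> h"
      proof (rule ccontr)
        assume *: "\<not> ?thesis"
        then have "w0 \<in> A1" using w0A w0 spA' by blast
        then have "(w0, a2) \<in> h" using a2 spA' by blast
        then show False using * a2 trh w0 by blast
      qed
      then obtain w where w: "w \<in> A2" "(w, v) \<notin> h" by blast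
      have wr: "(w, v) \<in> r" using w v spA' AB' by blast
      have A1h: "(x, v) \<notin> h" if "x \<in> A1" for x
      proof
        assume xv: "(x, v) \<in> h"
        obtain b where b: "b \<in> B" using AB' by blast
        have "distinct [x, w, v, b]" using that w b spA' AB' xv by auto
        moreover have "(x, w) \<in> h" "(x, b) \<in> r" "(w, b) \<in> r" using that w b spA' AB' by blast+
        ultimately have "\<not> no_N h r" using xv Bh[OF b] wr unfolding no_N_def by blast
        then show False using wn by (simp add: wn_rels_def)
      qed
      then have "x0 \<in> A2" using x0 x0h spA' by blast
      moreover obtain x where "x \<in> A1" using spA' by blast
      ultimately have "(x, x0) \<in> h" using spA' by blast
      then show ?thesis using trh x0h A1h \<open>x \<in> A1\<close> by blast
    qed
  qed
qed

lemma splits_mono: "splits h V A B \<Longrightarrow> h \<subseteq> h' \<Longrightarrow> splits h' V A B"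
  unfolding splits_def by blast

theorem wn_split:
  assumes "wn_rels V h r" "2 \<le> card V"
  shows "\<exists>A B. splits h V A B \<or> splits r V A B"
  using assms
proof (induction "card V" arbitrary: V h r rule: less_induct)
  case less
  note wn = less.prems(1)
  have fin: "finite V" using wn by (simp add: wn_rels_def)
  obtain v where v: "v \<in> V" "\<forall>x\<in>V. (x, v) \<in> h \<or> (x, v) \<in> r"
    using wn_has_max[OF wn] less.prems(2) by fastforce
  have v': "\<forall>x\<in>V. (x, v) \<in> r \<or> (x, v) \<in> h" using v by blast
  have IH: "\<exists>A1 A2. splits h A A1 A2 \<or> splits r A A1 A2" if "A \<subset> V" "2 \<le> card A" for A
  proof -
    have "card A < card V" using that fin psubset_card_mono by blast
    moreover have "wn_rels A (h \<inter> A \<times> A) (r \<inter> A \<times> A)" using wn_rels_restrict[OF wn] that by blast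
    ultimately have "\<exists>A1 A2. splits (h \<inter> A \<times> A) A A1 A2 \<or> splits (r \<inter> A \<times> A) A A1 A2"
      using less.hyps that by blast
    then show ?thesis using splits_mono[of _ A _ _] by (metis inf_le1)
  qed
  show ?case
  proof (cases "2 \<le> card (V - {v})")
    case True
    moreover have "V - {v} \<subset> V" using v by blast
    ultimately obtain A B where "splits h (V - {v}) A B \<or> splits r (V - {v}) A B" using IH by blast
    then show ?thesis
    proof
      assume "splits r (V - {v}) A B"
      then show ?thesis by (rule wn_split_step[OF wn v]) (use IH in blast)
    next
      assume "splits h (V - {v}) A B"
      then have "\<exists>A B. splits r V A B \<or> splits h V A B"
        by (rule wn_split_step[OF wn_rels_swap[OF wn] v(1) v']) (use IH in blast)
      then show ?thesis by blast
    qed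
  next
    case False
    then have "card (V - {v}) = 1" using less.prems(2) v fin by (simp add: card_Diff_singleton)
    then obtain u where u: "V - {v} = {u}" by (metis card_1_singletonE)
    then have V: "V = {u} \<union> {v}" "u \<noteq> v" using v by blast+
    then have "splits h V {u} {v} \<or> splits r V {u} {v}" using v unfolding splits_def by blast
    then show ?thesis by blast
  qed
qed

section \<open>Isomorphism classes\<close>

definition dec_iso :: "('v, 'd) ddposet \<Rightarrow> ('w, 'd) ddposet \<Rightarrow> ('v \<Rightarrow> 'w) \<Rightarrow> bool" where
  "dec_iso S T f \<longleftrightarrow> dp_iso S T f \<and> (\<forall>x\<in>verts S. dec T (f x) = dec S x)"

lemma ddp_isomorphic_iff: "ddp_isomorphic S T \<longleftrightarrow> (\<exists>f. dec_iso S T f)"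
  by (simp add: ddp_isomorphic_def dec_iso_def)

lemma subposet_simps [simp]:
  "verts (subposet S A) = A" "le_h (subposet S A) = le_h S \<inter> A \<times> A"
  "le_r (subposet S A) = le_r S \<inter> A \<times> A"
  by (simp_all add: subposet_def)

lemma dec_subposet [simp]: "dec (subposet S A) = dec S"
  by (simp add: subposet_def)

lemma map_prod_image_iff:
  assumes "inj_on f V" "R \<subseteq> V \<times> V" "x \<in> V" "y \<in> V"
  shows "(f x, f y) \<in> map_prod f f ` R \<longleftrightarrow> (x, y) \<in> R"
proof
  assume "(f x, f y) \<in> map_prod f f ` R"
  then obtain a b where "(a, b) \<in> R" "f x = f a" "f y = f b" by auto
  then show "(x, y) \<in> R" using assms by (metis SigmaD1 SigmaD2 inj_onD subsetD)
qed force

lemma subposet_subposet: "B \<subseteq> A \<Longrightarrow> subposet (subposet S A) B = subposet S B"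
proof -
  assume "B \<subseteq> A"
  then have "le_h S \<inter> A \<times> A \<inter> B \<times> B = le_h S \<inter> B \<times> B" "le_r S \<inter> A \<times> A \<inter> B \<times> B = le_r S \<inter> B \<times> B" by blast+
  then show ?thesis by (simp add: subposet_def)
qed

lemma dec_iso_sym: "dec_iso S T f \<Longrightarrow> dec_iso T S (the_inv_into (verts S) f)"
proof -
  assume f: "dec_iso S T f"
  then have bij: "bij_betw f (verts S) (verts T)" by (simp add: dp_iso_def dec_iso_def)
  have "f (the_inv_into (verts S) f y) = y" if "y \<in> verts T" for y
    using f_the_inv_into_f_bij_betw[OF bij] that by blast
  moreover have "the_inv_into (verts S) f y \<in> verts S" if "y \<in> verts T" for y
    using bij_betw_the_inv_into[OF bij] that bij_betwE by blast
  ultimately show ?thesis using f dp_iso_sym unfolding dec_iso_def by metis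
qed

lemma dec_iso_sub:
  assumes "dec_iso S T f" "A \<subseteq> verts S"
  shows "dec_iso (subposet S A) (subposet T (f ` A)) f"
proof -
  have "inj_on f A" using assms by (auto simp: dec_iso_def dp_iso_def bij_betw_def intro: inj_on_subset)
  then show ?thesis using assms unfolding dec_iso_def dp_iso_def
    by (auto simp: inj_on_imp_bij_betw subset_iff)
qed

lemma WN_sub: "WN S \<Longrightarrow> A \<subseteq> verts S \<Longrightarrow> WN (subposet S A)"
  using wn_rels_restrict by (auto simp: WN_iff)

lemma WN_rep: "WN (rp R)"
  using Quotient3_rel_rep[OF Quotient3_wnp, of R R] by (simp add: rp_def)

lemma rp_iso_iff: "ddp_isomorphic (rp P) (rp R) \<longleftrightarrow> P = R"
  using Quotient3_rel_rep[OF Quotient3_wnp, of P R] WN_rep by (auto simp: rp_def)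

lemma cls_eqI: "ddp_isomorphic (rp R) S \<Longrightarrow> cls S = R"
  unfolding cls_def
proof (rule the_equality)
  fix P assume "ddp_isomorphic (rp R) S" "ddp_isomorphic (rp P) S"
  then have "ddp_isomorphic (rp P) (rp R)" by (metis ddp_isomorphic_sym ddp_isomorphic_trans)
  then show "P = R" by (simp add: rp_iso_iff)
qed

lemma cls_rp [simp]: "cls (rp R) = R"
  by (rule cls_eqI) (rule ddp_isomorphic_refl)

lemma WN_finite: "WN S \<Longrightarrow> finite (verts S)"
  by (simp add: WN_iff wn_rels_def)

text \<open>
  The vertices of a finite poset can be renamed to natural numbers, so \<open>cls\<close> is meaningful for every
  WN poset, whatever the type of its vertices.
\<close>

lemma rp_cls:
  assumes "WN S"
  shows "ddp_isomorphic (rp (cls S)) S"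
proof -
  obtain f :: "'a \<Rightarrow> nat" where inj: "inj_on f (verts S)"
    using finite_imp_inj_to_nat_seg[OF WN_finite[OF assms]] by blast
  define T where "T = \<lparr>verts = f ` verts S, le_h = map_prod f f ` le_h S,
    le_r = map_prod f f ` le_r S, dec = dec S \<circ> the_inv_into (verts S) f\<rparr>"
  have sub: "le_h S \<subseteq> verts S \<times> verts S" "le_r S \<subseteq> verts S \<times> verts S"
    using assms by (auto simp: WN_iff wn_rels_def)
  have rel: "(x, y) \<in> le_h S \<longleftrightarrow> (f x, f y) \<in> le_h T" "(x, y) \<in> le_r S \<longleftrightarrow> (f x, f y) \<in> le_r T"
    if "x \<in> verts S" "y \<in> verts S" for x y
    using map_prod_image_iff[OF inj sub(1) that] map_prod_image_iff[OF inj sub(2) that] by (simp_all add: T_def)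
  have bij: "bij_betw f (verts S) (verts T)" using inj by (simp add: T_def bij_betw_def)
  have "wn_rels (verts T) (le_h T) (le_r T)"
    by (rule wn_rels_transport[OF _ bij rel(1) _ rel(2)])
      (use assms sub in \<open>auto simp: WN_iff T_def\<close>)
  then have WT: "WN T" by (simp add: WN_iff)
  have "dec_iso S T f"
    unfolding dec_iso_def dp_iso_def using bij rel inj by (auto simp: T_def the_inv_into_f_f)
  then have ST: "ddp_isomorphic S T" by (auto simp: ddp_isomorphic_iff)
  have "WN T \<and> ddp_isomorphic (rp (abs_wnp T)) T"
    using Quotient3_rep_abs[OF Quotient3_wnp, of T] WT ddp_isomorphic_refl by (auto simp: rp_def)
  then have *: "ddp_isomorphic (rp (abs_wnp T)) S"
    using ST by (metis ddp_isomorphic_sym ddp_isomorphic_trans)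
  then show ?thesis using cls_eqI[OF *] by simp
qed

lemma cls_cong: "WN S \<Longrightarrow> ddp_isomorphic S T \<Longrightarrow> cls T = cls S"
  by (metis cls_eqI ddp_isomorphic_trans rp_cls)

lemma cls_eq_iff: "WN S \<Longrightarrow> WN T \<Longrightarrow> cls S = cls T \<longleftrightarrow> ddp_isomorphic S T"
  by (metis cls_cong ddp_isomorphic_sym ddp_isomorphic_trans rp_cls)

lemma iso_rp_iff: "WN S \<Longrightarrow> ddp_isomorphic S (rp P) \<longleftrightarrow> cls S = P"
  using cls_eq_iff[OF _ WN_rep, of S P] by simp

section \<open>Statistics\<close>

text \<open>
  Both products add up the multisets of decorations.  This multiset determines the number of
  vertices, and the posets of \<open>WNP_Ind n\<close> are those in which it consists of \<open>1, \<dots>, n\<close>.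
\<close>

definition dec_mset :: "'d wnp \<Rightarrow> 'd multiset" where
  "dec_mset P = image_mset (dec (rp P)) (mset_set (verts (rp P)))"

text \<open>
  The grading used for triangularity: leading terms are those with the most \<open>h\<close>-relations.
\<close>

definition h_count :: "'d wnp \<Rightarrow> nat" where
  "h_count P = card (le_h (rp P))"

lemma dec_mset_cls:
  assumes "WN S"
  shows "dec_mset (cls S) = image_mset (dec S) (mset_set (verts S))"
proof -
  obtain f where f: "dec_iso (rp (cls S)) S f" using rp_cls[OF assms] by (auto simp: ddp_isomorphic_iff)
  let ?V = "verts (rp (cls S))"
  have *: "inj_on f ?V" "f ` ?V = verts S" using f by (auto simp: dec_iso_def dp_iso_def bij_betw_def)
  have "image_mset (dec S) (mset_set (verts S)) = image_mset (dec S) (image_mset f (mset_set ?V))"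
    using * image_mset_mset_set by metis
  also have "\<dots> = dec_mset (cls S)"
    unfolding dec_mset_def multiset.map_comp
    by (rule image_mset_cong) (use f WN_finite[OF WN_rep, of "cls S"] in \<open>auto simp: dec_iso_def\<close>)
  finally show ?thesis by simp
qed

lemma size_dec_mset_cls: "WN S \<Longrightarrow> size (dec_mset (cls S)) = card (verts S)"
  by (simp add: dec_mset_cls)

lemma h_count_cls:
  assumes "WN S"
  shows "h_count (cls S) = card (le_h S)"
proof -
  obtain f where f: "dec_iso (rp (cls S)) S f" using rp_cls[OF assms] by (auto simp: ddp_isomorphic_iff)
  let ?T = "rp (cls S)"
  have inj: "inj_on f (verts ?T)" and im: "f ` verts ?T = verts S"
    using f by (auto simp: dec_iso_def dp_iso_def bij_betw_def)
  have sub: "le_h S \<subseteq> verts S \<times> verts S" "le_h ?T \<subseteq> verts ?T \<times> verts ?T"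
    using assms WN_rep[of "cls S"] by (auto simp: WN_iff wn_rels_def)
  have "inj_on (map_prod f f) (le_h ?T)"
    using inj_on_subset[OF map_prod_inj_on[OF inj inj] sub(2)] .
  moreover have "map_prod f f ` le_h ?T = le_h S"
  proof
    show "map_prod f f ` le_h ?T \<subseteq> le_h S" using f sub(2) by (auto simp: dec_iso_def dp_iso_def)
    show "le_h S \<subseteq> map_prod f f ` le_h ?T"
    proof
      fix p assume p: "p \<in> le_h S"
      then obtain x y where "x \<in> verts ?T" "y \<in> verts ?T" "p = (f x, f y)" using sub(1) im by blast
      then have "(x, y) \<in> le_h ?T" using p f by (auto simp: dec_iso_def dp_iso_def)
      then show "p \<in> map_prod f f ` le_h ?T" using \<open>p = _\<close> by force
    qed
  qed
  ultimately show ?thesis unfolding h_count_def by (metis card_image)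
qed

lemma dec_mset_partition:
  assumes S: "WN S" and AB: "A \<union> B = verts S" "A \<inter> B = {}"
  shows "dec_mset (cls S) = dec_mset (cls (subposet S A)) + dec_mset (cls (subposet S B))"
proof -
  have "finite A" "finite B" using WN_finite[OF S] AB by (metis finite_Un)+
  then show ?thesis
    using AB WN_sub[OF S] by (simp add: dec_mset_cls S mset_set_Union flip: AB(1) image_mset_union)
qed

lemma h_count_partition:
  assumes S: "WN S" and AB: "A \<union> B = verts S" "A \<inter> B = {}" and BA: "le_h S \<inter> B \<times> A = {}"
  shows "h_count (cls S) = h_count (cls (subposet S A)) + h_count (cls (subposet S B)) + card (le_h S \<inter> A \<times> B)"
proof -
  have "finite A" "finite B" using WN_finite[OF S] AB by (metis finite_Un)+
  then have fin: "finite (le_h S \<inter> A \<times> A)" "finite (le_h S \<inter> B \<times> B)" "finite (le_h S \<inter> A \<times> B)" by auto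
  have "le_h S \<subseteq> verts S \<times> verts S" using S by (auto simp: WN_iff wn_rels_def)
  then have "le_h S = ((le_h S \<inter> A \<times> A) \<union> (le_h S \<inter> B \<times> B)) \<union> (le_h S \<inter> A \<times> B)"
    using AB BA by blast
  then have "card (le_h S) = card (((le_h S \<inter> A \<times> A) \<union> (le_h S \<inter> B \<times> B)) \<union> (le_h S \<inter> A \<times> B))" by simp
  also have "\<dots> = card ((le_h S \<inter> A \<times> A) \<union> (le_h S \<inter> B \<times> B)) + card (le_h S \<inter> A \<times> B)"
    by (rule card_Un_disjoint) (use fin AB in auto)
  also have "card ((le_h S \<inter> A \<times> A) \<union> (le_h S \<inter> B \<times> B)) = card (le_h S \<inter> A \<times> A) + card (le_h S \<inter> B \<times> B)"
    by (rule card_Un_disjoint) (use fin AB in auto)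
  finally show ?thesis
    using AB WN_sub[OF S, of A] WN_sub[OF S, of B] by (simp add: h_count_cls S flip: AB(1))
qed

text \<open>
  A poset with \<open>n\<close> vertices is isomorphic to one on \<open>{..<n}\<close>, which leaves finitely many choices
  of relations and decorations.
\<close>

lemma finite_dec_mset_eq: "finite {R :: 'd wnp. dec_mset R = M}"
proof -
  let ?n = "size M"
  let ?X = "Pow ({..<?n} \<times> {..<?n}) \<times> Pow ({..<?n} \<times> {..<?n}) \<times> {xs :: 'd list. set xs \<subseteq> set_mset M \<and> length xs = ?n}"
  let ?F = "\<lambda>(h, r, xs). cls \<lparr>verts = {..<?n}, le_h = h, le_r = r, dec = (\<lambda>i. xs ! i)\<rparr>"
  have "finite ?X" by (intro finite_cartesian_product finite_lists_length_eq) auto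
  moreover have "{R. dec_mset R = M} \<subseteq> ?F ` ?X"
  proof
    fix R :: "'d wnp" assume "R \<in> {R. dec_mset R = M}"
    then have R: "dec_mset R = M" by simp
    let ?S = "rp R"
    have fin: "finite (verts ?S)" using WN_finite[OF WN_rep] .
    have "card (verts ?S) = ?n" using size_dec_mset_cls[OF WN_rep, of R] R by simp
    then obtain f where f: "bij_betw f (verts ?S) {..<?n}"
      using ex_bij_betw_finite_nat[OF fin] by (auto simp: atLeast0LessThan)
    define g where "g = the_inv_into (verts ?S) f"
    have gf: "g (f x) = x" if "x \<in> verts ?S" for x
      using that f by (simp add: g_def bij_betw_def the_inv_into_f_f)
    have gV: "g i \<in> verts ?S" if "i < ?n" for i
      using bij_betw_the_inv_into[OF f] that bij_betwE unfolding g_def by blast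
    have fV: "f x < ?n" if "x \<in> verts ?S" for x using f that bij_betwE by blast
    have sub: "le_h ?S \<subseteq> verts ?S \<times> verts ?S" "le_r ?S \<subseteq> verts ?S \<times> verts ?S"
      using WN_rep[of R] by (auto simp: WN_iff wn_rels_def)
    define xs where "xs = map (\<lambda>i. dec ?S (g i)) [0..<?n]"
    let ?h = "map_prod f f ` le_h ?S" let ?r = "map_prod f f ` le_r ?S"
    have inj: "inj_on f (verts ?S)" using f by (simp add: bij_betw_def)
    have "dec ?S x \<in> set_mset M" if "x \<in> verts ?S" for x
      using that fin R by (auto simp: dec_mset_def)
    then have "set xs \<subseteq> set_mset M" using gV by (auto simp: xs_def)
    moreover have "?h \<subseteq> {..<?n} \<times> {..<?n}" "?r \<subseteq> {..<?n} \<times> {..<?n}" using sub fV by auto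
    ultimately have X: "(?h, ?r, xs) \<in> ?X" by (simp add: xs_def)
    have "dec_iso ?S \<lparr>verts = {..<?n}, le_h = ?h, le_r = ?r, dec = (\<lambda>i. xs ! i)\<rparr> f"
      unfolding dec_iso_def dp_iso_def using f fV gf
      by (simp add: xs_def map_prod_image_iff[OF inj sub(1)] map_prod_image_iff[OF inj sub(2)])
    then have "?F (?h, ?r, xs) = R" by (auto simp: ddp_isomorphic_iff intro!: cls_eqI)
    then show "R \<in> ?F ` ?X" by (rule image_eqI[OF sym X])
  qed
  ultimately show ?thesis by (rule finite_surj)
qed

lemma decs_conv: "decs P = set_mset (dec_mset P)"
  using WN_finite[OF WN_rep, of P] by (simp add: decs_def dec_mset_def)

lemma WNP_Ind_iff: "P \<in> WNP_Ind n \<longleftrightarrow> dec_mset P = mset_set {1..n}"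
proof
  assume "P \<in> WNP_Ind n"
  then show "dec_mset P = mset_set {1..n}"
    by (auto simp: WNP_Ind_def dec_mset_def bij_betw_def image_mset_mset_set)
next
  assume a: "dec_mset P = mset_set {1..n}"
  have fin: "finite (verts (rp P))" using WN_finite[OF WN_rep] .
  have c: "card (verts (rp P)) = n" using a size_dec_mset_cls[OF WN_rep, of P] by simp
  have im: "dec (rp P) ` verts (rp P) = {1..n}"
    using decs_conv[of P] a by (simp add: decs_def)
  then have "inj_on (dec (rp P)) (verts (rp P))"
    using c by (intro eq_card_imp_inj_on fin) simp
  then show "P \<in> WNP_Ind n" using c im by (simp add: WNP_Ind_def bij_betw_def)
qed

section \<open>Layered posets\<close>

definition rel_of :: "two_ops \<Rightarrow> ('v, 'm) dposet_scheme \<Rightarrow> 'v rel" where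
  "rel_of q S = (case q of Op1 \<Rightarrow> le_h S | Op2 \<Rightarrow> le_r S)"

lemma two_ops_all: "(\<forall>p. P p) \<longleftrightarrow> P Op1 \<and> P Op2"
  by (metis two_ops.exhaust)

text \<open>
  The two joins put the first poset entirely below the second one for one of the orders; \<open>Op2\<close>
  stands for \<open>r\<close> and gives \<open>squig\<close>.
\<close>

definition join_union :: "two_ops \<Rightarrow> ('v, 'd) ddposet \<Rightarrow> ('w, 'd) ddposet \<Rightarrow> ('v + 'w, 'd) ddposet" where
  "join_union q S T = \<lparr>
     verts = Inl ` verts S \<union> Inr ` verts T,
     le_h = map_prod Inl Inl ` le_h S \<union> map_prod Inr Inr ` le_h T \<union>
            (if q = Op1 then (Inl ` verts S) \<times> (Inr ` verts T) else {}),
     le_r = map_prod Inl Inl ` le_r S \<union> map_prod Inr Inr ` le_r T \<union>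
            (if q = Op2 then (Inl ` verts S) \<times> (Inr ` verts T) else {}),
     dec = case_sum (dec S) (dec T) \<rparr>"

definition join :: "two_ops \<Rightarrow> 'd wnp \<Rightarrow> 'd wnp \<Rightarrow> 'd wnp" where
  "join q P Q = cls (join_union q (rp P) (rp Q))"

lemma squig_eq_join: "squig P Q = join Op2 P Q"
  by (simp add: squig_def join_def squig_union_def join_union_def)

lemma join_union_rels [simp]:
  "Inl x \<in> verts (join_union q S T) \<longleftrightarrow> x \<in> verts S"
  "Inr y \<in> verts (join_union q S T) \<longleftrightarrow> y \<in> verts T"
  "(Inl x, Inl x') \<in> le_h (join_union q S T) \<longleftrightarrow> (x, x') \<in> le_h S"
  "(Inr y, Inr y') \<in> le_h (join_union q S T) \<longleftrightarrow> (y, y') \<in> le_h T"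
  "(Inl x, Inr y) \<in> le_h (join_union q S T) \<longleftrightarrow> q = Op1 \<and> x \<in> verts S \<and> y \<in> verts T"
  "(Inr y, Inl x) \<notin> le_h (join_union q S T)"
  "(Inl x, Inl x') \<in> le_r (join_union q S T) \<longleftrightarrow> (x, x') \<in> le_r S"
  "(Inr y, Inr y') \<in> le_r (join_union q S T) \<longleftrightarrow> (y, y') \<in> le_r T"
  "(Inl x, Inr y) \<in> le_r (join_union q S T) \<longleftrightarrow> q = Op2 \<and> x \<in> verts S \<and> y \<in> verts T"
  "(Inr y, Inl x) \<notin> le_r (join_union q S T)"
  "dec (join_union q S T) (Inl x) = dec S x"
  "dec (join_union q S T) (Inr y) = dec T y"
  by (auto simp: join_union_def image_iff map_prod_def split: prod.splits)

lemma rel_of_join_union: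
  "(Inl x, Inl x') \<in> rel_of p (join_union q S T) \<longleftrightarrow> (x, x') \<in> rel_of p S"
  "(Inr y, Inr y') \<in> rel_of p (join_union q S T) \<longleftrightarrow> (y, y') \<in> rel_of p T"
  "(Inl x, Inr y) \<in> rel_of p (join_union q S T) \<longleftrightarrow> q = p \<and> x \<in> verts S \<and> y \<in> verts T"
  "(Inr y, Inl x) \<notin> rel_of p (join_union q S T)"
  by (cases p; auto simp: rel_of_def)+

lemma WN_rel_of:
  "WN S \<longleftrightarrow> finite (verts S) \<and> (\<forall>p. rel_of p S \<subseteq> verts S \<times> verts S \<and> refl_on (verts S) (rel_of p S) \<and>
       trans (rel_of p S) \<and> antisym (rel_of p S)) \<and>
     (\<forall>x\<in>verts S. \<forall>y\<in>verts S. x \<noteq> y \<longrightarrow> ((x, y) \<in> le_h S \<or> (y, x) \<in> le_h S) = (\<not> ((x, y) \<in> le_r S \<or> (y, x) \<in> le_r S))) \<and>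
     (\<forall>p p'. p \<noteq> p' \<longrightarrow> no_N (rel_of p S) (rel_of p' S))"
  unfolding WN_iff wn_rels_def two_ops_all rel_of_def by auto

lemma WN_join_union:
  assumes S: "WN S" and T: "WN T"
  shows "WN (join_union q S T)"
proof -
  let ?J = "join_union q S T"
  let ?r = "\<lambda>p. rel_of p ?J"
  note wS = S[unfolded WN_rel_of] and wT = T[unfolded WN_rel_of]
  note ju = rel_of_join_union
  have sub: "(x, y) \<in> rel_of p S \<Longrightarrow> x \<in> verts S \<and> y \<in> verts S"
    "(x', y') \<in> rel_of p T \<Longrightarrow> x' \<in> verts T \<and> y' \<in> verts T" for x y x' y' p
    using wS wT by blast+
  have "finite (verts ?J)" using S T by (simp add: join_union_def WN_finite)
  moreover have "?r p \<subseteq> verts ?J \<times> verts ?J" for p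
  proof (rule subrelI)
    fix x y assume "(x, y) \<in> ?r p"
    then show "(x, y) \<in> verts ?J \<times> verts ?J" using sub by (cases x; cases y) (auto simp: ju)
  qed
  moreover have "refl_on (verts ?J) (?r p)" for p
  proof (rule refl_onI)
    fix x assume "x \<in> verts ?J"
    then show "(x, x) \<in> ?r p" using wS wT by (cases x) (auto simp: ju refl_on_def)
  qed
  moreover have "trans (?r p)" for p
  proof (rule transI)
    fix x y z assume "(x, y) \<in> ?r p" "(y, z) \<in> ?r p"
    moreover have "trans (rel_of p S)" "trans (rel_of p T)" using wS wT by blast+
    ultimately show "(x, z) \<in> ?r p"
      using sub by (cases x; cases y; cases z) (auto simp: ju dest: transD)
  qed
  moreover have "antisym (?r p)" for p
  proof (rule antisymI)
    fix x y assume "(x, y) \<in> ?r p" "(y, x) \<in> ?r p"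
    moreover have "antisym (rel_of p S)" "antisym (rel_of p T)" using wS wT by blast+
    ultimately show "x = y" by (cases x; cases y) (auto simp: ju dest: antisymD)
  qed
  moreover have "\<forall>x\<in>verts ?J. \<forall>y\<in>verts ?J. x \<noteq> y \<longrightarrow>
     ((x, y) \<in> le_h ?J \<or> (y, x) \<in> le_h ?J) = (\<not> ((x, y) \<in> le_r ?J \<or> (y, x) \<in> le_r ?J))"
  proof (intro ballI impI)
    fix x y assume "x \<in> verts ?J" "y \<in> verts ?J" "x \<noteq> y"
    then show "((x, y) \<in> le_h ?J \<or> (y, x) \<in> le_h ?J) = (\<not> ((x, y) \<in> le_r ?J \<or> (y, x) \<in> le_r ?J))"
      using wS wT by (cases x; cases y; cases q) simp_all
  qed
  moreover have "no_N (?r p) (?r p')" if neq: "p \<noteq> p'" for p p'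
    unfolding no_N_def
  proof (intro notI, elim exE conjE)
    fix x w v b
    assume *: "distinct [x, w, v, b]" "(x, w) \<in> ?r p" "(x, v) \<in> ?r p" "(b, v) \<in> ?r p"
      "(x, b) \<in> ?r p'" "(w, b) \<in> ?r p'" "(w, v) \<in> ?r p'"
    have n: "no_N (rel_of p S) (rel_of p' S)" "no_N (rel_of p T) (rel_of p' T)" using wS wT neq by blast+
    \<comment> \<open>The pattern is connected for both relations, and one of them has no arrows between the summands.\<close>
    have "isl w = isl x \<and> isl v = isl x \<and> isl b = isl x"
    proof (cases "q = p")
      case True
      then show ?thesis using *(5-7) neq by (cases x; cases w; cases v; cases b) (simp_all add: ju)
    next
      case False
      then show ?thesis using *(2-4) by (cases x; cases w; cases v; cases b) (simp_all add: ju)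
    qed
    then consider x' w' v' b' where "x = Inl x'" "w = Inl w'" "v = Inl v'" "b = Inl b'"
      | x' w' v' b' where "x = Inr x'" "w = Inr w'" "v = Inr v'" "b = Inr b'"
      by (cases x; cases w; cases v; cases b) simp_all
    then show False
    proof cases
      case (1 x' w' v' b')
      have "distinct [x', w', v', b']" using *(1) unfolding 1 by simp
      moreover note *(2-7)[unfolded 1 ju]
      ultimately have "\<not> no_N (rel_of p S) (rel_of p' S)" unfolding no_N_def by blast
      then show False using n by simp
    next
      case (2 x' w' v' b')
      have "distinct [x', w', v', b']" using *(1) unfolding 2 by simp
      moreover note *(2-7)[unfolded 2 ju]
      ultimately have "\<not> no_N (rel_of p T) (rel_of p' T)" unfolding no_N_def by blast
      then show False using n by simp
    qed
  qed
  ultimately show ?thesis unfolding WN_rel_of by blast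
qed

text \<open>
  Empty layers are admitted, which covers joins with the empty poset.
\<close>

definition layered :: "two_ops \<Rightarrow> ('v, 'm) dposet_scheme \<Rightarrow> 'v set \<Rightarrow> 'v set \<Rightarrow> bool" where
  "layered q S A B \<longleftrightarrow> A \<union> B = verts S \<and> A \<inter> B = {} \<and> A \<times> B \<subseteq> rel_of q S"

text \<open>
  By planarity the relation between the layers for one order fixes all relations between them.
\<close>

lemma layered_rels:
  assumes S: "WN S" and l: "layered q S A B" and ab: "a \<in> A" "b \<in> B"
  shows "(a, b) \<in> le_h S \<longleftrightarrow> q = Op1" "(a, b) \<in> le_r S \<longleftrightarrow> q = Op2"
    "(b, a) \<notin> le_h S" "(b, a) \<notin> le_r S"
proof -
  have V: "a \<in> verts S" "b \<in> verts S" "a \<noteq> b" and r: "(a, b) \<in> rel_of q S"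
    using l ab by (auto simp: layered_def)
  have pl: "((a, b) \<in> le_h S \<or> (b, a) \<in> le_h S) = (\<not> ((a, b) \<in> le_r S \<or> (b, a) \<in> le_r S))"
    using V S by (auto simp: WN_iff wn_rels_def)
  have an: "antisym (le_h S)" "antisym (le_r S)" using S by (auto simp: WN_iff wn_rels_def)
  have ah: "(a, b) \<in> le_h S \<Longrightarrow> (b, a) \<notin> le_h S" using an(1) V(3) by (auto dest: antisymD)
  have ar: "(a, b) \<in> le_r S \<Longrightarrow> (b, a) \<notin> le_r S" using an(2) V(3) by (auto dest: antisymD)
  show "(a, b) \<in> le_h S \<longleftrightarrow> q = Op1" "(a, b) \<in> le_r S \<longleftrightarrow> q = Op2"
    "(b, a) \<notin> le_h S" "(b, a) \<notin> le_r S"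
    using r pl ah ar by (cases q; simp add: rel_of_def; blast)+
qed

text \<open>
  This lemma and the next one describe joins without representatives: they are the same as
  layerings of an arbitrary poset of the class.
\<close>

lemma cls_layered:
  assumes S: "WN S" and l: "layered q S A B"
  shows "cls S = join q (cls (subposet S A)) (cls (subposet S B))"
proof -
  have A: "A \<subseteq> verts S" "B \<subseteq> verts S" "A \<inter> B = {}" "verts S = A \<union> B" using l by (auto simp: layered_def)
  let ?P = "rp (cls (subposet S A))" and ?Q = "rp (cls (subposet S B))"
  obtain f g where f: "dec_iso ?P (subposet S A) f" and g: "dec_iso ?Q (subposet S B) g"
    using rp_cls[OF WN_sub[OF S A(1)]] rp_cls[OF WN_sub[OF S A(2)]] by (auto simp: ddp_isomorphic_iff)
  have fi: "inj_on f (verts ?P)" "f ` verts ?P = A" and gi: "inj_on g (verts ?Q)" "g ` verts ?Q = B"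
    using f g by (auto simp: dec_iso_def dp_iso_def bij_betw_def)
  have fA: "f x \<in> A" if "x \<in> verts ?P" for x using that fi by blast
  have gB: "g x \<in> B" if "x \<in> verts ?Q" for x using that gi by blast
  let ?J = "join_union q ?P ?Q" and ?k = "case_sum f g"
  have "dec_iso ?J S ?k"
    unfolding dec_iso_def dp_iso_def
  proof (intro conjI ballI)
    show "bij_betw ?k (verts ?J) (verts S)"
      unfolding bij_betw_def
    proof
      show "inj_on ?k (verts ?J)"
      proof (rule inj_onI)
        fix x y assume "x \<in> verts ?J" "y \<in> verts ?J" "?k x = ?k y"
        then show "x = y"
          using fi(1) gi(1) fA gB A(3) by (cases x; cases y) (auto dest: inj_onD, (metis disjoint_iff)+)
      qed
      show "?k ` verts ?J = verts S"
        using fi(2) gi(2) A(4) by (simp add: join_union_def image_Un image_image)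
    qed
    fix x y assume x: "x \<in> verts ?J" and y: "y \<in> verts ?J"
    show "((x, y) \<in> le_h ?J) = ((?k x, ?k y) \<in> le_h S)"
      using x y f g fA gB layered_rels[OF S l]
      by (cases x; cases y) (auto simp: dec_iso_def dp_iso_def)
    show "((x, y) \<in> le_r ?J) = ((?k x, ?k y) \<in> le_r S)"
      using x y f g fA gB layered_rels[OF S l]
      by (cases x; cases y) (auto simp: dec_iso_def dp_iso_def)
  next
    fix x assume "x \<in> verts ?J"
    then show "dec S (?k x) = dec ?J x"
      using f g by (cases x) (auto simp: dec_iso_def)
  qed
  then show ?thesis
    unfolding join_def
    by (intro cls_cong WN_join_union WN_rep) (auto simp: ddp_isomorphic_iff)
qed

lemma layered_of_join:
  assumes S: "WN S" and eq: "cls S = join q P Q"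
  shows "\<exists>A B. layered q S A B \<and> cls (subposet S A) = P \<and> cls (subposet S B) = Q"
proof -
  let ?J = "join_union q (rp P) (rp Q)"
  have J: "WN ?J" by (intro WN_join_union WN_rep)
  then obtain f where f: "dec_iso ?J S f"
    using eq S cls_eq_iff[OF J S] by (auto simp: join_def ddp_isomorphic_iff)
  let ?A = "Inl ` verts (rp P)" and ?B = "Inr ` verts (rp Q)"
  have V: "verts ?J = ?A \<union> ?B" by (simp add: join_union_def)
  have fi: "inj_on f (verts ?J)" "f ` verts ?J = verts S"
    using f by (auto simp: dec_iso_def dp_iso_def bij_betw_def)
  have "f ` ?A \<inter> f ` ?B = f ` (?A \<inter> ?B)"
    using inj_on_image_Int[OF fi(1), of ?A ?B] V by auto
  then have "f ` ?A \<inter> f ` ?B = {}" by auto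
  moreover have "f ` ?A \<union> f ` ?B = verts S" using fi V by (metis image_Un)
  moreover have "f ` ?A \<times> f ` ?B \<subseteq> rel_of q S"
  proof -
    have "(f (Inl x), f (Inr y)) \<in> rel_of q S" if "x \<in> verts (rp P)" "y \<in> verts (rp Q)" for x y
    proof -
      have "Inl x \<in> verts ?J" "Inr y \<in> verts ?J" using that by simp_all
      then have "(Inl x, Inr y) \<in> rel_of q ?J \<longleftrightarrow> (f (Inl x), f (Inr y)) \<in> rel_of q S"
        using f unfolding dec_iso_def dp_iso_def rel_of_def by (cases q) (simp only: two_ops.case; blast)+
      then show ?thesis using that by (cases q) (auto simp: rel_of_def)
    qed
    then show ?thesis by auto
  qed
  ultimately have "layered q S (f ` ?A) (f ` ?B)" by (simp add: layered_def)
  moreover have "cls (subposet S (f ` ?A)) = P"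
  proof -
    have "dec_iso (rp P) (subposet ?J ?A) Inl" "dec_iso (subposet ?J ?A) (subposet S (f ` ?A)) f"
      using dec_iso_sub[OF f, of ?A] V by (auto simp: dec_iso_def dp_iso_def bij_betw_def)
    then show ?thesis
      by (intro cls_eqI) (metis ddp_isomorphic_iff ddp_isomorphic_trans)
  qed
  moreover have "cls (subposet S (f ` ?B)) = Q"
  proof -
    have "dec_iso (rp Q) (subposet ?J ?B) Inr" "dec_iso (subposet ?J ?B) (subposet S (f ` ?B)) f"
      using dec_iso_sub[OF f, of ?B] V by (auto simp: dec_iso_def dp_iso_def bij_betw_def)
    then show ?thesis
      by (intro cls_eqI) (metis ddp_isomorphic_iff ddp_isomorphic_trans)
  qed
  ultimately show ?thesis by blast
qed

lemma layered_joinE: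
  obtains A B where "layered q (rp (join q P Q)) A B"
    "cls (subposet (rp (join q P Q)) A) = P" "cls (subposet (rp (join q P Q)) B) = Q"
  using layered_of_join[OF WN_rep, of "join q P Q" q P Q] by auto

text \<open>
  Both sides are the join of the same three consecutive layers.
\<close>

lemma join_assoc: "join q (join q P Q) R = join q P (join q Q R)"
proof -
  let ?S = "rp (join q (join q P Q) R)"
  have S: "WN ?S" by (rule WN_rep)
  obtain AB C where l: "layered q ?S AB C" "cls (subposet ?S AB) = join q P Q" "cls (subposet ?S C) = R"
    by (rule layered_joinE)
  have ABV: "AB \<subseteq> verts ?S" using l by (auto simp: layered_def)
  obtain A B where l2: "layered q (subposet ?S AB) A B"
    "cls (subposet (subposet ?S AB) A) = P" "cls (subposet (subposet ?S AB) B) = Q"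
    using layered_of_join[OF WN_sub[OF S ABV] l(2)] by blast
  have AB: "A \<subseteq> AB" "B \<subseteq> AB" "A \<union> B = AB" "A \<inter> B = {}" using l2 by (auto simp: layered_def)
  have V: "B \<union> C \<subseteq> verts ?S" using l AB by (auto simp: layered_def)
  have "layered q ?S A (B \<union> C)"
    using l(1) l2(1) by (cases q) (auto simp: layered_def rel_of_def)
  moreover have "layered q (subposet ?S (B \<union> C)) B C"
    using l(1) l2(1) by (cases q) (auto simp: layered_def rel_of_def)
  from cls_layered[OF WN_sub[OF S V] this] have "cls (subposet ?S (B \<union> C)) = join q Q R"
    using l(3) l2(3) by (simp add: subposet_subposet AB)
  ultimately show ?thesis
    using cls_layered[OF S, of q A "B \<union> C"] l2(2) by (simp add: subposet_subposet AB)
qed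

lemma dec_mset_join: "dec_mset (join q P Q) = dec_mset P + dec_mset Q"
proof -
  obtain A B where l: "layered q (rp (join q P Q)) A B"
    "cls (subposet (rp (join q P Q)) A) = P" "cls (subposet (rp (join q P Q)) B) = Q"
    by (rule layered_joinE)
  then show ?thesis using dec_mset_partition[OF WN_rep, of A B "join q P Q"] by (simp add: layered_def)
qed

lemma h_count_join: "h_count (join q P Q) = h_count P + h_count Q + (if q = Op1 then size (dec_mset P) * size (dec_mset Q) else 0)"
proof -
  let ?S = "rp (join q P Q)"
  obtain A B where l: "layered q ?S A B" "cls (subposet ?S A) = P" "cls (subposet ?S B) = Q"
    by (rule layered_joinE)
  have AB: "A \<union> B = verts ?S" "A \<inter> B = {}" "A \<subseteq> verts ?S" "B \<subseteq> verts ?S" using l(1) by (auto simp: layered_def)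
  have sz: "size (dec_mset P) = card A" "size (dec_mset Q) = card B"
    using l(2,3) size_dec_mset_cls[OF WN_sub[OF WN_rep AB(3)]] size_dec_mset_cls[OF WN_sub[OF WN_rep AB(4)]] by auto
  have "le_h ?S \<inter> B \<times> A = {}" using layered_rels(3)[OF WN_rep l(1)] by blast
  then have "h_count (join q P Q) = h_count P + h_count Q + card (le_h ?S \<inter> A \<times> B)"
    using h_count_partition[OF WN_rep AB(1,2)] l by simp
  moreover have "le_h ?S \<inter> A \<times> B = (if q = Op1 then A \<times> B else {})"
    using layered_rels(1)[OF WN_rep l(1)] by auto
  ultimately show ?thesis by (simp add: sz card_cartesian_product)
qed

text \<open>
  The decomposition theorem in terms of classes.
\<close>

lemma WN_nonempty_decompose:
  assumes S: "WN S" and "verts S \<noteq> {}"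
  shows "(\<exists>d. cls S = dot d) \<or>
    (\<exists>q A B. layered q S A B \<and> A \<noteq> {} \<and> B \<noteq> {})"
proof (cases "card (verts S) = 1")
  case True
  then obtain x where x: "verts S = {x}" by (metis card_1_singletonE)
  have "le_h S = {(x, x)}" "le_r S = {(x, x)}"
    using S x by (auto simp: WN_iff wn_rels_def refl_on_def)
  then have "dec_iso S \<lparr>verts = {()}, le_h = {((), ())}, le_r = {((), ())}, dec = (\<lambda>_. dec S x)\<rparr> (\<lambda>_. ())"
    using x by (auto simp: dec_iso_def dp_iso_def bij_betw_def)
  then have "cls S = dot (dec S x)"
    unfolding dot_def by (intro cls_cong[symmetric] S) (auto simp: ddp_isomorphic_iff)
  then show ?thesis by blast
next
  case False
  have "card (verts S) \<noteq> 0" using WN_finite[OF S] assms(2) by simp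
  then have "2 \<le> card (verts S)" using False by linarith
  then obtain A B where "splits (le_h S) (verts S) A B \<or> splits (le_r S) (verts S) A B"
    using wn_split S unfolding WN_iff by blast
  then have "layered Op1 S A B \<or> layered Op2 S A B" "A \<noteq> {}" "B \<noteq> {}"
    by (auto simp: splits_def layered_def rel_of_def)
  then show ?thesis by blast
qed

lemma WN_point: "WN \<lparr>verts = {x}, le_h = {(x, x)}, le_r = {(x, x)}, dec = f\<rparr>"
  by (auto simp: WN_iff wn_rels_def refl_on_def trans_def antisym_def no_N_def)

lemma dec_mset_dot [simp]: "dec_mset (dot d) = {#d#}"
  unfolding dot_def by (subst dec_mset_cls[OF WN_point]) simp

lemma WN_empty_gen: "WN (empty_ddposet :: ('v, 'd) ddposet)"
  by (auto simp: WN_iff wn_rels_def refl_on_def trans_def antisym_def no_N_def empty_ddposet_def)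

lemma cls_empty:
  assumes "WN S" "verts S = {}" shows "cls S = empty_wnp"
  unfolding empty_wnp_def
  by (intro cls_cong[symmetric] assms(1)) (use assms(2) in \<open>auto simp: ddp_isomorphic_iff dec_iso_def dp_iso_def empty_ddposet_def bij_betw_def\<close>)

lemma dec_mset_empty_iff: "dec_mset R = {#} \<longleftrightarrow> R = empty_wnp"
proof
  assume "dec_mset R = {#}"
  then have "verts (rp R) = {}" using WN_finite[OF WN_rep[of R]] by (simp add: dec_mset_def mset_set_empty_iff)
  then show "R = empty_wnp" using cls_empty[OF WN_rep, of R] by simp
next
  assume "R = empty_wnp"
  then show "dec_mset R = {#}"
    unfolding empty_wnp_def using dec_mset_cls[OF WN_empty_gen] by (simp add: empty_ddposet_def)
qed

lemma join_empty: "join q P empty_wnp = P" "join q empty_wnp P = P"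
proof -
  have V: "subposet (rp P) (verts (rp P)) = rp P"
    using WN_rep[of P] unfolding subposet_def WN_iff wn_rels_def by (simp add: Int_absorb2)
  have e: "cls (subposet (rp P) {}) = empty_wnp" by (rule cls_empty) (auto intro: WN_sub WN_rep)
  have "layered q (rp P) (verts (rp P)) {}" "layered q (rp P) {} (verts (rp P))" by (auto simp: layered_def)
  from this[THEN cls_layered[OF WN_rep]] show "join q P empty_wnp = P" "join q empty_wnp P = P"
    by (simp_all add: V e)
qed

section \<open>Linear extension\<close>

abbreviation keys :: "('b \<Rightarrow>\<^sub>0 'k::zero) \<Rightarrow> 'b set" where
  "keys \<equiv> Poly_Mapping.keys"

abbreviation lookup :: "('b \<Rightarrow>\<^sub>0 'k::zero) \<Rightarrow> 'b \<Rightarrow> 'k" where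
  "lookup \<equiv> Poly_Mapping.lookup"

lemma lookup_scale [simp]: "lookup (scale c x) a = c * lookup x a"
  by (simp add: scale_def Poly_Mapping.map.rep_eq when_def)

interpretation pm: vector_space "scale :: 'k::field \<Rightarrow> ('b \<Rightarrow>\<^sub>0 'k) \<Rightarrow> _"
  by unfold_locales (auto intro!: poly_mapping_eqI simp: lookup_add algebra_simps)

text \<open>
  Linearity on the whole space: the linear maps below are total functions.
\<close>

definition lin :: "(('a \<Rightarrow>\<^sub>0 'k::field) \<Rightarrow> ('b \<Rightarrow>\<^sub>0 'k)) \<Rightarrow> bool" where
  "lin f \<longleftrightarrow> (\<forall>x y. f (x + y) = f x + f y) \<and> (\<forall>c x. f (scale c x) = scale c (f x))"

lemma linI:
  "(\<And>x y. f (x + y) = f x + f y) \<Longrightarrow> (\<And>c x. f (scale c x) = scale c (f x)) \<Longrightarrow> lin f"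
  by (simp add: lin_def)

lemma lin_add: "lin f \<Longrightarrow> f (x + y) = f x + f y"
  and lin_scale: "lin f \<Longrightarrow> f (scale c x) = scale c (f x)"
  by (simp_all add: lin_def)

lemma lin_zero: "lin f \<Longrightarrow> f 0 = 0"
  using lin_scale[of f 0 0] by simp

lemma lin_diff: "lin f \<Longrightarrow> f (x - y) = f x - f y"
  using lin_add[of f "x - y" y] by (simp add: algebra_simps)

lemma lin_sum: "lin f \<Longrightarrow> f (\<Sum>a\<in>A. g a) = (\<Sum>a\<in>A. f (g a))"
  by (induction A rule: infinite_finite_induct) (auto simp: lin_zero lin_add)

lemma lin_comp: "lin f \<Longrightarrow> lin g \<Longrightarrow> lin (\<lambda>x. f (g x))"
  by (simp add: lin_def)

lemma lin_const_zero: "lin (\<lambda>x. 0)"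
  by (simp add: lin_def)

lemma lin_plus: "lin f \<Longrightarrow> lin g \<Longrightarrow> lin (\<lambda>x. f x + g x)"
  by (simp add: lin_def algebra_simps pm.scale_right_distrib)

lemma lin_scaled: "lin f \<Longrightarrow> lin (\<lambda>x. scale c (f x))"
  by (simp add: lin_def pm.scale_right_distrib mult.commute)

lemma lin_sums: "(\<And>a. a \<in> A \<Longrightarrow> lin (f a)) \<Longrightarrow> lin (\<lambda>x. \<Sum>a\<in>A. f a x)"
  by (induction A rule: infinite_finite_induct) (simp_all add: lin_const_zero lin_plus)

lemma lin_ext_superset:
  assumes "finite A" "keys x \<subseteq> A"
  shows "lin_ext F x = (\<Sum>a\<in>A. scale (lookup x a) (F a))"
  unfolding lin_ext_def using assms by (intro sum.mono_neutral_left) (auto simp: in_keys_iff)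

lemma lin_lin_ext:
  fixes F :: "'a \<Rightarrow> ('b \<Rightarrow>\<^sub>0 'k::field)"
  shows "lin (lin_ext F)"
proof (rule linI)
  fix x y :: "'a \<Rightarrow>\<^sub>0 'k" and c
  let ?A = "keys x \<union> keys y"
  have "lin_ext F (x + y) = (\<Sum>a\<in>?A. scale (lookup (x + y) a) (F a))"
    by (rule lin_ext_superset) (auto dest: Poly_Mapping.keys_add[THEN subsetD])
  also have "\<dots> = lin_ext F x + lin_ext F y"
    by (simp add: lin_ext_superset[of ?A] lookup_add pm.scale_left_distrib sum.distrib)
  finally show "lin_ext F (x + y) = lin_ext F x + lin_ext F y" .
  have "lin_ext F (scale c x) = (\<Sum>a\<in>keys x. scale (lookup (scale c x) a) (F a))"
    by (rule lin_ext_superset) (auto simp: in_keys_iff)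
  then show "lin_ext F (scale c x) = scale c (lin_ext F x)"
    by (simp add: lin_ext_def pm.scale_sum_right)
qed

lemma lin_ext_basis [simp]: "lin_ext F (basis a) = F a"
  by (simp add: lin_ext_def)

lemma lin_ext_cong: "(\<And>a. a \<in> keys x \<Longrightarrow> F a = G a) \<Longrightarrow> lin_ext F x = lin_ext G x"
  by (simp add: lin_ext_def)

lemma lin_of_lin_ext: "lin f \<Longrightarrow> f (lin_ext F x) = lin_ext (\<lambda>a. f (F a)) x"
  by (simp add: lin_ext_def lin_sum lin_scale)

lemma basis_expansion: "x = (\<Sum>a\<in>keys x. scale (lookup x a) (basis a))"
proof (rule poly_mapping_eqI)
  fix k
  have "lookup (\<Sum>a\<in>keys x. scale (lookup x a) (basis a)) k =
     (\<Sum>a\<in>keys x. if a = k then lookup x a else 0)"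
    by (simp add: lookup_sum lookup_single when_def if_distrib cong: if_cong)
  then show "lookup x k = lookup (\<Sum>a\<in>keys x. scale (lookup x a) (basis a)) k"
    by (simp add: in_keys_iff)
qed

lemma lin_eq_lin_ext: "lin f \<Longrightarrow> f x = lin_ext (\<lambda>a. f (basis a)) x"
  by (subst basis_expansion[of x]) (simp add: lin_sum lin_scale lin_ext_def)

lemma lin_eqI: "lin f \<Longrightarrow> lin g \<Longrightarrow> (\<And>a. f (basis a) = g (basis a)) \<Longrightarrow> f x = g x"
  by (subst (1 2) lin_eq_lin_ext) simp_all

lemma lin_eq_on_span:
  assumes "lin f" "lin g" "\<And>s. s \<in> S \<Longrightarrow> f s = g s" "x \<in> pm.span S"
  shows "f x = g x"
  using assms(4)
  by (induction rule: pm.span_induct_alt) (auto simp: assms lin_zero lin_add lin_scale)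

lemma span_basis: "(pm.span (basis ` B) :: ('a \<Rightarrow>\<^sub>0 'k::field) set) = {x. keys x \<subseteq> B}"
proof
  show "(pm.span (basis ` B) :: ('a \<Rightarrow>\<^sub>0 'k::field) set) \<subseteq> {x. keys x \<subseteq> B}"
  proof
    fix x :: "'a \<Rightarrow>\<^sub>0 'k" assume "x \<in> pm.span (basis ` B)"
    then show "x \<in> {x. keys x \<subseteq> B}"
    proof (induction rule: pm.span_induct_alt)
      case (step c s y)
      then have "keys (scale c s) \<subseteq> B" by (auto simp: in_keys_iff lookup_single when_def split: if_splits)
      then show ?case using step keys_add[of "scale c s" y] by blast
    qed auto
  qed
  show "{x. keys x \<subseteq> B} \<subseteq> (pm.span (basis ` B) :: ('a \<Rightarrow>\<^sub>0 'k::field) set)"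
  proof
    fix x :: "'a \<Rightarrow>\<^sub>0 'k" assume "x \<in> {x. keys x \<subseteq> B}"
    then have "(\<Sum>a\<in>keys x. scale (lookup x a) (basis a)) \<in> pm.span (basis ` B)"
      by (intro pm.span_sum pm.span_scale pm.span_base) auto
    then show "x \<in> pm.span (basis ` B)" using basis_expansion[of x] by simp
  qed
qed

lemma lin_span_closed:
  assumes "lin f" "\<And>s. s \<in> S \<Longrightarrow> f s \<in> pm.span T" "x \<in> pm.span S"
  shows "f x \<in> pm.span T"
  using assms(3)
  by (induction rule: pm.span_induct_alt)
    (auto simp: assms lin_zero lin_add lin_scale pm.span_zero pm.span_add pm.span_scale)

lemma bilin_ext_linear:
  "lin (bilin_ext F x)" "lin (\<lambda>x. bilin_ext F x y)"
  unfolding bilin_ext_def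
  by (subst lin_ext_def[of _ x], intro lin_sums lin_scaled lin_lin_ext) (rule lin_lin_ext)

lemma bilin_ext_basis [simp]: "bilin_ext F (basis a) (basis b) = F a b"
  by (simp add: bilin_ext_def)

lemma lookup_lin_ext: "lookup (lin_ext F x) k =
    (\<Sum>a\<in>keys x. lookup x a * lookup (F a) k)"
  by (simp add: lin_ext_def lookup_sum)

section \<open>Counting ideals\<close>

definition ideals :: "('v, 'd) ddposet \<Rightarrow> 'd wnp \<Rightarrow> 'd wnp \<Rightarrow> 'v set set" where
  "ideals S P Q = {I. h_ideal S I \<and> cls (subposet S (verts S - I)) = P \<and> cls (subposet S I) = Q}"

lemma finite_ideals: "WN S \<Longrightarrow> finite (ideals S P Q)"
  by (rule finite_subset[of _ "Pow (verts S)"]) (auto simp: ideals_def h_ideal_def WN_finite)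

lemma ideal_count_rp: "ideal_count P Q R = card (ideals (rp R) P Q)"
proof -
  have "ideals (rp R) P Q = {I. h_ideal (rp R) I \<and>
     ddp_isomorphic (subposet (rp R) (verts (rp R) - I)) (rp P) \<and>
     ddp_isomorphic (subposet (rp R) I) (rp Q)}"
    unfolding ideals_def
    by (intro Collect_cong conj_cong refl iso_rp_iff[symmetric] WN_sub WN_rep) (auto simp: h_ideal_def)
  then show ?thesis by (simp add: ideal_count_def)
qed

text \<open>
  An isomorphism maps ideals to ideals and preserves the classes of the two parts.  Used in both
  directions it shows that ideals may be counted in any poset of a class.
\<close>

lemma card_ideals_le:
  assumes S: "WN S" and T: "WN T" and f: "dec_iso S T f"
  shows "card (ideals S P Q) \<le> card (ideals T P Q)"
proof (rule card_inj_on_le[of "(`) f"])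
  have inj: "inj_on f (verts S)" and im: "f ` verts S = verts T"
    using f by (auto simp: dec_iso_def dp_iso_def bij_betw_def)
  have sub: "cls (subposet T (f ` A)) = cls (subposet S A)" if "A \<subseteq> verts S" for A
    using dec_iso_sub[OF f that] WN_sub[OF S that] by (intro cls_cong) (auto simp: ddp_isomorphic_iff)
  show "inj_on ((`) f) (ideals S P Q)"
    by (rule inj_on_subset[OF inj_on_image_Pow[OF inj]]) (auto simp: ideals_def h_ideal_def)
  show "finite (ideals T P Q)" by (rule finite_ideals[OF T])
  show "(`) f ` ideals S P Q \<subseteq> ideals T P Q"
  proof
    fix J assume "J \<in> (`) f ` ideals S P Q"
    then obtain I where J: "J = f ` I" and I: "I \<in> ideals S P Q" by blast
    have IV: "I \<subseteq> verts S" and id: "h_ideal S I" using I by (auto simp: ideals_def h_ideal_def)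
    have "h_ideal T J"
      unfolding h_ideal_def
    proof (intro conjI ballI impI)
      show "J \<subseteq> verts T" using J IV im by blast
      fix x y assume x: "x \<in> J" and y: "y \<in> verts T" and xy: "(x, y) \<in> le_h T"
      obtain x' y' where x': "x' \<in> I" "x = f x'" and y': "y' \<in> verts S" "y = f y'" using x y J im by blast
      then have "(x', y') \<in> le_h S" using f xy IV by (auto simp: dec_iso_def dp_iso_def)
      then show "y \<in> J" using id x' y' J by (auto simp: h_ideal_def)
    qed
    moreover have "verts T - J = f ` (verts S - I)"
      using J im inj_on_image_set_diff[OF inj, of "verts S" I] IV by auto
    ultimately show "J \<in> ideals T P Q"
      using I J sub[OF IV] sub[of "verts S - I"] by (simp add: ideals_def)
  qed
qed

lemma ideal_count_cls:
  assumes "WN S" shows "ideal_count P Q (cls S) = card (ideals S P Q)"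
proof -
  obtain f where f: "dec_iso (rp (cls S)) S f" using rp_cls[OF assms] by (auto simp: ddp_isomorphic_iff)
  show ?thesis
    unfolding ideal_count_rp
    using card_ideals_le[OF WN_rep assms f] card_ideals_le[OF assms WN_rep dec_iso_sym[OF f]] by (rule antisym)
qed

lemma ideal_countE:
  assumes "ideal_count P Q R \<noteq> 0"
  obtains I where "I \<in> ideals (rp R) P Q"
  using assms by (force simp: ideal_count_rp)

lemma ideal_partition: "I \<in> ideals S P Q \<Longrightarrow> (verts S - I) \<union> I = verts S \<and> (verts S - I) \<inter> I = {}
    \<and> le_h S \<inter> I \<times> (verts S - I) = {} \<and> I \<subseteq> verts S"
  by (auto simp: ideals_def h_ideal_def)

lemma ideal_count_dec_mset:
  assumes "ideal_count P Q R \<noteq> 0" shows "dec_mset R = dec_mset P + dec_mset Q"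
proof -
  obtain I where I: "I \<in> ideals (rp R) P Q" using assms by (rule ideal_countE)
  then show ?thesis
    using dec_mset_partition[OF WN_rep, of "verts (rp R) - I" I R] ideal_partition[OF I]
    by (auto simp: ideals_def)
qed

text \<open>
  No \<open>h\<close>-relation leads from an ideal to its complement.  Hence a poset counted here has the
  \<open>h\<close>-relations of \<open>P\<close> and of \<open>Q\<close> and some from \<open>P\<close> to \<open>Q\<close>; only in the \<open>h\<close>-join all pairs occur.
\<close>

lemma ideal_count_h_count:
  assumes "ideal_count P Q R \<noteq> 0"
  shows "R = join Op1 P Q \<or> h_count R < h_count (join Op1 P Q)"
proof -
  let ?S = "rp R"
  obtain I where I: "I \<in> ideals ?S P Q" using assms by (rule ideal_countE)
  note p = ideal_partition[OF I]
  let ?C = "verts ?S - I"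
  have PQ: "cls (subposet ?S ?C) = P" "cls (subposet ?S I) = Q" using I by (auto simp: ideals_def)
  have sz: "size (dec_mset P) = card ?C" "size (dec_mset Q) = card I"
    using PQ size_dec_mset_cls[OF WN_sub[OF WN_rep], of ?C R] size_dec_mset_cls[OF WN_sub[OF WN_rep], of I R] p by auto
  have fin: "finite (?C \<times> I)" using WN_finite[OF WN_rep, of R] p by (auto intro: finite_subset)
  have h: "h_count R = h_count P + h_count Q + card (le_h ?S \<inter> ?C \<times> I)"
    using h_count_partition[OF WN_rep, of ?C I R] p PQ by simp
  show ?thesis
  proof (cases "?C \<times> I \<subseteq> le_h ?S")
    case True
    then have "layered Op1 ?S ?C I" using p by (auto simp: layered_def rel_of_def)
    then show ?thesis using cls_layered[OF WN_rep, of Op1 R ?C I] PQ by simp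
  next
    case False
    then have "card (le_h ?S \<inter> ?C \<times> I) < card (?C \<times> I)"
      by (intro psubset_card_mono fin) blast
    then show ?thesis using h h_count_join[of Op1 P Q] sz by (simp add: card_cartesian_product)
  qed
qed

text \<open>
  An ideal of the \<open>h\<close>-join that meets the lower layer contains the whole upper layer and is
  larger than \<open>Q\<close>.
\<close>

lemma ideal_count_join: "ideal_count P Q (join Op1 P Q) = 1"
proof -
  let ?S = "rp (join Op1 P Q)"
  obtain A B where l: "layered Op1 ?S A B" "cls (subposet ?S A) = P" "cls (subposet ?S B) = Q"
    by (rule layered_joinE)
  have AB: "A \<union> B = verts ?S" "A \<inter> B = {}" "A \<times> B \<subseteq> le_h ?S" using l(1) by (auto simp: layered_def rel_of_def)
  have fin: "finite (verts ?S)" using WN_finite[OF WN_rep] .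
  have "ideals ?S P Q = {B}"
  proof
    have "verts ?S - B = A" using AB by blast
    moreover have "h_ideal ?S B"
      using layered_rels(3)[OF WN_rep l(1)] AB by (auto simp: h_ideal_def)
    ultimately show "{B} \<subseteq> ideals ?S P Q" using l by (simp add: ideals_def)
    show "ideals ?S P Q \<subseteq> {B}"
    proof
      fix I assume I: "I \<in> ideals ?S P Q"
      note p = ideal_partition[OF I]
      have "size (dec_mset Q) = card I" "size (dec_mset Q) = card B"
        using I l(3) size_dec_mset_cls[OF WN_sub[OF WN_rep], of I "join Op1 P Q"]
          size_dec_mset_cls[OF WN_sub[OF WN_rep], of B "join Op1 P Q"] p AB
        by (auto simp: ideals_def)
      then have c: "card I = card B" by simp
      have "I \<subseteq> B"
      proof (rule ccontr)
        assume "\<not> I \<subseteq> B"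
        then obtain x where x: "x \<in> I" "x \<in> A" using p AB by blast
        have "B \<subseteq> I"
        proof
          fix y assume "y \<in> B"
          then have "(x, y) \<in> le_h ?S" "y \<in> verts ?S" using x AB by blast+
          then show "y \<in> I" using I x by (auto simp: ideals_def h_ideal_def)
        qed
        then have "B \<subset> I" using x AB by blast
        then have "card B < card I" using p fin by (meson finite_subset psubset_card_mono)
        then show False using c by simp
      qed
      moreover have "finite B" using AB fin by (metis finite_Un)
      ultimately show "I \<in> {B}" using c card_subset_eq by blast
    qed
  qed
  then show ?thesis by (simp add: ideal_count_rp)
qed

lemma finite_ideal_count: "finite {R. ideal_count P Q R \<noteq> 0}"
  by (rule finite_subset[OF _ finite_dec_mset_eq[of "dec_mset P + dec_mset Q"]]) (use ideal_count_dec_mset in blast)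

lemma lookup_star:
  "lookup (star P Q :: 'd wnp \<Rightarrow>\<^sub>0 'k::field) R = of_nat (ideal_count P Q R)"
proof -
  have "lookup (star P Q :: 'd wnp \<Rightarrow>\<^sub>0 'k) R =
    (\<Sum>T | ideal_count P Q T \<noteq> 0. if T = R then of_nat (ideal_count P Q T) else 0)"
    by (simp add: star_def lookup_sum lookup_single when_def if_distrib cong: if_cong)
  also have "\<dots> = of_nat (ideal_count P Q R)"
    using finite_ideal_count[of P Q] by (simp add: sum.delta)
  finally show ?thesis .
qed

lemma keys_star: "keys (star P Q :: _ \<Rightarrow>\<^sub>0 'k::field) \<subseteq> {R. ideal_count P Q R \<noteq> 0}"
  unfolding subset_iff in_keys_iff lookup_star by (metis mem_Collect_eq of_nat_0)

lemma sum_fibres: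
  assumes "finite U" "finite T" "\<And>I. I \<in> U \<Longrightarrow> n (t I) \<noteq> (0::nat) \<Longrightarrow> t I \<in> T"
  shows "(\<Sum>k\<in>T. n k * card {I \<in> U. t I = k}) = (\<Sum>I\<in>U. n (t I))"
proof -
  have "(\<Sum>k\<in>T. n k * card {I \<in> U. t I = k}) = (\<Sum>k\<in>T. \<Sum>I\<in>{I \<in> U. t I = k}. n (t I))"
    by (intro sum.cong refl) simp
  also have "\<dots> = (\<Sum>k\<in>T. \<Sum>I\<in>{I. I \<in> {I \<in> U. t I \<in> T} \<and> t I = k}. n (t I))"
    by (intro sum.cong refl) auto
  also have "\<dots> = (\<Sum>I\<in>{I \<in> U. t I \<in> T}. n (t I))"
    by (rule sum.group) (use assms in auto)
  also have "\<dots> = (\<Sum>I\<in>U. n (t I))"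
    by (rule sum.mono_neutral_left) (use assms in auto)
  finally show ?thesis .
qed

text \<open>
  Both sides count the chains \<open>I \<subseteq> K\<close> of ideals of \<open>R\<close> for which the complement of \<open>K\<close>, the
  difference \<open>K - I\<close> and \<open>I\<close> have the classes \<open>P\<close>, \<open>Q\<close> and \<open>S\<close>.
\<close>

lemma ideal_count_assoc:
  "(\<Sum>T | dec_mset T = dec_mset P + dec_mset Q. ideal_count P Q T * ideal_count T S R) =
   (\<Sum>T | dec_mset T = dec_mset Q + dec_mset S. ideal_count Q S T * ideal_count P T R)"
proof -
  let ?R = "rp R"
  let ?V = "verts ?R"
  let ?c = "\<lambda>A. cls (subposet ?R A)"
  have fin: "finite ?V" using WN_finite[OF WN_rep] .
  define U where "U = {I. h_ideal ?R I \<and> ?c I = S}"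
  define Y where "Y = {K. h_ideal ?R K \<and> ?c (?V - K) = P}"
  have finU: "finite U" by (rule finite_subset[of _ "Pow ?V"]) (auto simp: U_def h_ideal_def fin)
  have finY: "finite Y" by (rule finite_subset[of _ "Pow ?V"]) (auto simp: Y_def h_ideal_def fin)
  have "(\<Sum>T | dec_mset T = dec_mset P + dec_mset Q. ideal_count P Q T * ideal_count T S R) =
    (\<Sum>T | dec_mset T = dec_mset P + dec_mset Q. ideal_count P Q T * card {I \<in> U. ?c (?V - I) = T})"
    by (intro sum.cong refl arg_cong2[of _ _ _ _ "(*)"])
      (auto simp: ideal_count_rp ideals_def U_def intro!: arg_cong[of _ _ card])
  also have "\<dots> = (\<Sum>I\<in>U. ideal_count P Q (?c (?V - I)))"
    by (rule sum_fibres[OF finU]) (use finite_dec_mset_eq ideal_count_dec_mset in blast)+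
  also have "\<dots> = (\<Sum>I\<in>U. card (ideals (subposet ?R (?V - I)) P Q))"
    by (intro sum.cong refl ideal_count_cls WN_sub WN_rep) auto
  also have "\<dots> = card (SIGMA I:U. ideals (subposet ?R (?V - I)) P Q)"
    by (intro card_SigmaI[symmetric] finU ballI finite_ideals WN_sub WN_rep) auto
  also have "\<dots> = card (SIGMA K:Y. ideals (subposet ?R K) Q S)"
  proof (rule bij_betw_same_card, rule bij_betw_byWitness[where f = "\<lambda>(I, J). (I \<union> J, I)" and f' = "\<lambda>(K, I). (I, K - I)"])
    show "\<forall>p\<in>SIGMA I:U. ideals (subposet ?R (?V - I)) P Q. (\<lambda>(K, I). (I, K - I)) ((\<lambda>(I, J). (I \<union> J, I)) p) = p"
      by (auto simp: ideals_def h_ideal_def)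
    show "\<forall>p\<in>SIGMA K:Y. ideals (subposet ?R K) Q S. (\<lambda>(I, J). (I \<union> J, I)) ((\<lambda>(K, I). (I, K - I)) p) = p"
      by (auto simp: ideals_def h_ideal_def)
    show "(\<lambda>(I, J). (I \<union> J, I)) ` (SIGMA I:U. ideals (subposet ?R (?V - I)) P Q) \<subseteq> (SIGMA K:Y. ideals (subposet ?R K) Q S)"
    proof clarify
      fix I J assume I: "I \<in> U" and J: "J \<in> ideals (subposet ?R (?V - I)) P Q"
      have s: "J \<subseteq> ?V - I" "I \<subseteq> ?V" using I J by (auto simp: U_def ideals_def h_ideal_def)
      have e: "?V - (I \<union> J) = ?V - I - J" "(I \<union> J) - I = J" using s by auto
      have "h_ideal ?R (I \<union> J)" "h_ideal (subposet ?R (I \<union> J)) I"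
      proof -
        have h: "h_ideal ?R I" "h_ideal (subposet ?R (?V - I)) J" using I J by (auto simp: U_def ideals_def)
        show "h_ideal ?R (I \<union> J)" "h_ideal (subposet ?R (I \<union> J)) I"
          using h unfolding h_ideal_def subposet_simps by blast+
      qed
      then show "I \<union> J \<in> Y \<and> I \<in> ideals (subposet ?R (I \<union> J)) Q S"
        using I J s by (simp add: U_def Y_def ideals_def subposet_subposet e)
    qed
    show "(\<lambda>(K, I). (I, K - I)) ` (SIGMA K:Y. ideals (subposet ?R K) Q S) \<subseteq> (SIGMA I:U. ideals (subposet ?R (?V - I)) P Q)"
    proof clarify
      fix K I assume K: "K \<in> Y" and I: "I \<in> ideals (subposet ?R K) Q S"
      have s: "I \<subseteq> K" "K \<subseteq> ?V" using I K by (auto simp: Y_def ideals_def h_ideal_def)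
      have e: "?V - I - (K - I) = ?V - K" "K - I \<subseteq> ?V - I" "?V - K \<subseteq> ?V - I" using s by auto
      have "h_ideal ?R I" "h_ideal (subposet ?R (?V - I)) (K - I)"
        using I K s by (auto simp: Y_def ideals_def h_ideal_def)
      then show "I \<in> U \<and> K - I \<in> ideals (subposet ?R (?V - I)) P Q"
        using I K s by (simp add: U_def Y_def ideals_def subposet_subposet e)
    qed
  qed
  also have "\<dots> = (\<Sum>K\<in>Y. card (ideals (subposet ?R K) Q S))"
    by (intro card_SigmaI finY ballI finite_ideals WN_sub WN_rep) (auto simp: Y_def h_ideal_def)
  also have "\<dots> = (\<Sum>K\<in>Y. ideal_count Q S (?c K))"
    by (intro sum.cong refl ideal_count_cls[symmetric] WN_sub WN_rep) (auto simp: Y_def h_ideal_def)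
  also have "\<dots> = (\<Sum>T | dec_mset T = dec_mset Q + dec_mset S. ideal_count Q S T * card {K \<in> Y. ?c K = T})"
    by (rule sum_fibres[OF finY, symmetric]) (use finite_dec_mset_eq ideal_count_dec_mset in blast)+
  also have "\<dots> = (\<Sum>T | dec_mset T = dec_mset Q + dec_mset S. ideal_count Q S T * ideal_count P T R)"
    by (intro sum.cong refl arg_cong2[of _ _ _ _ "(*)"])
      (auto simp: ideal_count_rp ideals_def Y_def intro!: arg_cong[of _ _ card])
  finally show ?thesis .
qed

section \<open>The 2-As algebra\<close>

definition basis_mult :: "two_ops \<Rightarrow> 'd wnp \<Rightarrow> 'd wnp \<Rightarrow> ('d wnp \<Rightarrow>\<^sub>0 'k::field)" where
  "basis_mult q P Q = (case q of Op1 \<Rightarrow> star P Q | Op2 \<Rightarrow> basis (squig P Q))"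

definition mulop :: "two_ops \<Rightarrow> ('d wnp \<Rightarrow>\<^sub>0 'k::field) \<Rightarrow> ('d wnp \<Rightarrow>\<^sub>0 'k) \<Rightarrow> ('d wnp \<Rightarrow>\<^sub>0 'k)" where
  "mulop q = bilin_ext (basis_mult q)"

lemma mulop_linear: "lin (mulop q x)" "lin (\<lambda>x. mulop q x y)"
  unfolding mulop_def by (rule bilin_ext_linear)+

lemma mulop_basis [simp]: "mulop q (basis P) (basis Q) = basis_mult q P Q"
  by (simp add: mulop_def)

lemma lookup_mulop: "lookup (mulop q x y) R =
    (\<Sum>P\<in>keys x. \<Sum>Q\<in>keys y.
       lookup x P * lookup y Q * lookup (basis_mult q P Q) R)"
  by (simp add: mulop_def bilin_ext_def lookup_lin_ext sum_distrib_left mult.assoc)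

lemma star_star_lookup:
  "lookup (mulop Op1 (star P Q) (basis S) :: _ \<Rightarrow>\<^sub>0 'k::field) R =
     of_nat (\<Sum>T | dec_mset T = dec_mset P + dec_mset Q. ideal_count P Q T * ideal_count T S R)"
  "lookup (mulop Op1 (basis P) (star Q S) :: _ \<Rightarrow>\<^sub>0 'k::field) R =
     of_nat (\<Sum>T | dec_mset T = dec_mset Q + dec_mset S. ideal_count Q S T * ideal_count P T R)"
proof -
  let ?x = "star P Q :: _ \<Rightarrow>\<^sub>0 'k" and ?y = "star Q S :: _ \<Rightarrow>\<^sub>0 'k"
  have "keys ?x \<subseteq> {T. dec_mset T = dec_mset P + dec_mset Q}"
    using keys_star ideal_count_dec_mset by blast
  then show "lookup (mulop Op1 ?x (basis S)) R =
     of_nat (\<Sum>T | dec_mset T = dec_mset P + dec_mset Q. ideal_count P Q T * ideal_count T S R)"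
    by (simp add: mulop_def bilin_ext_def lin_ext_superset[OF finite_dec_mset_eq] lookup_sum lookup_star basis_mult_def)
  have "keys ?y \<subseteq> {T. dec_mset T = dec_mset Q + dec_mset S}"
    using keys_star ideal_count_dec_mset by blast
  then show "lookup (mulop Op1 (basis P) ?y) R =
     of_nat (\<Sum>T | dec_mset T = dec_mset Q + dec_mset S. ideal_count Q S T * ideal_count P T R)"
    by (simp add: mulop_def bilin_ext_def lin_ext_superset[OF finite_dec_mset_eq] lookup_sum lookup_star basis_mult_def)
qed

lemma mulop_assoc:
  fixes x y z :: "'d wnp \<Rightarrow>\<^sub>0 'k::field"
  shows "mulop q (mulop q x y) z = mulop q x (mulop q y z)"
proof -
  have b: "mulop q (mulop q (basis P) (basis Q)) (basis R) = (mulop q (basis P) (mulop q (basis Q) (basis R)) :: 'd wnp \<Rightarrow>\<^sub>0 'k)" for P Q R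
  proof (cases q)
    case Op1
    show ?thesis
      unfolding Op1 by (rule poly_mapping_eqI) (simp add: basis_mult_def star_star_lookup ideal_count_assoc)
  next
    case Op2
    then show ?thesis by (simp add: basis_mult_def squig_eq_join join_assoc)
  qed
  note l = mulop_linear lin_comp[OF mulop_linear(1) mulop_linear(1)] lin_comp[OF mulop_linear(1) mulop_linear(2)]
    lin_comp[OF mulop_linear(2) mulop_linear(1)] lin_comp[OF mulop_linear(2) mulop_linear(2)]
  have b1: "mulop q (mulop q (basis P) (basis Q)) z = mulop q (basis P) (mulop q (basis Q) z)" for P Q
    by (rule lin_eqI[where f = "\<lambda>z. mulop q (mulop q (basis P) (basis Q)) z"]) (rule l b)+
  have b2: "mulop q (mulop q (basis P) y) z = mulop q (basis P) (mulop q y z)" for P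
    by (rule lin_eqI[where f = "\<lambda>y. mulop q (mulop q (basis P) y) z"]) (rule l b1)+
  show ?thesis
    by (rule lin_eqI[where f = "\<lambda>x. mulop q (mulop q x y) z"]) (rule l b2)+
qed

lemma subposet_full: "WN S \<Longrightarrow> subposet S (verts S) = S"
  unfolding subposet_def WN_iff wn_rels_def by (simp add: Int_absorb2)

lemma star_empty:
  fixes P Q :: "'d wnp"
  shows "star empty_wnp Q = basis Q" "star P empty_wnp = basis P"
proof -
  have em: "cls (subposet (rp R) A) = empty_wnp \<longleftrightarrow> A = {}" if "A \<subseteq> verts (rp R)" for R :: "'d wnp" and A
    using that WN_finite[OF WN_rep, of R] finite_subset
    by (auto simp: dec_mset_cls[OF WN_sub[OF WN_rep]] mset_set_empty_iff simp flip: dec_mset_empty_iff)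
  have "ideals (rp R) empty_wnp Q = (if R = Q then {verts (rp R)} else {})" for R
  proof -
    have "I \<in> ideals (rp R) empty_wnp Q \<longleftrightarrow> I = verts (rp R) \<and> R = Q" for I
      using em[of "verts (rp R) - I" R] subposet_full[OF WN_rep[of R]]
      by (auto simp: ideals_def h_ideal_def)
    then show ?thesis by auto
  qed
  then show "star empty_wnp Q = basis Q"
    by (intro poly_mapping_eqI) (simp add: lookup_star ideal_count_rp lookup_single when_def)
  have "ideals (rp R) P empty_wnp = (if R = P then {{}} else {})" for R
  proof -
    have "I \<in> ideals (rp R) P empty_wnp \<longleftrightarrow> I = {} \<and> R = P" for I
      using em[of I R] subposet_full[OF WN_rep[of R]]
      by (auto simp: ideals_def h_ideal_def)
    then show ?thesis by auto
  qed
  then show "star P empty_wnp = basis P"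
    by (intro poly_mapping_eqI) (simp add: lookup_star ideal_count_rp lookup_single when_def)
qed

lemma mulop_unit: "mulop q (basis empty_wnp) x = x" "mulop q x (basis empty_wnp) = x"
proof -
  have id: "lin (\<lambda>x. x)" by (simp add: lin_def)
  show "mulop q (basis empty_wnp) x = x"
    by (rule lin_eqI[OF mulop_linear(1) id]) (cases q; simp add: basis_mult_def star_empty squig_eq_join join_empty)
  show "mulop q x (basis empty_wnp) = x"
    by (rule lin_eqI[OF mulop_linear(2) id]) (cases q; simp add: basis_mult_def star_empty squig_eq_join join_empty)
qed

text \<open>
  A unique term with the most \<open>h\<close>-relations, with coefficient one; all terms have the same
  decorations.
\<close>

definition leads :: "('d wnp \<Rightarrow>\<^sub>0 'k::field) \<Rightarrow> 'd wnp \<Rightarrow> bool" where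
  "leads x R \<longleftrightarrow> lookup x R = 1 \<and>
     (\<forall>R'\<in>keys x. dec_mset R' = dec_mset R \<and> (R' = R \<or> h_count R' < h_count R))"

lemma leads_basis: "leads (basis R) R"
  by (simp add: leads_def)

lemma leads_basis_mult: "leads (basis_mult q P Q :: 'd wnp \<Rightarrow>\<^sub>0 'k::field) (join q P Q)"
proof (cases q)
  case Op1
  then show ?thesis
    using keys_star[of P Q, where 'k = 'k] ideal_count_dec_mset[of P Q] ideal_count_h_count[of P Q] unfolding leads_def
    by (auto simp: basis_mult_def lookup_star ideal_count_join dec_mset_join)
qed (simp add: basis_mult_def squig_eq_join leads_basis)

text \<open>
  With the decorations fixed, so are the numbers of vertices, and \<open>h_count (join q P Q)\<close> grows
  strictly with \<open>h_count P\<close> and \<open>h_count Q\<close>.  So the product of the leading terms is produced by the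
  leading terms only.
\<close>

lemma leads_mulop:
  fixes x y :: "'d wnp \<Rightarrow>\<^sub>0 'k::field"
  assumes x: "leads x P" and y: "leads y Q"
  shows "leads (mulop q x y) (join q P Q)"
proof -
  let ?b = "\<lambda>P' Q' R. lookup (basis_mult q P' Q' :: 'd wnp \<Rightarrow>\<^sub>0 'k) R"
  have b: "dec_mset R = dec_mset (join q P Q) \<and> ((P' = P \<and> Q' = Q \<and> R = join q P Q) \<or> h_count R < h_count (join q P Q))"
    if "P' \<in> keys x" "Q' \<in> keys y" "?b P' Q' R \<noteq> 0" for P' Q' R
  proof -
    have P': "dec_mset P' = dec_mset P" "P' = P \<or> h_count P' < h_count P" using x that by (auto simp: leads_def)
    have Q': "dec_mset Q' = dec_mset Q" "Q' = Q \<or> h_count Q' < h_count Q" using y that by (auto simp: leads_def)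
    have R: "dec_mset R = dec_mset (join q P' Q')" "R = join q P' Q' \<or> h_count R < h_count (join q P' Q')"
    proof -
      have "R \<in> keys (basis_mult q P' Q' :: 'd wnp \<Rightarrow>\<^sub>0 'k)" using that(3) by (simp add: in_keys_iff)
      then show "dec_mset R = dec_mset (join q P' Q')" "R = join q P' Q' \<or> h_count R < h_count (join q P' Q')"
        using leads_basis_mult[of q P' Q', where 'k = 'k] unfolding leads_def by blast+
    qed
    have l: "h_count (join q P' Q') < h_count (join q P Q)" if "P' \<noteq> P \<or> Q' \<noteq> Q"
      using that P' Q' by (auto simp: h_count_join)
    show ?thesis
    proof (cases "P' = P \<and> Q' = Q")
      case True
      then show ?thesis using R by auto
    next
      case False
      then have "h_count (join q P' Q') < h_count (join q P Q)" using l by blast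
      then have "h_count R < h_count (join q P Q)" using R(2) by auto
      then show ?thesis using R(1) P'(1) Q'(1) by (simp add: dec_mset_join)
    qed
  qed
  have keys: "P \<in> keys x" "Q \<in> keys y"
    using x y by (auto simp: leads_def in_keys_iff)
  have "lookup (mulop q x y) (join q P Q) =
    (\<Sum>P'\<in>keys x. \<Sum>Q'\<in>keys y. if Q' = Q then (if P' = P then 1 else 0) else 0)"
    unfolding lookup_mulop
  proof (intro sum.cong refl)
    fix P' Q' assume k: "P' \<in> keys x" "Q' \<in> keys y"
    show "lookup x P' * lookup y Q' * ?b P' Q' (join q P Q) =
      (if Q' = Q then (if P' = P then 1 else 0) else 0)"
      using b[OF k, of "join q P Q"] x y leads_basis_mult[of q P Q, where 'k = 'k] by (auto simp: leads_def)
  qed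
  also have "\<dots> = 1" using keys by (simp add: sum.delta)
  finally have "lookup (mulop q x y) (join q P Q) = 1" .
  moreover have "dec_mset R = dec_mset (join q P Q) \<and> (R = join q P Q \<or> h_count R < h_count (join q P Q))"
    if "R \<in> keys (mulop q x y)" for R
  proof -
    have "lookup (mulop q x y) R \<noteq> 0" using that by (simp add: in_keys_iff)
    then obtain P' where P': "P' \<in> keys x" "(\<Sum>Q'\<in>keys y.
       lookup x P' * lookup y Q' * ?b P' Q' R) \<noteq> 0"
      unfolding lookup_mulop by (rule sum.not_neutral_contains_not_neutral)
    from P'(2) obtain Q' where "Q' \<in> keys y"
      "lookup x P' * lookup y Q' * ?b P' Q' R \<noteq> 0"
      by (rule sum.not_neutral_contains_not_neutral)
    then have "Q' \<in> keys y" "?b P' Q' R \<noteq> 0" by auto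
    with P'(1) show ?thesis using b by blast
  qed
  ultimately show ?thesis by (auto simp: leads_def)
qed

section \<open>Change of decorations\<close>

definition recolour :: "('d \<Rightarrow> 'e) \<Rightarrow> ('v, 'd) ddposet \<Rightarrow> ('v, 'e) ddposet" where
  "recolour f S = \<lparr>verts = verts S, le_h = le_h S, le_r = le_r S, dec = f \<circ> dec S\<rparr>"

lemma recolour_simps [simp]: "verts (recolour f S) = verts S" "le_h (recolour f S) = le_h S" "le_r (recolour f S) = le_r S"
  "dec (recolour f S) = f \<circ> dec S"
  by (simp_all add: recolour_def)

lemma WN_recolour [simp]: "WN (recolour f S) = WN S"
  by (simp add: WN_iff)

lemma redecorate_recolour: "redecorate f P = cls (recolour f (rp P))"
  by (simp add: redecorate_def recolour_def)

lemma subposet_recolour: "subposet (recolour f S) A = recolour f (subposet S A)"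
  by (simp add: recolour_def subposet_def)

lemma cls_recolour:
  assumes "WN S" shows "cls (recolour f S) = redecorate f (cls S)"
proof -
  obtain g where "dec_iso (rp (cls S)) S g" using rp_cls[OF assms] by (auto simp: ddp_isomorphic_iff)
  then have "dec_iso (recolour f (rp (cls S))) (recolour f S) g" by (simp add: dec_iso_def dp_iso_def)
  then show ?thesis unfolding redecorate_recolour by (intro cls_cong) (auto simp: WN_rep ddp_isomorphic_iff)
qed

lemma dec_mset_redecorate [simp]: "dec_mset (redecorate f P) = image_mset f (dec_mset P)"
  by (simp add: redecorate_recolour dec_mset_cls WN_rep dec_mset_def[of P] multiset.map_comp)

lemma redecorate_redecorate: "redecorate f (redecorate g P) = redecorate (f \<circ> g) P"
proof -
  have "redecorate f (redecorate g P) = cls (recolour f (recolour g (rp P)))"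
    using cls_recolour[of "recolour g (rp P)" f] by (simp only: WN_recolour WN_rep redecorate_recolour[of g P])
  also have "recolour f (recolour g (rp P)) = recolour (f \<circ> g) (rp P)" by (simp add: recolour_def o_assoc)
  finally show ?thesis by (simp add: redecorate_recolour)
qed

lemma redecorate_ident:
  assumes "\<And>d. d \<in># dec_mset P \<Longrightarrow> f d = d" shows "redecorate f P = P"
proof -
  have "dec_iso (rp P) (recolour f (rp P)) id"
    using assms WN_finite[OF WN_rep, of P] by (auto simp: dec_iso_def dp_iso_def dec_mset_def)
  then show ?thesis unfolding redecorate_recolour by (intro cls_eqI) (auto simp: ddp_isomorphic_iff)
qed

lemma redecorate_inj: "inj f \<Longrightarrow> redecorate f P = redecorate f Q \<longleftrightarrow> P = Q"
  using redecorate_redecorate[of "inv_into UNIV f" f] redecorate_ident[of _ "inv_into UNIV f \<circ> f"] by (metis inv_o_cancel id_apply)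

lemma redecorate_dot [simp]: "redecorate f (dot d) = dot (f d)"
  using cls_recolour[OF WN_point, of f "()" "\<lambda>_. d"] by (simp add: dot_def recolour_def comp_def)

lemma redecorate_empty [simp]: "redecorate f empty_wnp = empty_wnp"
  by (simp flip: dec_mset_empty_iff) (simp add: dec_mset_empty_iff)

lemma redecorate_join: "redecorate f (join q P Q) = join q (redecorate f P) (redecorate f Q)"
proof -
  let ?S = "rp (join q P Q)"
  obtain A B where l: "layered q ?S A B" "cls (subposet ?S A) = P" "cls (subposet ?S B) = Q"
    by (rule layered_joinE)
  have AB: "A \<subseteq> verts ?S" "B \<subseteq> verts ?S" using l(1) by (auto simp: layered_def)
  have "layered q (recolour f ?S) A B" using l(1) by (cases q) (simp_all add: layered_def rel_of_def)
  then have "cls (recolour f ?S) = join q (cls (recolour f (subposet ?S A))) (cls (recolour f (subposet ?S B)))"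
    using cls_layered[of "recolour f ?S" q A B] by (simp add: WN_rep subposet_recolour)
  then show ?thesis using l AB by (simp add: cls_recolour WN_sub WN_rep)
qed

lemma ideal_count_redecorate:
  assumes "inj f"
  shows "ideal_count (redecorate f P) (redecorate f Q) (redecorate f R) = ideal_count P Q R"
proof -
  have c: "cls (subposet (recolour f (rp R)) A) = redecorate f T \<longleftrightarrow> cls (subposet (rp R) A) = T"
    if "A \<subseteq> verts (rp R)" for A T
    by (simp add: subposet_recolour cls_recolour WN_sub[OF WN_rep that] redecorate_inj[OF assms])
  have h: "h_ideal (recolour f (rp R)) I = h_ideal (rp R) I" for I by (simp add: h_ideal_def)
  have "ideals (recolour f (rp R)) (redecorate f P) (redecorate f Q) = ideals (rp R) P Q"
    unfolding ideals_def h recolour_simps by (intro Collect_cong conj_cong refl c) (auto simp: h_ideal_def)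
  then show ?thesis
    using ideal_count_cls[of "recolour f (rp R)" "redecorate f P" "redecorate f Q"]
    by (simp add: WN_rep ideal_count_rp flip: redecorate_recolour)
qed

definition Redec :: "('d \<Rightarrow> 'e) \<Rightarrow> ('d wnp \<Rightarrow>\<^sub>0 'k::field) \<Rightarrow> ('e wnp \<Rightarrow>\<^sub>0 'k)" where
  "Redec f = lin_ext (\<lambda>P. basis (redecorate f P))"

lemma lin_Redec: "lin (Redec f)" by (simp add: Redec_def lin_lin_ext)

lemma Redec_basis [simp]: "Redec f (basis P) = basis (redecorate f P)" by (simp add: Redec_def)

lemma lookup_Redec:
  assumes "inj f" shows "lookup (Redec f x) (redecorate f R) = lookup x R"
proof -
  have "lookup (Redec f x) (redecorate f R) =
     (\<Sum>P\<in>keys x. if P = R then lookup x P else 0)"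
    by (simp add: Redec_def lookup_lin_ext lookup_single when_def redecorate_inj[OF assms] if_distrib cong: if_cong)
  then show ?thesis by (simp add: in_keys_iff)
qed

text \<open>
  For injective \<open>f\<close>, a poset occurring on the right has its decorations in the range of \<open>f\<close> and
  is therefore a redecorated poset in exactly one way; the two coefficients count the same ideals.
\<close>

lemma Redec_star:
  fixes f :: "'d \<Rightarrow> 'e"
  assumes inj: "inj f" shows "Redec f (star P Q :: 'd wnp \<Rightarrow>\<^sub>0 'k::field) = star (redecorate f P) (redecorate f Q)"
proof (rule poly_mapping_eqI)
  fix R' :: "'e wnp"
  show "lookup (Redec f (star P Q) :: 'e wnp \<Rightarrow>\<^sub>0 'k) R' = lookup (star (redecorate f P) (redecorate f Q)) R'"
  proof (cases "R' \<in> range (redecorate f)")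
    case True
    then show ?thesis
      by (auto simp: lookup_Redec[OF inj] lookup_star ideal_count_redecorate[OF inj])
  next
    case False
    have "ideal_count (redecorate f P) (redecorate f Q) R' = 0"
    proof (rule ccontr)
      assume "ideal_count (redecorate f P) (redecorate f Q) R' \<noteq> 0"
      then have "dec_mset R' = image_mset f (dec_mset P + dec_mset Q)" using ideal_count_dec_mset by fastforce
      then have "redecorate (f \<circ> inv_into UNIV f) R' = R'"
        by (intro redecorate_ident) (auto simp: f_inv_into_f)
      then show False using False by (metis redecorate_redecorate rangeI)
    qed
    moreover have "lookup (Redec f (star P Q) :: 'e wnp \<Rightarrow>\<^sub>0 'k) R' = 0"
      unfolding Redec_def lookup_lin_ext
      by (rule sum.neutral) (use False in \<open>auto simp: lookup_single when_def\<close>)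
    ultimately show ?thesis by (simp add: lookup_star)
  qed
qed

lemma Redec_mulop:
  assumes "inj f" shows "Redec f (mulop q x y) = mulop q (Redec f x) (Redec f y)"
proof -
  have b: "Redec f (basis_mult q P Q) = basis_mult q (redecorate f P) (redecorate f Q)" for P Q
    by (cases q) (simp_all add: basis_mult_def Redec_star[OF assms] squig_eq_join redecorate_join)
  note l = lin_comp[OF lin_Redec mulop_linear(1)] lin_comp[OF lin_Redec mulop_linear(2)]
    lin_comp[OF mulop_linear(1) lin_Redec] lin_comp[OF mulop_linear(2) lin_Redec]
  have b1: "Redec f (mulop q (basis P) y) = mulop q (basis (redecorate f P)) (Redec f y)" for P
    by (rule lin_eqI[where f = "\<lambda>y. Redec f (mulop q (basis P) y)"]) (rule l | simp add: b)+
  show ?thesis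
    by (rule lin_eqI[where f = "\<lambda>x. Redec f (mulop q x y)"]) (rule l | simp add: b1)+
qed

section \<open>Trees up to associativity\<close>

fun evalt :: "('l \<Rightarrow> ('d wnp \<Rightarrow>\<^sub>0 'k::field)) \<Rightarrow> (two_ops, 'l) optree \<Rightarrow> ('d wnp \<Rightarrow>\<^sub>0 'k)" where
  "evalt g (Leaf l) = g l"
| "evalt g (Node q s t) = mulop q (evalt g s) (evalt g t)"

definition gens :: "'d \<Rightarrow> ('d wnp \<Rightarrow>\<^sub>0 'k::field)" where
  "gens d = basis (dot d)"

text \<open>
  The leading term of the value of a tree: both products are replaced by the corresponding joins.
\<close>

fun lead :: "(two_ops, 'd) optree \<Rightarrow> 'd wnp" where
  "lead (Leaf d) = dot d"
| "lead (Node q s t) = join q (lead s) (lead t)"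

inductive assoc_equiv :: "('g, 'l) optree \<Rightarrow> ('g, 'l) optree \<Rightarrow> bool" (infix "\<approx>" 50) where
  equiv_refl: "t \<approx> t"
| equiv_sym: "s \<approx> t \<Longrightarrow> t \<approx> s"
| equiv_trans: "s \<approx> t \<Longrightarrow> t \<approx> u \<Longrightarrow> s \<approx> u"
| equiv_cong: "s \<approx> s' \<Longrightarrow> t \<approx> t' \<Longrightarrow> Node q s t \<approx> Node q s' t'"
| equiv_assoc: "Node q (Node q s t) u \<approx> Node q s (Node q t u)"

lemma equiv_evalt: "s \<approx> t \<Longrightarrow> evalt g s = evalt g t"
  by (induction rule: assoc_equiv.induct) (auto simp: mulop_assoc)

lemma equiv_leaves: "s \<approx> t \<Longrightarrow> leaves s = leaves t"
  by (induction rule: assoc_equiv.induct) auto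

lemma leads_evalt: "leads (evalt gens t :: 'd wnp \<Rightarrow>\<^sub>0 'k::field) (lead t)"
  by (induction t) (auto simp: gens_def leads_basis leads_mulop)

lemma dec_mset_lead: "dec_mset (lead t) = mset (leaves t)"
  by (induction t) (auto simp: dec_mset_join)

lemma leaves_ne [simp]: "leaves t \<noteq> []"
  by (induction t) auto

lemma length_leaves_pos: "0 < length (leaves t)"
  by simp

lemma lead_nonempty: "lead t \<noteq> empty_wnp"
  by (simp add: dec_mset_lead flip: dec_mset_empty_iff)

lemma cls_is_lead:
  assumes "WN S" "verts S \<noteq> {}"
  shows "\<exists>t. lead t = cls S"
  using assms
proof (induction "card (verts S)" arbitrary: S rule: less_induct)
  case less
  from WN_nonempty_decompose[OF less.prems] show ?case
  proof
    assume "\<exists>d. cls S = dot d"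
    then show ?case by (metis lead.simps(1))
  next
    assume "\<exists>q A B. layered q S A B \<and> A \<noteq> {} \<and> B \<noteq> {}"
    then obtain q A B where l: "layered q S A B" "A \<noteq> {}" "B \<noteq> {}" by blast
    have AB: "A \<subset> verts S" "B \<subset> verts S" using l by (auto simp: layered_def)
    have "\<exists>t. lead t = cls (subposet S C)" if "C \<subset> verts S" "C \<noteq> {}" for C
    proof (rule less.hyps)
      show "card (verts (subposet S C)) < card (verts S)"
        using psubset_card_mono[OF WN_finite[OF less.prems(1)] that(1)] by simp
      show "WN (subposet S C)" using WN_sub less.prems(1) that(1) by blast
    qed (use that in simp)
    then obtain s t where "lead s = cls (subposet S A)" "lead t = cls (subposet S B)" using AB l by meson
    then have "lead (Node q s t) = cls S" using cls_layered[OF less.prems(1) l(1)] by simp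
    then show ?case by blast
  qed
qed

lemma lead_surj:
  assumes "R \<noteq> empty_wnp" shows "\<exists>t. lead t = R"
proof -
  have "verts (rp R) \<noteq> {}" using assms cls_empty[OF WN_rep, of R] by auto
  then show ?thesis using cls_is_lead[OF WN_rep, of R] by simp
qed

text \<open>
  If the orders differed, a point of \<open>A\<close> and a point of \<open>B\<close> could never be in different layers of the
  second splitting; as every point of \<open>A\<close> is linked to every point of \<open>B\<close>, a single layer of the second
  splitting would contain everything.
\<close>

lemma layered_op_unique:
  assumes S: "WN S" and l: "layered q S A B" "A \<noteq> {}" "B \<noteq> {}" and l': "layered q' S C D" "C \<noteq> {}" "D \<noteq> {}"
  shows "q = q'"
proof (rule ccontr)
  assume neq: "q \<noteq> q'"
  have same: "(a \<in> C \<and> b \<in> C) \<or> (a \<in> D \<and> b \<in> D)" if "a \<in> A" "b \<in> B" for a b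
  proof (rule ccontr)
    assume "\<not> ?thesis"
    then have "(a \<in> C \<and> b \<in> D) \<or> (a \<in> D \<and> b \<in> C)" using that l(1) l'(1) by (auto simp: layered_def)
    then show False
      using layered_rels[OF S l(1) that] layered_rels[OF S l'(1), of a b] layered_rels[OF S l'(1), of b a] neq
      by (cases q; cases q') auto
  qed
  have V: "A \<union> B = C \<union> D" "C \<inter> D = {}" using l(1) l'(1) by (auto simp: layered_def)
  obtain a b where ab: "a \<in> A" "b \<in> B" using l by blast
  show False
  proof (cases "a \<in> C")
    case True
    then have "B \<subseteq> C" using same ab V(2) by blast
    then have "A \<subseteq> C" using same ab V(2) by blast
    then show False using \<open>B \<subseteq> C\<close> V l'(3) by blast
  next
    case False
    then have "B \<subseteq> D" using same ab V(2) by blast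
    then have "A \<subseteq> D" using same ab V(2) by blast
    then show False using \<open>B \<subseteq> D\<close> V l'(2) by blast
  qed
qed

lemma layered_linear:
  assumes S: "WN S" and l: "layered q S A B" and l': "layered q S C D"
  shows "A \<subseteq> C \<or> C \<subseteq> A"
proof (rule ccontr)
  assume "\<not> ?thesis"
  then obtain x y where x: "x \<in> A" "x \<notin> C" and y: "y \<in> C" "y \<notin> A" by blast
  then have "y \<in> B" "x \<in> D" using l l' by (auto simp: layered_def)
  then show False
    using layered_rels[OF S l x(1), of y] layered_rels[OF S l' y(1), of x] by (cases q) auto
qed

lemma card_nonempty_lead: "WN S \<Longrightarrow> A \<subseteq> verts S \<Longrightarrow> cls (subposet S A) = lead t \<Longrightarrow> A \<noteq> {}"
  using cls_empty[of "subposet S A"] lead_nonempty[of t] WN_sub by fastforce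

text \<open>
  Uniqueness of the decomposition.  Two trees with the same join split it for the same order, and
  their first layers are nested, say \<open>A \<subseteq> C\<close>.  If they differ, the poset \<open>C - A\<close> between them is itself
  the join of some tree, and by induction both trees are bracketings of the same three factors.
\<close>

lemma lead_eq_imp_equiv: "lead s = lead t \<Longrightarrow> s \<approx> t"
proof (induction "length (leaves s)" arbitrary: s t rule: less_induct)
  case less
  have len: "mset (leaves s) = mset (leaves t)" using less.prems by (metis dec_mset_lead)
  then have len': "length (leaves s) = length (leaves t)" by (metis size_mset)
  show ?case
  proof (cases s)
    case (Leaf d)
    show ?thesis
    proof (cases t)
      case (Leaf d')
      then show ?thesis using len \<open>s = Leaf d\<close> by (simp add: equiv_refl)
    next
      case (Node q t1 t2)
      then show ?thesis
        using len' \<open>s = Leaf d\<close> length_leaves_pos[of t1] length_leaves_pos[of t2]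
        by (simp del: leaves_ne length_greater_0_conv)
    qed
  next
    case (Node q s1 s2)
    then obtain q' t1 t2 where t: "t = Node q' t1 t2"
      using len' length_leaves_pos[of s1] length_leaves_pos[of s2]
      by (cases t) (simp_all del: leaves_ne length_greater_0_conv)
    let ?S = "rp (lead s)"
    have S: "WN ?S" by (rule WN_rep)
    obtain A B where l: "layered q ?S A B" "cls (subposet ?S A) = lead s1" "cls (subposet ?S B) = lead s2"
      using layered_of_join[OF S, of q "lead s1" "lead s2"] Node by auto
    obtain C D where l': "layered q' ?S C D" "cls (subposet ?S C) = lead t1" "cls (subposet ?S D) = lead t2"
      using layered_of_join[OF S, of q' "lead t1" "lead t2"] t less.prems by auto
    have sub: "A \<subseteq> verts ?S" "B \<subseteq> verts ?S" "C \<subseteq> verts ?S" "D \<subseteq> verts ?S"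
      using l(1) l'(1) by (auto simp: layered_def)
    have ne: "A \<noteq> {}" "B \<noteq> {}" "C \<noteq> {}" "D \<noteq> {}"
      using card_nonempty_lead[OF S] sub l l' by blast+
    have qq: "q' = q" using layered_op_unique[OF S l(1) ne(1,2) l'(1) ne(3,4)] by simp
    have core: "Node q u1 u2 \<approx> Node q v1 v2"
      if A: "layered q ?S A B" "cls (subposet ?S A) = lead u1" "cls (subposet ?S B) = lead u2"
      and C: "layered q ?S C D" "cls (subposet ?S C) = lead v1" "cls (subposet ?S D) = lead v2"
      and AC: "A \<subseteq> C" and lens: "length (leaves u1) + length (leaves u2) = length (leaves s)"
        "length (leaves v1) + length (leaves v2) = length (leaves s)"
      for A B C D u1 u2 v1 v2
    proof (cases "A = C")
      case True
      then have "B = D" using A(1) C(1) by (auto simp: layered_def)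
      then have "lead u1 = lead v1" "lead u2 = lead v2" using True A C by simp_all
      moreover have "length (leaves u1) < length (leaves s)" "length (leaves u2) < length (leaves s)"
        using lens length_leaves_pos[of u1] length_leaves_pos[of u2] by linarith+
      ultimately show ?thesis by (intro equiv_cong less.hyps)
    next
      case False
      define E where "E = C - A"
      have E: "E \<noteq> {}" "E \<subseteq> verts ?S" "E \<subseteq> C" "E \<subseteq> B" "D \<subseteq> B" "A \<subseteq> verts ?S" "B \<subseteq> verts ?S" "C \<subseteq> verts ?S"
        using False AC A(1) C(1) unfolding E_def layered_def by blast+
      then obtain u where u: "lead u = cls (subposet ?S E)"
        using cls_is_lead[OF WN_sub[OF S E(2)]] by auto
      have "layered q (subposet ?S C) A E"
        using A(1) C(1) AC by (cases q) (auto simp: layered_def rel_of_def E_def)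
      from cls_layered[OF WN_sub[OF S E(8)] this] have "lead v1 = lead (Node q u1 u)"
        using A C E u AC by (simp add: subposet_subposet)
      moreover have "layered q (subposet ?S B) E D"
        using A(1) C(1) AC E(5) by (cases q) (auto simp: layered_def rel_of_def E_def)
      from cls_layered[OF WN_sub[OF S E(7)] this] have "lead u2 = lead (Node q u v2)"
        using A C E u AC by (simp add: subposet_subposet)
      moreover have "length (leaves v1) < length (leaves s)" "length (leaves u2) < length (leaves s)"
        using lens length_leaves_pos[of u1] length_leaves_pos[of v2] by linarith+
      ultimately have v1: "v1 \<approx> Node q u1 u" and u2: "u2 \<approx> Node q u v2"
        by (auto intro: less.hyps)
      have "Node q u1 u2 \<approx> Node q u1 (Node q u v2)" by (intro equiv_cong equiv_refl u2)
      moreover have "Node q (Node q u1 u) v2 \<approx> Node q u1 (Node q u v2)" by (rule equiv_assoc)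
      moreover have "Node q v1 v2 \<approx> Node q (Node q u1 u) v2" by (intro equiv_cong equiv_refl v1)
      ultimately show ?thesis by (meson equiv_sym equiv_trans)
    qed
    have lens: "length (leaves s1) + length (leaves s2) = length (leaves s)"
       "length (leaves t1) + length (leaves t2) = length (leaves s)"
      using Node t len' by simp_all
    from layered_linear[OF S l(1) l'(1)[unfolded qq]] show ?thesis
    proof
      assume "A \<subseteq> C"
      then show ?thesis using core[OF l l'[unfolded qq] _ lens] Node t qq by simp
    next
      assume "C \<subseteq> A"
      then show ?thesis using core[OF l'[unfolded qq] l _ lens(2,1)] Node t qq by (simp add: equiv_sym)
    qed
  qed
qed

section \<open>Freeness\<close>

text \<open>
  The linear relations that associativity imposes on the trees of \<open>T\<close>.
\<close>

definition assoc_space :: "('g, 'l) optree set \<Rightarrow> (('g, 'l) optree \<Rightarrow>\<^sub>0 'k::field) set" where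
  "assoc_space T = pm.span {basis s - basis t |s t. s \<in> T \<and> t \<in> T \<and> s \<approx> t}"

lemma assoc_space_vanish:
  assumes "y \<in> assoc_space T" shows "lin_ext (evalt g) y = 0"
proof -
  have "lin_ext (evalt g) y = (\<lambda>x. 0) y"
    by (rule lin_eq_on_span[OF lin_lin_ext lin_const_zero _ assms[unfolded assoc_space_def]])
      (auto simp: lin_diff[OF lin_lin_ext] equiv_evalt)
  then show ?thesis by simp
qed

text \<open>
  Among the leading terms involved, one with the most \<open>h\<close>-relations cannot be cancelled.
\<close>

lemma lead_independent:
  fixes x :: "(two_ops, 'd) optree \<Rightarrow>\<^sub>0 'k::field"
  assumes inj: "inj_on lead (keys x)" and z: "lin_ext (evalt gens) x = 0"
  shows "x = 0"
proof (rule ccontr)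
  assume "x \<noteq> 0"
  then have "keys x \<noteq> {}" by simp
  then obtain t where t: "t \<in> keys x"
    and max: "\<And>u. u \<in> keys x \<Longrightarrow> h_count (lead u) \<le> h_count (lead t)"
    using Max_in[of "(\<lambda>u. h_count (lead u)) ` keys x"] Max_ge[of "(\<lambda>u. h_count (lead u)) ` keys x"]
    by (metis (no_types, lifting) finite_imageI finite_keys imageE image_eqI image_is_empty)
  have *: "lookup (evalt gens u :: 'd wnp \<Rightarrow>\<^sub>0 'k) (lead t) = (if u = t then 1 else 0)"
    if "u \<in> keys x" for u
  proof (cases "u = t")
    case True
    then show ?thesis using leads_evalt[of t, where 'k = 'k] by (simp add: leads_def)
  next
    case False
    have "lead t \<notin> keys (evalt gens u :: 'd wnp \<Rightarrow>\<^sub>0 'k)"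
    proof
      assume "lead t \<in> keys (evalt gens u :: 'd wnp \<Rightarrow>\<^sub>0 'k)"
      then have "lead t = lead u \<or> h_count (lead t) < h_count (lead u)"
        using leads_evalt[of u, where 'k = 'k] unfolding leads_def by blast
      then show False using max[OF that] inj_onD[OF inj, of t u] t that False by auto
    qed
    then show ?thesis using False by (simp add: in_keys_iff)
  qed
  have "lookup (lin_ext (evalt gens) x :: 'd wnp \<Rightarrow>\<^sub>0 'k) (lead t) =
    (\<Sum>u\<in>keys x. if u = t then lookup x u else 0)"
    unfolding lookup_lin_ext by (intro sum.cong refl) (simp add: *)
  also have "\<dots> = lookup x t" using t by simp
  finally show False using z t by (simp add: in_keys_iff)
qed

text \<open>
  A chosen representative of the trees with a given leading term.
\<close>

definition nf :: "(two_ops, 'd) optree \<Rightarrow> (two_ops, 'd) optree" where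
  "nf t = (SOME u. lead u = lead t)"

lemma lead_nf: "lead (nf t) = lead t"
  unfolding nf_def by (rule someI) (rule refl)

text \<open>
  The core of freeness.  Replacing trees by their representatives changes \<open>x\<close> by an element of
  \<open>assoc_space T\<close> and not its value, and the values of the representatives are linearly independent.
  The set \<open>T\<close> confines the argument to one arity when the operads are compared.
\<close>

lemma kernel_subset_assoc_space:
  fixes x :: "(two_ops, 'd) optree \<Rightarrow>\<^sub>0 'k::field"
  assumes keys: "keys x \<subseteq> T" and cl: "\<And>s t. s \<in> T \<Longrightarrow> s \<approx> t \<Longrightarrow> t \<in> T"
    and z: "lin_ext (evalt gens) x = 0"
  shows "x \<in> assoc_space T"
proof -
  define y where "y = lin_ext (\<lambda>t. basis (nf t)) x"
  have "x - y = (\<Sum>t\<in>keys x. scale (lookup x t) (basis t - basis (nf t)))"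
    unfolding y_def lin_ext_def by (subst basis_expansion[of x])
      (simp add: pm.scale_right_diff_distrib sum_subtractf)
  also have "\<dots> \<in> assoc_space T"
    unfolding assoc_space_def
  proof (intro pm.span_sum pm.span_scale pm.span_base)
    fix t assume "t \<in> keys x"
    moreover have "t \<approx> nf t" by (rule lead_eq_imp_equiv) (simp add: lead_nf)
    ultimately show "basis t - basis (nf t) \<in> {basis s - basis t |s t. s \<in> T \<and> t \<in> T \<and> s \<approx> t}"
      using keys cl by blast
  qed
  finally have xy: "x - y \<in> assoc_space T" .
  have "lin_ext (evalt gens) y = (0 :: 'd wnp \<Rightarrow>\<^sub>0 'k)"
    using assoc_space_vanish[OF xy, of gens] z by (simp add: lin_diff[OF lin_lin_ext])
  moreover have ky: "keys y \<subseteq> range nf"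
  proof -
    have "y \<in> pm.span (basis ` range nf)"
      unfolding y_def lin_ext_def by (intro pm.span_sum pm.span_scale pm.span_base) auto
    then show ?thesis by (simp add: span_basis)
  qed
  have "inj_on lead (keys y)"
  proof (rule inj_onI)
    fix s t assume "s \<in> keys y" "t \<in> keys y" and e: "lead s = lead t"
    then obtain s' t' where "s = nf s'" "t = nf t'" using ky by blast
    then show "s = t" using e by (simp add: lead_nf) (simp add: nf_def)
  qed
  ultimately have "y = 0" using lead_independent by blast
  then show ?thesis using xy by simp
qed

lemma span_image_lin_ext:
  assumes "y \<in> pm.span (f ` A)"
  shows "\<exists>x. keys x \<subseteq> A \<and> lin_ext f x = y"
  using assms
proof (induction rule: pm.span_induct_alt)
  case base
  then show ?case by (intro exI[of _ 0]) (simp add: lin_zero[OF lin_lin_ext])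
next
  case (step c s y)
  then obtain a x where "a \<in> A" "s = f a" "keys x \<subseteq> A" "lin_ext f x = y" by blast
  moreover from this have "x \<in> pm.span (basis ` A)" by (simp add: span_basis)
  with \<open>a \<in> A\<close> have "scale c (basis a) + x \<in> pm.span (basis ` A)"
    by (intro pm.span_add pm.span_scale) (auto intro: pm.span_base)
  ultimately show ?case
    by (intro exI[of _ "scale c (basis a) + x"])
      (auto simp: span_basis lin_add[OF lin_lin_ext] lin_scale[OF lin_lin_ext])
qed

text \<open>
  Triangularity again: a tree with leading term \<open>R\<close> has the value \<open>R\<close> plus terms with fewer
  \<open>h\<close>-relations and the same decorations, which are dealt with by induction.
\<close>

lemma basis_in_span_evalt:
  assumes "R \<noteq> empty_wnp"
  shows "(basis R :: 'd wnp \<Rightarrow>\<^sub>0 'k::field) \<in> pm.span (evalt gens ` {t. mset (leaves t) = dec_mset R})"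
  using assms
proof (induction "h_count R" arbitrary: R rule: less_induct)
  case less
  obtain t where t: "lead t = R" using lead_surj less.prems by blast
  let ?S = "pm.span (evalt gens ` {t. mset (leaves t) = dec_mset R}) :: ('d wnp \<Rightarrow>\<^sub>0 'k) set"
  let ?x = "evalt gens t :: 'd wnp \<Rightarrow>\<^sub>0 'k"
  have ld: "leads ?x R" using leads_evalt[of t] t by simp
  have R: "R \<in> keys ?x" "lookup ?x R = 1" using ld by (auto simp: leads_def in_keys_iff)
  have "?x = (\<Sum>R'\<in>keys ?x. scale (lookup ?x R') (basis R'))"
    by (rule basis_expansion)
  also have "\<dots> = basis R + (\<Sum>R'\<in>keys ?x - {R}. scale (lookup ?x R') (basis R'))"
    using R by (subst sum.remove[of _ R]) auto
  finally have "basis R = ?x - (\<Sum>R'\<in>keys ?x - {R}. scale (lookup ?x R') (basis R'))"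
    by (simp add: algebra_simps)
  also have "\<dots> \<in> ?S"
  proof (intro pm.span_diff pm.span_sum pm.span_scale)
    show "?x \<in> ?S" using dec_mset_lead[of t] t by (intro pm.span_base imageI) simp
    fix R' assume "R' \<in> keys ?x - {R}"
    then have R': "dec_mset R' = dec_mset R" "h_count R' < h_count R" using ld by (auto simp: leads_def)
    then have "R' \<noteq> empty_wnp" using less.prems by (metis dec_mset_empty_iff)
    then show "basis R' \<in> ?S" using less.hyps[OF R'(2)] R'(1) by simp
  qed
  finally show ?case .
qed

lemma in_span_evalt:
  fixes x :: "'d wnp \<Rightarrow>\<^sub>0 'k::field"
  assumes "\<And>R. R \<in> keys x \<Longrightarrow> set_mset (dec_mset R) \<subseteq> D"
  shows "x \<in> pm.span (insert (basis empty_wnp) (evalt gens ` {t. set (leaves t) \<subseteq> D}))"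
proof -
  let ?S = "insert (basis empty_wnp) (evalt gens ` {t. set (leaves t) \<subseteq> D}) :: ('d wnp \<Rightarrow>\<^sub>0 'k) set"
  have "(\<Sum>R\<in>keys x. scale (lookup x R) (basis R)) \<in> pm.span ?S"
  proof (intro pm.span_sum pm.span_scale)
    fix R assume "R \<in> keys x"
    then have R: "set_mset (dec_mset R) \<subseteq> D" using assms by blast
    show "basis R \<in> pm.span ?S"
    proof (cases "R = empty_wnp")
      case True
      then show ?thesis by (auto intro: pm.span_base)
    next
      case False
      have "pm.span (evalt gens ` {t. mset (leaves t) = dec_mset R}) \<subseteq> pm.span ?S"
        by (rule pm.span_mono) (use R in \<open>auto simp flip: set_mset_mset\<close>)
      then show ?thesis using basis_in_span_evalt[OF False] by blast
    qed
  qed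
  then show ?thesis using basis_expansion[of x] by simp
qed

text \<open>
  Any preimage serves, since two of them differ by relations that hold in every 2-As algebra.
\<close>

definition presentation :: "'d wnp \<Rightarrow> ((two_ops, 'd) optree \<Rightarrow>\<^sub>0 'k::field)" where
  "presentation R = (SOME x. lin_ext (evalt gens) x = basis R)"

lemma presentation: "R \<noteq> empty_wnp \<Longrightarrow> lin_ext (evalt gens) (presentation R) = basis R"
  unfolding presentation_def
  by (rule someI_ex) (use span_image_lin_ext[OF basis_in_span_evalt[of R]] in blast)

text \<open>
  The morphism of 2-As algebras that extends \<open>g\<close>.
\<close>

definition Phi :: "('d \<Rightarrow> ('e wnp \<Rightarrow>\<^sub>0 'k::field)) \<Rightarrow> ('d wnp \<Rightarrow>\<^sub>0 'k) \<Rightarrow> ('e wnp \<Rightarrow>\<^sub>0 'k)" where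
  "Phi g = lin_ext (\<lambda>R. if R = empty_wnp then basis empty_wnp else lin_ext (evalt g) (presentation R))"

lemma lin_Phi: "lin (Phi g)"
  by (simp add: Phi_def lin_lin_ext)

lemma Phi_unit [simp]: "Phi g (basis empty_wnp) = basis empty_wnp"
  by (simp add: Phi_def)

text \<open>
  The morphism does not depend on the chosen presentations: the one of the value of \<open>t\<close> differs from
  \<open>t\<close> by an element of the kernel, on which every evaluation vanishes.
\<close>

lemma Phi_evalt_gens [simp]:
  fixes g :: "'d \<Rightarrow> ('e wnp \<Rightarrow>\<^sub>0 'k::field)"
  shows "Phi g (evalt gens t) = evalt g t"
proof -
  let ?x = "evalt gens t :: 'd wnp \<Rightarrow>\<^sub>0 'k"
  define z :: "(two_ops, 'd) optree \<Rightarrow>\<^sub>0 'k" where "z = lin_ext presentation ?x"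
  have ne: "R \<noteq> empty_wnp" if "R \<in> keys ?x" for R
    using that leads_evalt[of t, where 'k = 'k] lead_nonempty[of t]
    by (auto simp: leads_def simp flip: dec_mset_empty_iff)
  have comp: "lin_ext (evalt h) z = (\<Sum>R\<in>keys ?x. scale (lookup ?x R) (lin_ext (evalt h) (presentation R)))"
    for h :: "'d \<Rightarrow> ('f wnp \<Rightarrow>\<^sub>0 'k)"
    unfolding z_def by (simp add: lin_ext_def[of presentation] lin_sum[OF lin_lin_ext] lin_scale[OF lin_lin_ext])
  have "lin_ext (evalt gens) z = (\<Sum>R\<in>keys ?x. scale (lookup ?x R) (basis R))"
    unfolding comp by (intro sum.cong refl) (simp add: presentation ne)
  also have "\<dots> = ?x" by (rule basis_expansion[symmetric])
  finally have "lin_ext (evalt gens) (z - basis t) = (0 :: 'd wnp \<Rightarrow>\<^sub>0 'k)" by (simp add: lin_diff[OF lin_lin_ext])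
  then have "z - basis t \<in> assoc_space UNIV" by (intro kernel_subset_assoc_space) auto
  then have "lin_ext (evalt g) (z - basis t) = 0" by (rule assoc_space_vanish)
  then have "lin_ext (evalt g) z = evalt g t" by (simp add: lin_diff[OF lin_lin_ext])
  moreover have "lin_ext (evalt g) z = Phi g ?x"
    unfolding comp Phi_def lin_ext_def[of _ ?x] by (intro sum.cong refl) (simp add: ne)
  ultimately show ?thesis by simp
qed

lemma Phi_gens [simp]: "Phi g (basis (dot d)) = g d"
  using Phi_evalt_gens[of g "Leaf d"] by (simp add: gens_def)

lemma UNIV_span_evalt: "x \<in> pm.span (insert (basis empty_wnp) (range (evalt gens)))"
  using in_span_evalt[of x UNIV] by simp

lemma Phi_mulop: "Phi g (mulop q x y) = mulop q (Phi g x) (Phi g y)"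
proof -
  note l = lin_comp[OF lin_Phi mulop_linear(1)] lin_comp[OF lin_Phi mulop_linear(2)]
    lin_comp[OF mulop_linear(1) lin_Phi] lin_comp[OF mulop_linear(2) lin_Phi]
  have t: "Phi g (mulop q (evalt gens s) (evalt gens t)) = mulop q (evalt g s) (evalt g t)" for s t
    using Phi_evalt_gens[of g "Node q s t"] by simp
  have t1: "Phi g (mulop q (evalt gens s) y) = mulop q (evalt g s) (Phi g y)" for s
    by (rule lin_eq_on_span[OF l(1) l(3) _ UNIV_span_evalt]) (auto simp: mulop_unit t)
  show ?thesis
    by (rule lin_eq_on_span[OF l(2) l(4) _ UNIV_span_evalt]) (auto simp: mulop_unit t1)
qed

lemma Phi_evalt: "Phi g (evalt h t) = evalt (\<lambda>l. Phi g (h l)) t"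
  by (induction t) (simp_all add: Phi_mulop)

text \<open>
  The universal property in the form in which all operad axioms are reduced to statements about
  generators.
\<close>

lemma Phi_Phi: "Phi g (Phi h x) = Phi (\<lambda>d. Phi g (h d)) x"
  by (rule lin_eq_on_span[OF lin_comp[OF lin_Phi lin_Phi] lin_Phi _ UNIV_span_evalt])
    (auto simp: Phi_evalt gens_def)

lemma evalt_cong: "(\<And>l. l \<in> set (leaves t) \<Longrightarrow> g l = h l) \<Longrightarrow> evalt g t = evalt h t"
  by (induction t) auto

lemma Phi_cong:
  assumes "\<And>R. R \<in> keys x \<Longrightarrow> set_mset (dec_mset R) \<subseteq> D" "\<And>d. d \<in> D \<Longrightarrow> g d = h d"
  shows "Phi g x = Phi h x"
  by (rule lin_eq_on_span[OF lin_Phi lin_Phi _ in_span_evalt[OF assms(1)]])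
    (auto intro!: evalt_cong assms(2))

lemma Redec_evalt: "inj f \<Longrightarrow> Redec f (evalt g t) = evalt (\<lambda>l. Redec f (g l)) t"
  by (induction t) (simp_all add: Redec_mulop)

text \<open>
  Shifts and permutations of the decorations become morphisms, too.
\<close>

lemma Redec_conv_Phi:
  assumes "inj f" shows "Redec f x = Phi (\<lambda>d. basis (dot (f d))) x"
  by (rule lin_eq_on_span[OF lin_Redec lin_Phi _ UNIV_span_evalt])
    (auto simp: Redec_evalt[OF assms] gens_def)

lemma Phi_ident: "Phi gens x = x"
  by (rule lin_eq_on_span[OF lin_Phi _ _ UNIV_span_evalt]) (auto simp: lin_def)

lemma H_WNP_simps:
  "carrier (H_WNP D) = {x. keys x \<subseteq> {P. decs P \<subseteq> D}}"
  "x \<otimes>\<^bsub>H_WNP D\<^esub> y = mulop Op1 x y" "mult2 (H_WNP D) x y = mulop Op2 x y"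
  "\<one>\<^bsub>H_WNP D\<^esub> = basis empty_wnp" "x \<oplus>\<^bsub>H_WNP D\<^esub> y = x + y" "c \<odot>\<^bsub>H_WNP D\<^esub> x = scale c x"
  by (simp_all add: H_WNP_def mulop_def basis_mult_def[abs_def])

lemma carrier_H_span:
  "(carrier (H_WNP D) :: ('a wnp \<Rightarrow>\<^sub>0 'b::field) set) = pm.span (insert (basis empty_wnp) (evalt gens ` {t. set (leaves t) \<subseteq> D}))"
proof
  show "carrier (H_WNP D) \<subseteq> pm.span (insert (basis empty_wnp) (evalt gens ` {t. set (leaves t) \<subseteq> D}))"
    using in_span_evalt[of _ D] by (force simp: H_WNP_simps decs_conv)
  have "pm.span (insert (basis empty_wnp) (evalt gens ` {t. set (leaves t) \<subseteq> D})) \<subseteq> (pm.span (basis ` {P. decs P \<subseteq> D}) :: ('a wnp \<Rightarrow>\<^sub>0 'b) set)"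
  proof (rule pm.span_minimal)
    have "dec_mset empty_wnp = ({#} :: 'a multiset)" by (simp add: dec_mset_empty_iff)
    moreover have "(evalt gens t :: 'a wnp \<Rightarrow>\<^sub>0 'b) \<in> pm.span (basis ` {P. decs P \<subseteq> D})" if "set (leaves t) \<subseteq> D" for t :: "(two_ops, 'a) optree"
    proof -
      have "dec_mset R = mset (leaves t)" if "R \<in> keys (evalt gens t :: 'a wnp \<Rightarrow>\<^sub>0 'b)" for R
        using leads_evalt[of t, where 'k = 'b] that unfolding leads_def dec_mset_lead by blast
      then show ?thesis using that by (auto simp: span_basis decs_conv)
    qed
    ultimately show "insert (basis empty_wnp) (evalt gens ` {t. set (leaves t) \<subseteq> D}) \<subseteq> (pm.span (basis ` {P. decs P \<subseteq> D}) :: ('a wnp \<Rightarrow>\<^sub>0 'b) set)"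
      by (simp add: span_basis decs_conv image_subset_iff)
  qed (rule pm.subspace_span)
  then show "pm.span (insert (basis empty_wnp) (evalt gens ` {t. set (leaves t) \<subseteq> D})) \<subseteq> (carrier (H_WNP D) :: ('a wnp \<Rightarrow>\<^sub>0 'b::field) set)"
    by (simp add: span_basis H_WNP_simps)
qed

lemma evalt_gens_carrier: "set (leaves t) \<subseteq> D \<Longrightarrow> evalt gens t \<in> carrier (H_WNP D)"
  unfolding carrier_H_span by (auto intro: pm.span_base)

text \<open>
  A morphism is determined by its values at the generators, also if it is given only on the
  subalgebra with decorations in \<open>D\<close>.
\<close>

lemma twoas_hom_unique:
  fixes f :: "('d wnp \<Rightarrow>\<^sub>0 'k::field) \<Rightarrow> ('e wnp \<Rightarrow>\<^sub>0 'k)"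
  assumes f: "f \<in> twoas_hom (H_WNP D) (H_WNP E)" and g: "\<And>d. d \<in> D \<Longrightarrow> f (basis (dot d)) = g d"
    and x: "x \<in> carrier (H_WNP D)"
  shows "f x = Phi g x"
proof -
  have t: "set (leaves t) \<subseteq> D \<Longrightarrow> f (evalt gens t) = evalt g t" for t
  proof (induction t)
    case (Leaf l)
    then show ?case by (simp add: gens_def g)
  next
    case (Node q s t)
    then have c: "evalt gens s \<in> carrier (H_WNP D)" "evalt gens t \<in> carrier (H_WNP D)"
      by (auto intro: evalt_gens_carrier)
    then have "f (mulop q (evalt gens s) (evalt gens t)) = mulop q (f (evalt gens s)) (f (evalt gens t))"
      using f by (cases q) (auto simp: twoas_hom_def H_WNP_simps(2-6))
    then show ?case using Node by simp
  qed
  let ?S = "insert (basis empty_wnp) (evalt gens ` {t. set (leaves t) \<subseteq> D})"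
  have lin: "\<And>x y. x \<in> carrier (H_WNP D) \<Longrightarrow> y \<in> carrier (H_WNP D) \<Longrightarrow> f (x + y) = f x + f y"
    "\<And>c x. x \<in> carrier (H_WNP D) \<Longrightarrow> f (scale c x) = scale c (f x)"
    using f by (auto simp: twoas_hom_def lin_maps_def H_WNP_simps(2-6))
  have one: "f (basis empty_wnp) = basis empty_wnp" using f by (auto simp: twoas_hom_def H_WNP_simps(2-6))
  have "x \<in> pm.span ?S" using x by (simp add: carrier_H_span)
  then have "x \<in> carrier (H_WNP D) \<and> f x = Phi g x"
  proof (induction rule: pm.span_induct_alt)
    case base
    have z: "0 \<in> carrier (H_WNP D)" by (simp add: carrier_H_span pm.span_zero)
    have "f (scale 0 0) = scale 0 (f 0)" by (rule lin(2)[OF z])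
    then show ?case using z by (simp add: lin_zero[OF lin_Phi])
  next
    case (step c s y)
    have s: "s \<in> carrier (H_WNP D)" "scale c s \<in> carrier (H_WNP D)"
      using step(1) by (auto simp: carrier_H_span intro: pm.span_base pm.span_scale)
    have "f s = Phi g s" using step(1) t one by auto
    moreover have "scale c s + y \<in> carrier (H_WNP D)"
      using s step(2) unfolding carrier_H_span by (intro pm.span_add) auto
    ultimately show ?case using step lin s by (simp add: lin_add[OF lin_Phi] lin_scale[OF lin_Phi])
  qed
  then show ?thesis ..
qed

section \<open>Multilinear expansion\<close>

lemma listset_iff: "bs \<in> listset As \<longleftrightarrow> list_all2 (\<in>) bs As"
  by (induction As arbitrary: bs) (auto simp: set_Cons_def list_all2_Cons2)

lemma length_listset: "bs \<in> listset As \<Longrightarrow> length bs = length As"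
  by (auto simp: listset_iff dest: list_all2_lengthD)

text \<open>
  The value at \<open>ys\<close> of the multilinear map that is given by \<open>F\<close> on basis vectors.
\<close>

definition multi_sum :: "('b list \<Rightarrow> ('c \<Rightarrow>\<^sub>0 'k)) \<Rightarrow> ('b \<Rightarrow>\<^sub>0 'k) list \<Rightarrow> ('c \<Rightarrow>\<^sub>0 'k::field)" where
  "multi_sum F ys = (\<Sum>bs\<in>listset (map keys ys). scale (\<Prod>i<length ys. lookup (ys ! i) (bs ! i)) (F bs))"

lemma multilin_ext_eq: "multilin_ext F x ys = lin_ext (\<lambda>a. multi_sum (F a) ys) x"
  by (simp add: multilin_ext_def multi_sum_def)

lemma multi_sum_cong:
  "(\<And>bs. length bs = length ys \<Longrightarrow> F bs = G bs) \<Longrightarrow> multi_sum F ys = multi_sum G ys"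
  unfolding multi_sum_def by (intro sum.cong refl) (simp add: length_listset)

lemma lin_multi_sum: "lin f \<Longrightarrow> f (multi_sum F ys) = multi_sum (\<lambda>bs. f (F bs)) ys"
  by (simp add: multi_sum_def lin_sum lin_scale)

lemma multilinear_expansion:
  fixes G :: "('b \<Rightarrow>\<^sub>0 'k::field) list \<Rightarrow> ('c \<Rightarrow>\<^sub>0 'k)"
  assumes "\<And>zs i. length zs = length ys \<Longrightarrow> i < length ys \<Longrightarrow> lin (\<lambda>x. G (zs[i := x]))"
  shows "multi_sum (\<lambda>bs. G (map basis bs)) ys = G ys"
  using assms
proof (induction ys arbitrary: G)
  case Nil
  then show ?case by (simp add: multi_sum_def)
next
  case (Cons y ys)
  let ?L = "listset (map keys ys)"
  have im: "listset (map keys (y # ys)) = (\<lambda>(b, bs). b # bs) ` (keys y \<times> ?L)"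
    by (auto simp: set_Cons_def)
  have inj: "inj_on (\<lambda>(b, bs). b # bs) (keys y \<times> ?L)" by (auto intro: inj_onI)
  have IH: "multi_sum (\<lambda>bs. G (basis b # map basis bs)) ys = G (basis b # ys)" for b
  proof (rule Cons.IH)
    fix zs :: "('b \<Rightarrow>\<^sub>0 'k) list" and i assume "length zs = length ys" "i < length ys"
    then show "lin (\<lambda>x. G (basis b # zs[i := x]))"
      using Cons.prems[of "basis b # zs" "Suc i"] by simp
  qed
  have l: "lin (\<lambda>x. G (x # ys))" using Cons.prems[of "y # ys" 0] by simp
  have "multi_sum (\<lambda>bs. G (map basis bs)) (y # ys) =
     (\<Sum>(b, bs)\<in>keys y \<times> ?L. scale (lookup y b)
        (scale (\<Prod>i<length ys. lookup (ys ! i) (bs ! i)) (G (basis b # map basis bs))))"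
    unfolding multi_sum_def im sum.reindex[OF inj]
    by (simp add: prod.lessThan_Suc_shift case_prod_unfold del: prod.lessThan_Suc)
  also have "\<dots> = lin_ext (\<lambda>b. G (basis b # ys)) y"
    unfolding sum.cartesian_product[symmetric] pm.scale_sum_right[symmetric] IH[unfolded multi_sum_def] lin_ext_def ..
  also have "\<dots> = G (y # ys)" by (rule lin_eq_lin_ext[OF l, symmetric])
  finally show ?case .
qed

section \<open>Spaces of multilinear elements\<close>

lemma free_space_simps [simp]:
  "carrier (free_space B) = pm.span (basis ` B)" "x \<oplus>\<^bsub>free_space B\<^esub> y = x + y"
  "\<zero>\<^bsub>free_space B\<^esub> = 0" "c \<odot>\<^bsub>free_space B\<^esub> x = scale c x"
  by (simp_all add: free_space_def span_basis)

lemma abelian_group_free_space: "abelian_group (free_space B :: ('k::field, 'b \<Rightarrow>\<^sub>0 'k) module)"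
proof (rule abelian_groupI)
  fix x assume "x \<in> carrier (free_space B :: ('k, 'b \<Rightarrow>\<^sub>0 'k) module)"
  then show "\<exists>y\<in>carrier (free_space B). y \<oplus>\<^bsub>free_space B\<^esub> x = \<zero>\<^bsub>free_space B\<^esub>"
    by (intro bexI[of _ "- x"]) (simp_all add: pm.span_neg)
qed (auto intro: pm.span_add pm.span_zero)

lemma module_free_space:
  "Module.module (ring_of_type_algebra :: 'k::field ring) (free_space B :: ('k, 'b \<Rightarrow>\<^sub>0 'k) module)"
  by (rule moduleI[OF cring_from_type_algebra abelian_group_free_space])
    (auto simp: ring_of_type_algebra_def pm.scale_left_distrib pm.scale_right_distrib intro: pm.span_scale)

lemma op_trees_iff: "t \<in> op_trees n \<longleftrightarrow> mset (leaves t) = mset_set {1..n}"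
proof
  assume "t \<in> op_trees n"
  then show "mset (leaves t) = mset_set {1..n}"
    using mset_set_set[of "leaves t"] by (simp add: op_trees_def)
next
  assume a: "mset (leaves t) = mset_set {1..n}"
  then have s: "set (leaves t) = {1..n}" by (metis finite_atLeastAtMost finite_set_mset_mset_set set_mset_mset)
  moreover have "length (leaves t) = n" using arg_cong[OF a, of size] by simp
  ultimately show "t \<in> op_trees n" by (simp add: op_trees_def card_distinct)
qed

text \<open>
  Products of the generators in which each of \<open>1, \<dots>, n\<close> occurs exactly once span the space of arity \<open>n\<close>.
\<close>

lemma ind_space_span:
  assumes "1 \<le> n"
  shows "(pm.span (basis ` WNP_Ind n) :: (nat wnp \<Rightarrow>\<^sub>0 'k::field) set) = pm.span (evalt gens ` op_trees n)"
proof (rule antisym)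
  show "(pm.span (basis ` WNP_Ind n) :: (nat wnp \<Rightarrow>\<^sub>0 'k) set) \<subseteq> pm.span (evalt gens ` op_trees n)"
  proof (intro pm.span_minimal image_subsetI pm.subspace_span)
    fix R assume R: "R \<in> WNP_Ind n"
    then have "dec_mset R \<noteq> {#}" using assms by (auto simp: WNP_Ind_iff mset_set_empty_iff)
    then have "R \<noteq> empty_wnp" by (simp add: dec_mset_empty_iff)
    then show "(basis R :: nat wnp \<Rightarrow>\<^sub>0 'k) \<in> pm.span (evalt gens ` op_trees n)"
    proof -
      have "{t :: (two_ops, nat) optree. mset (leaves t) = dec_mset R} = op_trees n"
        using R by (auto simp: op_trees_iff WNP_Ind_iff)
      then show ?thesis using basis_in_span_evalt[OF \<open>R \<noteq> empty_wnp\<close>, where 'k = 'k] by simp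
    qed
  qed
  show "pm.span (evalt gens ` op_trees n) \<subseteq> (pm.span (basis ` WNP_Ind n) :: (nat wnp \<Rightarrow>\<^sub>0 'k) set)"
  proof (intro pm.span_minimal image_subsetI pm.subspace_span)
    fix t :: "(two_ops, nat) optree" assume t: "t \<in> op_trees n"
    have "dec_mset R = mset (leaves t)" if "R \<in> keys (evalt gens t :: nat wnp \<Rightarrow>\<^sub>0 'k)" for R
      using leads_evalt[of t, where 'k = 'k] that unfolding leads_def dec_mset_lead by blast
    then show "(evalt gens t :: nat wnp \<Rightarrow>\<^sub>0 'k) \<in> pm.span (basis ` WNP_Ind n)"
      using t by (auto simp: span_basis WNP_Ind_iff op_trees_iff)
  qed
qed

lemma ind_Phi_cong:
  assumes "x \<in> pm.span (basis ` WNP_Ind n)" "\<And>i. i \<in> {1..n} \<Longrightarrow> g i = h i"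
  shows "Phi g x = Phi h x"
  by (rule Phi_cong[of _ "{1..n}"]) (use assms in \<open>auto simp: span_basis WNP_Ind_iff\<close>)

lemma Phi_Redec: "inj f \<Longrightarrow> Phi g (Redec f x) = Phi (\<lambda>d. g (f d)) x"
  by (simp add: Redec_conv_Phi Phi_Phi)

lemma Redec_Phi: "inj f \<Longrightarrow> Redec f (Phi g x) = Phi (\<lambda>d. Redec f (g d)) x"
  by (simp add: Redec_conv_Phi Phi_Phi)

lemma Redec_Redec: "Redec f (Redec g x) = Redec (\<lambda>d. f (g d)) x"
  by (rule lin_eqI[OF lin_comp[OF lin_Redec lin_Redec] lin_Redec])
    (simp add: redecorate_redecorate comp_def)

lemma Redec_ident: "Redec (\<lambda>d. d) x = x"
  by (rule lin_eqI[OF lin_Redec]) (auto simp: lin_def redecorate_ident)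

section \<open>Composition\<close>

text \<open>
  The images of the generators under the morphism of the composition, at arbitrary instead of basis
  elements: \<open>p\<^sub>i\<close>, its indices moved to the \<open>i\<close>-th block.
\<close>

definition args :: "nat list \<Rightarrow> (nat wnp \<Rightarrow>\<^sub>0 'k::field) list \<Rightarrow> nat \<Rightarrow> (nat wnp \<Rightarrow>\<^sub>0 'k)" where
  "args ns ps i = Redec (\<lambda>d. d + offset ns (i - 1)) (ps ! (i - 1))"

lemma inj_shift: "inj (\<lambda>d::nat. d + c)"
  by (simp add: inj_def)

lemma basis_shift: "basis (shift c P) = Redec (\<lambda>d. d + c) (basis P)"
  by (simp add: shift_def)

lemma Xi_spec_iff:
  fixes f :: "(nat wnp \<Rightarrow>\<^sub>0 'k::field) \<Rightarrow> (nat wnp \<Rightarrow>\<^sub>0 'k)"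
  assumes len: "length Ps = length ns"
  shows "Xi_spec ns Ps f \<longleftrightarrow> f = restrict (Phi (args ns (map basis Ps))) (carrier (H_WNP {1..length ns}))"
    (is "_ \<longleftrightarrow> f = restrict ?F ?C")
proof
  assume f: "Xi_spec ns Ps f"
  show "f = restrict ?F ?C"
  proof
    fix x
    have "f x = ?F x" if "x \<in> ?C"
      by (rule twoas_hom_unique[OF _ _ that, where E = UNIV])
        (use f len in \<open>auto simp: Xi_spec_def args_def basis_shift\<close>)
    then show "f x = restrict ?F ?C x"
      using f by (cases "x \<in> ?C") (auto simp: Xi_spec_def extensional_def)
  qed
next
  assume f: "f = restrict ?F ?C"
  have C: "?C = pm.span (basis ` {P. decs P \<subseteq> {1..length ns}})"
    by (simp add: span_basis H_WNP_simps)
  have cl: "x + y \<in> ?C" "scale c x \<in> ?C" if "x \<in> ?C" "y \<in> ?C" for x y :: "nat wnp \<Rightarrow>\<^sub>0 'k" and c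
    using that unfolding C by (auto intro: pm.span_add pm.span_scale)
  have mul: "mulop q x y \<in> ?C" if x: "x \<in> ?C" and y: "y \<in> ?C" for x y :: "nat wnp \<Rightarrow>\<^sub>0 'k" and q
  proof -
    have b: "basis_mult q P Q \<in> ?C" if PQ: "decs P \<subseteq> {1..length ns}" "decs Q \<subseteq> {1..length ns}" for P Q
    proof -
      have "dec_mset R = dec_mset P + dec_mset Q" if "R \<in> keys (basis_mult q P Q :: nat wnp \<Rightarrow>\<^sub>0 'k)" for R
        using leads_basis_mult[of q P Q, where 'k = 'k] that unfolding leads_def dec_mset_join by blast
      then have "decs R \<subseteq> {1..length ns}" if "R \<in> keys (basis_mult q P Q :: nat wnp \<Rightarrow>\<^sub>0 'k)" for R
        using that PQ unfolding decs_conv by simp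
      then show ?thesis by (auto simp only: H_WNP_simps)
    qed
    have "mulop q (basis P) y \<in> ?C" if "decs P \<subseteq> {1..length ns}" for P
      unfolding C by (rule lin_span_closed[OF mulop_linear(1) _ y[unfolded C]]) (use b that C in auto)
    then show ?thesis
      unfolding C by (intro lin_span_closed[OF mulop_linear(2) _ x[unfolded C]]) (use C in auto)
  qed
  have e: "(basis empty_wnp :: nat wnp \<Rightarrow>\<^sub>0 'k) \<in> ?C"
    using dec_mset_empty_iff[of "empty_wnp :: nat wnp"] by (simp add: H_WNP_simps decs_conv)
  have d: "(basis (dot i) :: nat wnp \<Rightarrow>\<^sub>0 'k) \<in> ?C" if "i \<in> {1..length ns}" for i
    using that by (simp add: H_WNP_simps decs_conv)
  have fC: "f x = ?F x" if "x \<in> ?C" for x using that by (simp only: f restrict_apply' if_True)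
  have fU: "carrier (H_WNP UNIV) = (UNIV :: (nat wnp \<Rightarrow>\<^sub>0 'k) set)" by (simp add: H_WNP_simps)
  have "f \<in> twoas_hom (H_WNP {1..length ns}) (H_WNP UNIV)"
    unfolding twoas_hom_def lin_maps_def
    by (simp add: H_WNP_simps(2-6) fU fC cl mul e lin_add[OF lin_Phi] lin_scale[OF lin_Phi] Phi_mulop del: One_nat_def)
  moreover have "f (basis (dot i)) = basis (shift (offset ns (i - 1)) (Ps ! (i - 1)))" if "i \<in> {1..length ns}" for i
    using that len by (auto simp: fC[OF d[OF that]] args_def basis_shift)
  ultimately show "Xi_spec ns Ps f" by (simp add: Xi_spec_def f)
qed

lemma Xi_unique: "length Ps = length ns \<Longrightarrow> \<exists>!f. Xi_spec ns Ps f"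
  by (simp add: Xi_spec_iff)

lemma Xi_basis:
  fixes Ps :: "nat wnp list"
  assumes "length Ps = length ns" "Q \<in> WNP_Ind (length ns)"
  shows "Xi ns Ps (basis Q) = (Phi (args ns (map basis Ps)) (basis Q) :: nat wnp \<Rightarrow>\<^sub>0 'k::field)"
proof -
  have "(basis Q :: nat wnp \<Rightarrow>\<^sub>0 'k) \<in> carrier (H_WNP {1..length ns})"
    using assms(2) by (simp add: H_WNP_simps decs_conv WNP_Ind_iff)
  then show ?thesis unfolding Xi_def Xi_spec_iff[OF assms(1)] by (simp del: One_nat_def)
qed

text \<open>
  The leaf \<open>l\<close> occurs once only, so the value of the tree is linear in its image.
\<close>

lemma lin_evalt:
  assumes "distinct (leaves t)" "l \<in> set (leaves t)" "lin (\<lambda>x. g x l)"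
    "\<And>x l'. l' \<in> set (leaves t) \<Longrightarrow> l' \<noteq> l \<Longrightarrow> g x l' = g0 l'"
  shows "lin (\<lambda>x. evalt (g x) t)"
  using assms
proof (induction t)
  case (Leaf l)
  then show ?case by simp
next
  case (Node q s t)
  show ?case
  proof (cases "l \<in> set (leaves s)")
    case True
    then have "evalt (g x) t = evalt g0 t" for x using Node.prems by (intro evalt_cong) auto
    moreover have "lin (\<lambda>x. evalt (g x) s)" using Node.prems True by (intro Node.IH(1)) auto
    ultimately show ?thesis by (simp add: lin_comp[OF mulop_linear(2)])
  next
    case False
    then have "evalt (g x) s = evalt g0 s" for x using Node.prems by (intro evalt_cong) auto
    moreover have "lin (\<lambda>x. evalt (g x) t)" using Node.prems False by (intro Node.IH(2)) auto
    ultimately show ?thesis by (simp add: lin_comp[OF mulop_linear(1)])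
  qed
qed

lemma lin_evalt_args:
  assumes t: "t \<in> op_trees k" and "length ps = k" "i < k"
  shows "lin (\<lambda>x. evalt (args ns (ps[i := x])) t)"
proof (rule lin_evalt[where l = "Suc i" and ?g0.0 = "args ns ps"])
  show "lin (\<lambda>x. args ns (ps[i := x]) (Suc i))" using assms by (simp add: args_def lin_Redec)
  show "args ns (ps[i := x]) l' = args ns ps l'" if "l' \<in> set (leaves t)" "l' \<noteq> Suc i" for x l'
  proof -
    have "i \<noteq> l' - 1" using that t by (auto simp: op_trees_def)
    then show ?thesis by (simp add: args_def)
  qed
qed (use assms in \<open>auto simp: op_trees_def\<close>)

lemma lin_Phi_args:
  assumes q: "q \<in> pm.span (basis ` WNP_Ind k)" and "length ps = k" "i < k"
  shows "lin (\<lambda>x. Phi (args ns (ps[i := x])) q)"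
proof -
  have "q \<in> pm.span (evalt gens ` op_trees k)" using q ind_space_span[of k] assms(3) by auto
  then show ?thesis
  proof (induction rule: pm.span_induct_alt)
    case base
    then show ?case by (simp add: lin_zero[OF lin_Phi] lin_const_zero)
  next
    case (step c s y)
    then obtain t where "t \<in> op_trees k" "s = evalt gens t" by blast
    then have "lin (\<lambda>x. Phi (args ns (ps[i := x])) s)" using assms(2,3) by (simp add: lin_evalt_args)
    then show ?case
      using step by (simp add: lin_add[OF lin_Phi] lin_scale[OF lin_Phi] lin_plus lin_scaled)
  qed
qed

lemma WNP_operad_simps [simp]:
  "op_space (WNP_operad :: ('k::field, nat wnp \<Rightarrow>\<^sub>0 'k) operad) n = free_space (WNP_Ind n)"
  "op_ident (WNP_operad :: ('k, nat wnp \<Rightarrow>\<^sub>0 'k) operad) = basis (dot 1)"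
  "op_act (WNP_operad :: ('k, nat wnp \<Rightarrow>\<^sub>0 'k) operad) n \<sigma> = Redec \<sigma>"
  by (simp_all add: WNP_operad_def Redec_def fun_eq_iff)

text \<open>
  The composition is the multilinear extension of its values at basis elements.  As \<open>Phi (args ns ps) q\<close>
  is multilinear in \<open>ps\<close> for \<open>q\<close> in arity \<open>length ns\<close>, it agrees with the composition everywhere, so
  that the axioms can be treated for all elements at once.
\<close>

lemma op_comp_WNP:
  fixes q :: "nat wnp \<Rightarrow>\<^sub>0 'k::field"
  assumes q: "q \<in> pm.span (basis ` WNP_Ind (length ns))" and len: "length ps = length ns"
  shows "op_comp WNP_operad ns q ps = Phi (args ns ps) q"
proof -
  have "op_comp WNP_operad ns q ps = lin_ext (\<lambda>Q. multi_sum (\<lambda>Ps. Xi ns Ps (basis Q)) ps) q"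
    by (simp add: WNP_operad_def multilin_ext_eq)
  also have "\<dots> = lin_ext (\<lambda>Q. Phi (args ns ps) (basis Q)) q"
  proof (rule lin_ext_cong)
    fix Q assume "Q \<in> keys q"
    then have Q: "Q \<in> WNP_Ind (length ns)" using q by (auto simp: span_basis)
    have "multi_sum (\<lambda>Ps. Xi ns Ps (basis Q)) ps = multi_sum (\<lambda>Ps. Phi (args ns (map basis Ps)) (basis Q :: nat wnp \<Rightarrow>\<^sub>0 'k)) ps"
      by (rule multi_sum_cong) (simp add: Xi_basis Q len)
    also have "\<dots> = Phi (args ns ps) (basis Q)"
      by (rule multilinear_expansion) (use Q len in \<open>auto intro!: lin_Phi_args pm.span_base\<close>)
    finally show "multi_sum (\<lambda>Ps. Xi ns Ps (basis Q)) ps = Phi (args ns ps) (basis Q)" .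
  qed
  also have "\<dots> = Phi (args ns ps) q" by (rule lin_eq_lin_ext[OF lin_Phi, symmetric])
  finally show ?thesis .
qed

section \<open>Blocks of indices\<close>

lemma offset_0 [simp]: "offset ns 0 = 0" by (simp add: offset_def)

lemma offset_Suc: "i < length ns \<Longrightarrow> offset ns (Suc i) = offset ns i + ns ! i"
  by (simp add: offset_def take_Suc_conv_app_nth)

lemma offset_mono: "i \<le> j \<Longrightarrow> offset ns i \<le> offset ns j"
  unfolding offset_def by (metis le_add1 le_iff_add sum_list_append take_add)

lemma offset_le: "offset ns i \<le> sum_list ns"
  unfolding offset_def by (metis append_take_drop_id le_add1 sum_list_append)

lemma block_le: "i < length ns \<Longrightarrow> j \<le> ns ! i \<Longrightarrow> offset ns i + j \<le> sum_list ns"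
  using offset_le[of ns "Suc i"] by (simp add: offset_Suc)

lemma block_of_eq:
  assumes "i < length ns" "j \<in> {1..ns ! i}"
  shows "block_of ns (offset ns i + j) = i"
  unfolding block_of_def
proof (rule Least_equality)
  show "offset ns i + j \<le> offset ns (Suc i)" using assms by (simp add: offset_Suc)
  fix y assume "offset ns i + j \<le> offset ns (Suc y)"
  then show "i \<le> y" using assms(2) offset_mono[of "Suc y" i ns] by (cases "i \<le> y") auto
qed

lemma block_exhaust:
  assumes "x \<in> {1..sum_list ns}"
  obtains i j where "i < length ns" "j \<in> {1..ns ! i}" "x = offset ns i + j"
proof -
  have "\<exists>i<length ns. \<exists>j\<in>{1..ns ! i}. x = offset ns i + j"
    using assms
  proof (induction ns rule: rev_induct)
    case (snoc n ns)
    show ?case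
    proof (cases "x \<le> sum_list ns")
      case True
      then obtain i j where ij: "i < length ns" "j \<in> {1..ns ! i}" "x = offset ns i + j" using snoc by auto
      then show ?thesis by (intro exI[of _ i] conjI bexI[of _ j]) (auto simp: nth_append offset_def)
    next
      case False
      then show ?thesis using snoc.prems
        by (intro exI[of _ "length ns"] conjI bexI[of _ "x - sum_list ns"]) (auto simp: offset_def)
    qed
  qed simp
  then show ?thesis using that by blast
qed

lemma perm_sum_block:
  assumes "i < length ns" "j \<in> {1..ns ! i}"
  shows "perm_sum ns \<tau>s (offset ns i + j) = offset ns i + (\<tau>s ! i) j"
  using assms block_le[of i ns j] by (simp add: perm_sum_def block_of_eq Let_def)

lemma block_perm_block:
  assumes "i < length ns" "j \<in> {1..reindex \<sigma> ns ! i}" "sum_list (reindex \<sigma> ns) = sum_list ns"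
  shows "block_perm ns \<sigma> (offset (reindex \<sigma> ns) i + j) = offset ns (\<sigma> (Suc i) - 1) + j"
  using assms block_le[of i "reindex \<sigma> ns" j] block_of_eq[of i "reindex \<sigma> ns" j]
  by (simp add: block_perm_def Let_def reindex_def)

lemma length_reindex [simp]: "length (reindex \<sigma> xs) = length xs"
  by (simp add: reindex_def del: upt_Suc)

lemma nth_reindex: "i < length xs \<Longrightarrow> reindex \<sigma> xs ! i = xs ! (\<sigma> (Suc i) - 1)"
  by (simp add: reindex_def del: upt_Suc)

lemma sum_list_reindex:
  assumes "\<sigma> permutes {1..length ns}"
  shows "sum_list (reindex \<sigma> ns) = sum_list (ns :: nat list)"
proof -
  have sh: "(\<Sum>i<length ns. f (Suc i)) = (\<Sum>i\<in>{1..length ns}. f i)" for f :: "nat \<Rightarrow> nat"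
    by (rule sum.reindex_bij_witness[of _ "\<lambda>i. i - 1" Suc]) auto
  have "sum_list (reindex \<sigma> ns) = (\<Sum>i<length ns. ns ! (\<sigma> (Suc i) - 1))"
    by (simp add: sum_list_sum_nth atLeast0LessThan nth_reindex)
  also have "\<dots> = (\<Sum>i\<in>{1..length ns}. ns ! (\<sigma> i - 1))" by (rule sh)
  also have "\<dots> = (\<Sum>i\<in>{1..length ns}. ns ! (i - 1))"
    using sum.permute[OF assms, of "\<lambda>i. ns ! (i - 1)"] by (simp add: comp_def)
  also have "\<dots> = (\<Sum>i<length ns. ns ! (Suc i - 1))" by (rule sh[symmetric])
  also have "\<dots> = sum_list ns" by (simp add: sum_list_sum_nth atLeast0LessThan)
  finally show ?thesis .
qed

lemma inj_on_outside:
  assumes "inj_on f A" "f ` A \<subseteq> A" "\<And>x. x \<notin> A \<Longrightarrow> f x = x"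
  shows "inj f"
proof (rule injI)
  fix x y assume "f x = f y"
  then show "x = y" using assms by (cases "x \<in> A"; cases "y \<in> A") (auto dest: inj_onD)
qed

lemma block_unique:
  assumes "i < length ns" "j \<in> {1..ns ! i}" "i' < length ns" "j' \<in> {1..ns ! i'}"
    "offset ns i + j = offset ns i' + j'"
  shows "i = i' \<and> j = j'"
  using assms block_of_eq[of i ns j] block_of_eq[of i' ns j'] by auto

text \<open>
  Injectivity of this and of the block permutation is what \<open>Redec_conv_Phi\<close> asks for.
\<close>

lemma inj_perm_sum:
  assumes "length \<tau>s = length ns" "\<And>i. i < length ns \<Longrightarrow> \<tau>s ! i permutes {1..ns ! i}"
  shows "inj (perm_sum ns \<tau>s)"
proof (rule inj_on_outside[of _ "{1..sum_list ns}"])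
  have tau: "(\<tau>s ! i) j \<in> {1..ns ! i}" if "i < length ns" "j \<in> {1..ns ! i}" for i j
    using assms(2)[OF that(1)] that(2) by (simp only: permutes_in_image)
  show "inj_on (perm_sum ns \<tau>s) {1..sum_list ns}"
  proof (rule inj_onI)
    fix x y assume xy: "x \<in> {1..sum_list ns}" "y \<in> {1..sum_list ns}" and e: "perm_sum ns \<tau>s x = perm_sum ns \<tau>s y"
    obtain i j where ij1: "i < length ns" "j \<in> {1..ns ! i}" "x = offset ns i + j"
      by (rule block_exhaust[OF xy(1)])
    obtain i' j' where ij2: "i' < length ns" "j' \<in> {1..ns ! i'}" "y = offset ns i' + j'"
      by (rule block_exhaust[OF xy(2)])
    note ij = ij1 ij2
    have "offset ns i + (\<tau>s ! i) j = offset ns i' + (\<tau>s ! i') j'"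
      using e ij by (simp only: perm_sum_block)
    then have "i = i'" "(\<tau>s ! i) j = (\<tau>s ! i') j'"
      using block_unique[OF ij(1) tau[OF ij(1,2)] ij(4) tau[OF ij(4,5)]] by blast+
    then have "j = j'" using injD[OF permutes_inj[OF assms(2)[OF ij(1)]]] by simp
    then show "x = y" using ij \<open>i = i'\<close> by simp
  qed
  show "perm_sum ns \<tau>s ` {1..sum_list ns} \<subseteq> {1..sum_list ns}"
  proof
    fix y assume "y \<in> perm_sum ns \<tau>s ` {1..sum_list ns}"
    then obtain x where "x \<in> {1..sum_list ns}" "y = perm_sum ns \<tau>s x" by blast
    then obtain i j where ij: "i < length ns" "j \<in> {1..ns ! i}" "y = perm_sum ns \<tau>s (offset ns i + j)"
      by (metis block_exhaust)
    then have "y = offset ns i + (\<tau>s ! i) j" by (simp only: perm_sum_block)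
    then show "y \<in> {1..sum_list ns}" using tau[OF ij(1,2)] block_le[OF ij(1), of "(\<tau>s ! i) j"] by simp
  qed
  show "perm_sum ns \<tau>s x = x" if "x \<notin> {1..sum_list ns}" for x
    by (simp only: perm_sum_def that if_False)
qed

lemma inj_block_perm:
  assumes s: "\<sigma> permutes {1..length ns}"
  shows "inj (block_perm ns \<sigma>)"
proof (rule inj_on_outside[of _ "{1..sum_list ns}"])
  let ?m = "reindex \<sigma> ns"
  note sm = sum_list_reindex[OF s]
  have si: "\<sigma> (Suc i) - 1 < length ns" "Suc (\<sigma> (Suc i) - 1) = \<sigma> (Suc i)" if "i < length ns" for i
    using permutes_in_image[OF s, of "Suc i"] that by auto
  have st: "\<And>x. x \<in> {1..sum_list ns} \<Longrightarrow> \<exists>i j. i < length ns \<and> j \<in> {1..ns ! (\<sigma> (Suc i) - 1)} \<and> x = offset ?m i + j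
     \<and> block_perm ns \<sigma> x = offset ns (\<sigma> (Suc i) - 1) + j"
  proof -
    fix x assume "x \<in> {1..sum_list ns}"
    then obtain i j where ij: "i < length ?m" "j \<in> {1..?m ! i}" "x = offset ?m i + j"
      using block_exhaust[of x ?m] sm by metis
    then show "\<exists>i j. i < length ns \<and> j \<in> {1..ns ! (\<sigma> (Suc i) - 1)} \<and> x = offset ?m i + j
     \<and> block_perm ns \<sigma> x = offset ns (\<sigma> (Suc i) - 1) + j"
      using block_perm_block[OF _ _ sm, of i j] nth_reindex[of i ns \<sigma>] by (intro exI[of _ i] exI[of _ j]) auto
  qed
  show "inj_on (block_perm ns \<sigma>) {1..sum_list ns}"
  proof (rule inj_onI)
    fix x y assume xy: "x \<in> {1..sum_list ns}" "y \<in> {1..sum_list ns}" and e: "block_perm ns \<sigma> x = block_perm ns \<sigma> y"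
    obtain i j where ij1: "i < length ns" "j \<in> {1..ns ! (\<sigma> (Suc i) - 1)}" "x = offset ?m i + j"
       "block_perm ns \<sigma> x = offset ns (\<sigma> (Suc i) - 1) + j"
      using st[OF xy(1)] by blast
    obtain i' j' where ij2: "i' < length ns" "j' \<in> {1..ns ! (\<sigma> (Suc i') - 1)}" "y = offset ?m i' + j'"
       "block_perm ns \<sigma> y = offset ns (\<sigma> (Suc i') - 1) + j'"
      using st[OF xy(2)] by blast
    note ij = ij1 ij2
    have e': "\<sigma> (Suc i) - 1 = \<sigma> (Suc i') - 1 \<and> j = j'"
      by (rule block_unique[OF si(1)[OF ij(1)] ij(2) si(1)[OF ij(5)] ij(6)])
        (simp only: e[unfolded ij(4) ij(8)])
    have "\<sigma> (Suc i) = \<sigma> (Suc i')"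
      by (rule box_equals[OF arg_cong[OF conjunct1[OF e'], of Suc] si(2)[OF ij(1)] si(2)[OF ij(5)]])
    moreover have "j = j'" using e' ..
    moreover from \<open>\<sigma> (Suc i) = _\<close> have "i = i'" using injD[OF permutes_inj[OF s], of "Suc i" "Suc i'"] by simp
    ultimately show "x = y" by (simp only: ij(3,7))
  qed
  show "block_perm ns \<sigma> ` {1..sum_list ns} \<subseteq> {1..sum_list ns}"
  proof
    fix y assume "y \<in> block_perm ns \<sigma> ` {1..sum_list ns}"
    then obtain i j where ij: "i < length ns" "j \<in> {1..ns ! (\<sigma> (Suc i) - 1)}"
      "y = offset ns (\<sigma> (Suc i) - 1) + j" using st by force
    then show "y \<in> {1..sum_list ns}" using block_le[OF si(1)[OF ij(1)], of j] by simp
  qed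
  show "block_perm ns \<sigma> x = x" if "x \<notin> {1..sum_list ns}" for x
    by (simp only: block_perm_def that if_False)
qed

lemma concat_block:
  "i < length xss \<Longrightarrow> j < length (xss ! i) \<Longrightarrow> concat xss ! (offset (map length xss) i + j) = xss ! i ! j"
proof (induction xss arbitrary: i)
  case (Cons xs xss)
  then show ?case by (cases i) (auto simp: nth_append offset_def)
qed simp

lemma offset_concat:
  "i < length mss \<Longrightarrow> j \<le> length (mss ! i) \<Longrightarrow>
     offset (concat mss) (offset (map length mss) i + j) = offset (map sum_list mss) i + offset (mss ! i) j"
proof (induction mss arbitrary: i)
  case (Cons ms mss)
  then show ?case by (cases i) (auto simp: offset_def)
qed simp

section \<open>Presentation by the free operad\<close>

lemma leaves_map [simp]: "leaves (map_optree id f t) = map f (leaves t)"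
  by (induction t) auto

lemma mset_leaves_graft: "mset (leaves (graft f t)) = (\<Sum>l\<in>#mset (leaves t). mset (leaves (f l)))"
  by (induction t) auto

lemma evalt_map: "evalt g (map_optree id f t) = evalt (\<lambda>l. g (f l)) t"
  by (induction t) auto

lemma evalt_graft: "evalt g (graft f t) = evalt (\<lambda>l. evalt g (f l)) t"
  by (induction t) auto

lemma Redec_evalt_gens: "inj f \<Longrightarrow> Redec f (evalt gens t) = evalt gens (map_optree id f t)"
  by (simp add: Redec_evalt evalt_map gens_def)

lemma sum_blocks:
  "(\<Sum>i\<in>{1..length ns}. image_mset (\<lambda>l. l + offset ns (i - 1)) (mset_set {1..ns ! (i - 1)})) = mset_set {1..sum_list ns}"
proof (induction ns rule: rev_induct)
  case (snoc n ns)
  have "(\<Sum>i\<in>{1..length (ns @ [n])}. image_mset (\<lambda>l. l + offset (ns @ [n]) (i - 1)) (mset_set {1..(ns @ [n]) ! (i - 1)})) =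
    (\<Sum>i\<in>{1..length ns}. image_mset (\<lambda>l. l + offset (ns @ [n]) (i - 1)) (mset_set {1..(ns @ [n]) ! (i - 1)})) +
    image_mset (\<lambda>l. l + sum_list ns) (mset_set {1..n})"
    by (simp add: offset_def)
  also have "(\<Sum>i\<in>{1..length ns}. image_mset (\<lambda>l. l + offset (ns @ [n]) (i - 1)) (mset_set {1..(ns @ [n]) ! (i - 1)})) = mset_set {1..sum_list ns}"
    unfolding snoc.IH[symmetric] by (intro sum.cong refl) (auto simp: offset_def nth_append)
  also have "image_mset (\<lambda>l. l + sum_list ns) (mset_set {1..n}) = mset_set {1 + sum_list ns..n + sum_list ns}"
    by (subst image_mset_mset_set) (simp_all add: inj_on_def image_add_atLeastAtMost')
  also have "mset_set {1..sum_list ns} + mset_set {1 + sum_list ns..n + sum_list ns} = mset_set ({1..sum_list ns} \<union> {1 + sum_list ns..n + sum_list ns})"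
    by (rule mset_set_Union[symmetric]) auto
  also have "{1..sum_list ns} \<union> {1 + sum_list ns..n + sum_list ns} = {1..sum_list (ns @ [n])}" by auto
  finally show ?case .
qed simp

lemma tree_comp_op_trees:
  assumes t: "t \<in> op_trees (length ns)" and us: "\<And>i. i < length ns \<Longrightarrow> us ! i \<in> op_trees (ns ! i)"
  shows "tree_comp ns t us \<in> op_trees (sum_list ns)"
proof -
  have "mset (leaves (tree_comp ns t us)) =
    (\<Sum>i\<in>#mset (leaves t). image_mset (\<lambda>l. l + offset ns (i - 1)) (mset (leaves (us ! (i - 1)))))"
    by (simp add: tree_comp_def mset_leaves_graft)
  also have "\<dots> = (\<Sum>i\<in>{1..length ns}. image_mset (\<lambda>l. l + offset ns (i - 1)) (mset (leaves (us ! (i - 1)))))"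
    using t unfolding op_trees_iff by (simp add: sum_unfold_sum_mset)
  also have "\<dots> = (\<Sum>i\<in>{1..length ns}. image_mset (\<lambda>l. l + offset ns (i - 1)) (mset_set {1..ns ! (i - 1)}))"
  proof (intro sum.cong refl)
    fix i assume "i \<in> {1..length ns}"
    then have "us ! (i - 1) \<in> op_trees (ns ! (i - 1))" by (intro us) auto
    then show "image_mset (\<lambda>l. l + offset ns (i - 1)) (mset (leaves (us ! (i - 1)))) =
      image_mset (\<lambda>l. l + offset ns (i - 1)) (mset_set {1..ns ! (i - 1)})" by (simp only: op_trees_iff)
  qed
  also have "\<dots> = mset_set {1..sum_list ns}" by (rule sum_blocks)
  finally show ?thesis by (simp add: op_trees_iff)
qed

text \<open>
  The map from the free operad onto the operad of WN posets.
\<close>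

definition Ev :: "((two_ops, nat) optree \<Rightarrow>\<^sub>0 'k::field) \<Rightarrow> (nat wnp \<Rightarrow>\<^sub>0 'k)" where
  "Ev = lin_ext (evalt gens)"

lemma lin_Ev: "lin Ev" by (simp add: Ev_def lin_lin_ext)

lemma Ev_basis [simp]: "Ev (basis t) = evalt gens t" by (simp add: Ev_def)

lemma evalt_tree_comp:
  assumes t: "t \<in> op_trees (length ns)" and len: "length us = length ns"
  shows "evalt gens (tree_comp ns t us) = evalt (args ns (map (evalt gens) us)) t"
  unfolding tree_comp_def evalt_graft
proof (rule evalt_cong)
  fix l assume "l \<in> set (leaves t)"
  then have "l - 1 < length us" using t len by (auto simp: op_trees_def)
  then show "evalt gens (map_optree id (\<lambda>la. la + offset ns (l - 1)) (us ! (l - 1))) = args ns (map (evalt gens) us) l"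
    by (simp add: args_def Redec_evalt_gens inj_shift)
qed

lemma free_operad_simps [simp]:
  "op_space (free_operad :: ('k::field, ('g, nat) optree \<Rightarrow>\<^sub>0 'k) operad) n = free_space (op_trees n)"
  "op_ident (free_operad :: ('k, ('g, nat) optree \<Rightarrow>\<^sub>0 'k) operad) = basis (Leaf 1)"
  "op_act (free_operad :: ('k, ('g, nat) optree \<Rightarrow>\<^sub>0 'k) operad) n \<sigma> = lin_ext (\<lambda>t. basis (map_optree id \<sigma> t))"
  by (simp_all add: free_operad_def)

lemma op_comp_free:
  "op_comp free_operad ns q ps = lin_ext (\<lambda>t. multi_sum (\<lambda>us. basis (tree_comp ns t us)) ps) q"
  by (simp add: free_operad_def multilin_ext_eq)

text \<open>
  Both sides are multilinear in \<open>ps\<close> and linear in \<open>q\<close>; for trees, grafting corresponds to evaluating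
  at the values of the grafted trees.
\<close>

lemma Ev_comp:
  fixes q :: "(two_ops, nat) optree \<Rightarrow>\<^sub>0 'k::field"
  assumes q: "q \<in> pm.span (basis ` op_trees (length ns))" and len: "length ps = length ns"
  shows "Ev (op_comp free_operad ns q ps) = Phi (args ns (map Ev ps)) (Ev q)"
proof -
  have "Ev (op_comp free_operad ns q ps) = lin_ext (\<lambda>t. multi_sum (\<lambda>us. evalt gens (tree_comp ns t us)) ps) q"
    by (simp add: op_comp_free lin_of_lin_ext[OF lin_Ev] lin_multi_sum[OF lin_Ev])
  also have "\<dots> = lin_ext (evalt (args ns (map Ev ps))) q"
  proof (rule lin_ext_cong)
    fix t assume "t \<in> keys q"
    then have t: "t \<in> op_trees (length ns)" using q by (auto simp: span_basis)
    have "multi_sum (\<lambda>us. evalt gens (tree_comp ns t us)) ps =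
        multi_sum (\<lambda>us. evalt (args ns (map Ev (map basis us))) t :: nat wnp \<Rightarrow>\<^sub>0 'k) ps"
      by (rule multi_sum_cong) (use len in \<open>simp add: evalt_tree_comp[OF t] comp_def\<close>)
    also have "\<dots> = evalt (args ns (map Ev ps)) t"
    proof (rule multilinear_expansion[where G = "\<lambda>ps. evalt (args ns (map Ev ps)) t"])
      fix zs :: "((two_ops, nat) optree \<Rightarrow>\<^sub>0 'k) list" and i
      assume "length zs = length ps" "i < length ps"
      then show "lin (\<lambda>x. evalt (args ns (map Ev (zs[i := x]))) t)"
        using lin_comp[OF lin_evalt_args[OF t, of "map Ev zs" i ns] lin_Ev] len by (simp add: map_update)
    qed
    finally show "multi_sum (\<lambda>us. evalt gens (tree_comp ns t us)) ps = (evalt (args ns (map Ev ps)) t :: nat wnp \<Rightarrow>\<^sub>0 'k)" .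
  qed
  also have "\<dots> = Phi (args ns (map Ev ps)) (Ev q)"
    by (simp add: Ev_def lin_of_lin_ext[OF lin_Phi])
  finally show ?thesis .
qed

lemma op_comp_free_closed:
  fixes q :: "('g, nat) optree \<Rightarrow>\<^sub>0 'k::field"
  assumes q: "q \<in> pm.span (basis ` op_trees (length ns))" and len: "length ps = length ns"
    and ps: "\<And>i. i < length ns \<Longrightarrow> ps ! i \<in> pm.span (basis ` op_trees (ns ! i))"
  shows "op_comp free_operad ns q ps \<in> pm.span (basis ` op_trees (sum_list ns))"
  unfolding op_comp_free lin_ext_def multi_sum_def
proof (intro pm.span_sum pm.span_scale pm.span_base imageI)
  fix t us assume t: "t \<in> keys q" and us: "us \<in> listset (map keys ps)"
  have "us ! i \<in> op_trees (ns ! i)" if "i < length ns" for i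
    using us ps[OF that] that len by (auto simp: listset_iff list_all2_conv_all_nth span_basis)
  then show "tree_comp ns t us \<in> op_trees (sum_list ns)"
    using t q by (intro tree_comp_op_trees) (auto simp: span_basis)
qed

lemma Ev_image:
  assumes "1 \<le> n"
  shows "Ev ` pm.span (basis ` op_trees n) = (pm.span (basis ` WNP_Ind n) :: (nat wnp \<Rightarrow>\<^sub>0 'k::field) set)"
proof
  show "Ev ` pm.span (basis ` op_trees n) \<subseteq> (pm.span (basis ` WNP_Ind n) :: (nat wnp \<Rightarrow>\<^sub>0 'k) set)"
    unfolding ind_space_span[OF assms]
  proof (rule image_subsetI)
    fix x :: "(two_ops, nat) optree \<Rightarrow>\<^sub>0 'k" assume "x \<in> pm.span (basis ` op_trees n)"
    then show "Ev x \<in> pm.span (evalt gens ` op_trees n)"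
    proof (rule lin_span_closed[OF lin_Ev, rotated])
      fix s :: "(two_ops, nat) optree \<Rightarrow>\<^sub>0 'k" assume "s \<in> basis ` op_trees n"
      then obtain t where "t \<in> op_trees n" "s = basis t" by blast
      then show "Ev s \<in> pm.span (evalt gens ` op_trees n)" by (simp add: pm.span_base)
    qed
  qed
  show "(pm.span (basis ` WNP_Ind n) :: (nat wnp \<Rightarrow>\<^sub>0 'k) set) \<subseteq> Ev ` pm.span (basis ` op_trees n)"
  proof
    fix y :: "nat wnp \<Rightarrow>\<^sub>0 'k" assume "y \<in> pm.span (basis ` WNP_Ind n)"
    then have "y \<in> pm.span (evalt gens ` op_trees n)" by (simp only: ind_space_span[OF assms])
    from span_image_lin_ext[OF this] obtain x where "keys x \<subseteq> op_trees n" "y = Ev x"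
      unfolding Ev_def by blast
    then show "y \<in> Ev ` pm.span (basis ` op_trees n)" by (simp add: span_basis)
  qed
qed

lemma Ev_closed: "1 \<le> n \<Longrightarrow> x \<in> pm.span (basis ` op_trees n) \<Longrightarrow> Ev x \<in> pm.span (basis ` WNP_Ind n)"
  using Ev_image[of n] by blast

lemma Ev_act:
  fixes x :: "(two_ops, nat) optree \<Rightarrow>\<^sub>0 'k::field"
  assumes "inj \<sigma>"
  shows "Ev (op_act free_operad n \<sigma> x) = Redec \<sigma> (Ev x)"
proof -
  have 1: "lin (\<lambda>x. Ev (lin_ext (\<lambda>t. basis (map_optree id \<sigma> t)) x) :: nat wnp \<Rightarrow>\<^sub>0 'k)"
    by (rule lin_comp[OF lin_Ev lin_lin_ext])
  have 2: "lin (\<lambda>x. Redec \<sigma> (Ev x) :: nat wnp \<Rightarrow>\<^sub>0 'k)"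
    by (rule lin_comp[OF lin_Redec lin_Ev])
  show ?thesis
    unfolding free_operad_simps
    by (rule lin_eqI[OF 1 2]) (simp add: Redec_evalt_gens[OF assms])
qed

lemma op_act_free_closed:
  fixes x :: "('g, nat) optree \<Rightarrow>\<^sub>0 'k::field"
  assumes s: "\<sigma> permutes {1..n}" and x: "x \<in> pm.span (basis ` op_trees n)"
  shows "op_act free_operad n \<sigma> x \<in> pm.span (basis ` op_trees n)"
  unfolding free_operad_simps
proof (rule lin_span_closed[OF lin_lin_ext _ x])
  fix y :: "('g, nat) optree \<Rightarrow>\<^sub>0 'k" assume "y \<in> basis ` op_trees n"
  then obtain t where t: "t \<in> op_trees n" "y = basis t" by blast
  then have "map_optree id \<sigma> t \<in> op_trees n"
    using permutes_image[OF s] permutes_inj_on[OF s] by (simp add: op_trees_def distinct_map)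
  then show "lin_ext (\<lambda>t. basis (map_optree id \<sigma> t)) y \<in> (pm.span (basis ` op_trees n) :: (('g, nat) optree \<Rightarrow>\<^sub>0 'k) set)"
    using t by (simp add: pm.span_base)
qed

section \<open>The operad axioms\<close>

lemma op_argsD:
  assumes "op_args \<O> ns ps"
  shows "length ps = length ns" "1 \<le> length ns" "1 \<le> sum_list ns" "\<And>i. i < length ns \<Longrightarrow> 1 \<le> ns ! i"
    "\<And>i. i < length ns \<Longrightarrow> ps ! i \<in> carrier (op_space \<O> (ns ! i))"
proof -
  show "length ps = length ns" "1 \<le> length ns" "\<And>i. i < length ns \<Longrightarrow> 1 \<le> ns ! i"
    "\<And>i. i < length ns \<Longrightarrow> ps ! i \<in> carrier (op_space \<O> (ns ! i))"
    using assms by (auto simp: op_args_def list_all2_conv_all_nth Suc_le_eq)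
  show "1 \<le> sum_list ns" using assms by (cases ns) (auto simp: op_args_def)
qed

text \<open>
  Since \<open>Ev\<close> is onto in each arity, this follows from the corresponding fact about trees.
\<close>

lemma op_comp_WNP_closed:
  fixes q :: "nat wnp \<Rightarrow>\<^sub>0 'k::field"
  assumes a: "op_args (WNP_operad :: ('k, nat wnp \<Rightarrow>\<^sub>0 'k) operad) ns ps"
    and q: "q \<in> pm.span (basis ` WNP_Ind (length ns))"
  shows "Phi (args ns ps) q \<in> pm.span (basis ` WNP_Ind (sum_list ns))"
proof -
  note d = op_argsD[OF a]
  obtain q' where q': "q' \<in> pm.span (basis ` op_trees (length ns))" "q = Ev q'"
    using q Ev_image[OF d(2), where 'k = 'k] by blast
  have "\<forall>i\<in>{..<length ns}. \<exists>p'. p' \<in> pm.span (basis ` op_trees (ns ! i)) \<and> ps ! i = Ev p'"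
    using d(5) Ev_image[OF d(4), where 'k = 'k] by (auto simp: image_iff) blast
  then obtain p' where p': "\<And>i. i < length ns \<Longrightarrow> p' i \<in> pm.span (basis ` op_trees (ns ! i)) \<and> ps ! i = Ev (p' i)"
    by (metis lessThan_iff)
  define ps' where "ps' = map p' [0..<length ns]"
  have "ps = map Ev ps'" using d(1) p' by (intro nth_equalityI) (auto simp: ps'_def)
  moreover have "op_comp free_operad ns q' ps' \<in> pm.span (basis ` op_trees (sum_list ns))"
    by (rule op_comp_free_closed[OF q'(1)]) (use p' in \<open>auto simp: ps'_def\<close>)
  then have "Ev (op_comp free_operad ns q' ps') \<in> pm.span (basis ` WNP_Ind (sum_list ns))"
    by (rule Ev_closed[OF d(3)])
  ultimately show ?thesis
    using Ev_comp[OF q'(1), of ps'] q'(2) by (simp add: ps'_def)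
qed

lemma Redec_ind_closed:
  assumes "\<sigma> permutes {1..n}" "x \<in> pm.span (basis ` WNP_Ind n)"
  shows "Redec \<sigma> x \<in> pm.span (basis ` WNP_Ind n)"
  using lin_Redec _ assms(2)
proof (rule lin_span_closed)
  fix s :: "nat wnp \<Rightarrow>\<^sub>0 'a" assume "s \<in> basis ` WNP_Ind n"
  then obtain P where P: "s = basis P" "dec_mset P = mset_set {1..n}" by (auto simp: WNP_Ind_iff)
  have "image_mset \<sigma> (mset_set {1..n}) = mset_set {1..n}"
    using permutes_inj_on[OF assms(1)] permutes_image[OF assms(1)] by (simp add: image_mset_mset_set)
  then have "redecorate \<sigma> P \<in> WNP_Ind n" using P by (simp add: WNP_Ind_iff)
  then show "Redec \<sigma> s \<in> pm.span (basis ` WNP_Ind n)" using P by (auto intro: pm.span_base)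
qed

text \<open>
  Both sides are of the form \<open>Phi h q\<close>; comparing the images of the generators leads to another two
  morphisms, applied to \<open>p\<^sub>i\<close>, and comparing these at generators leaves an identity between positions
  in concatenated lists.
\<close>

lemma WNP_assoc:
  fixes q :: "nat wnp \<Rightarrow>\<^sub>0 'k::field"
  assumes a: "op_args (WNP_operad :: ('k, nat wnp \<Rightarrow>\<^sub>0 'k) operad) (map length mss) ps"
    and q: "q \<in> pm.span (basis ` WNP_Ind (length mss))"
    and r: "list_all2 (op_args (WNP_operad :: ('k, nat wnp \<Rightarrow>\<^sub>0 'k) operad)) mss rss"
  shows "op_comp WNP_operad (concat mss) (op_comp WNP_operad (map length mss) q ps) (concat rss) =
        op_comp WNP_operad (map sum_list mss) q
          (map (\<lambda>i. op_comp WNP_operad (mss ! i) (ps ! i) (rss ! i)) [0..<length mss])"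
proof -
  note d = op_argsD[OF a, simplified]
  have lr: "length rss = length mss" using r by (simp add: list_all2_lengthD)
  have r': "op_args (WNP_operad :: ('k, nat wnp \<Rightarrow>\<^sub>0 'k) operad) (mss ! i) (rss ! i)" if "i < length mss" for i
    using r that by (simp add: list_all2_conv_all_nth)
  note dr = op_argsD[OF r', simplified]
  have lens: "map length rss = map length mss" using lr dr(1) by (intro nth_equalityI) auto
  let ?o = "offset (map length mss)" and ?o' = "offset (map sum_list mss)"
  let ?G = "args (concat mss) (concat rss)"
  have len_concat: "length (concat mss) = sum_list (map length mss)" by (simp add: length_concat)
  have "op_comp WNP_operad (concat mss) (op_comp WNP_operad (map length mss) q ps) (concat rss) =
    Phi ?G (Phi (args (map length mss) ps) q)"
    using op_comp_WNP[of q "map length mss" ps] q d(1)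
      op_comp_WNP[of "Phi (args (map length mss) ps) q" "concat mss" "concat rss"]
      op_comp_WNP_closed[OF a, of q] lens
    by (simp add: length_concat)
  also have "\<dots> = Phi (\<lambda>i. Phi ?G (args (map length mss) ps i)) q" by (rule Phi_Phi)
  also have "\<dots> = Phi (args (map sum_list mss) (map (\<lambda>i. op_comp WNP_operad (mss ! i) (ps ! i) (rss ! i)) [0..<length mss])) q"
  proof (rule ind_Phi_cong[OF q])
    fix i' assume "i' \<in> {1..length mss}"
    then obtain i where i: "i' = Suc i" "i < length mss" by (cases i') auto
    have p: "ps ! i \<in> pm.span (basis ` WNP_Ind (length (mss ! i)))" using d(5) i(2) by simp
    have "Phi ?G (args (map length mss) ps i') = Phi (\<lambda>d. ?G (d + ?o i)) (ps ! i)"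
      by (simp add: i args_def[of "map length mss"] Phi_Redec[OF inj_shift])
    also have "\<dots> = Phi (\<lambda>d. Redec (\<lambda>c. c + ?o' i) (args (mss ! i) (rss ! i) d)) (ps ! i)"
    proof (rule ind_Phi_cong[OF p])
      fix j' assume "j' \<in> {1..length (mss ! i)}"
      then obtain j where j: "j' = Suc j" "j < length (mss ! i)" by (cases j') auto
      have "concat rss ! (?o i + j) = rss ! i ! j"
        using concat_block[of i rss j] i(2) lr j(2) dr(1) lens by simp
      moreover have "offset (concat mss) (?o i + j) = ?o' i + offset (mss ! i) j"
        using offset_concat[of i mss j] i j by simp
      ultimately show "?G (j' + ?o i) = Redec (\<lambda>c. c + ?o' i) (args (mss ! i) (rss ! i) j')"
        by (simp add: args_def j Redec_Redec add.commute add.left_commute)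
    qed
    also have "\<dots> = Redec (\<lambda>c. c + ?o' i) (Phi (args (mss ! i) (rss ! i)) (ps ! i))"
      by (simp add: Redec_Phi[OF inj_shift])
    also have "\<dots> = args (map sum_list mss) (map (\<lambda>i. op_comp WNP_operad (mss ! i) (ps ! i) (rss ! i)) [0..<length mss]) i'"
      using op_comp_WNP[OF p dr(1)[OF i(2)]] i by (simp add: args_def)
    finally show "Phi ?G (args (map length mss) ps i') =
      args (map sum_list mss) (map (\<lambda>i. op_comp WNP_operad (mss ! i) (ps ! i) (rss ! i)) [0..<length mss]) i'" .
  qed
  also have "\<dots> = op_comp WNP_operad (map sum_list mss) q
          (map (\<lambda>i. op_comp WNP_operad (mss ! i) (ps ! i) (rss ! i)) [0..<length mss])"
    by (rule op_comp_WNP[symmetric]) (use q in auto)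
  finally show ?thesis .
qed

lemma WNP_equivariant_inner:
  fixes q :: "nat wnp \<Rightarrow>\<^sub>0 'k::field"
  assumes a: "op_args (WNP_operad :: ('k, nat wnp \<Rightarrow>\<^sub>0 'k) operad) ns ps"
    and q: "q \<in> pm.span (basis ` WNP_Ind (length ns))"
    and t: "list_all2 (\<lambda>n \<tau>. \<tau> permutes {1..n}) ns \<tau>s"
  shows "op_comp WNP_operad ns q (map (\<lambda>i. Redec (\<tau>s ! i) (ps ! i)) [0..<length ns]) =
        Redec (perm_sum ns \<tau>s) (op_comp WNP_operad ns q ps)"
proof -
  note d = op_argsD[OF a, simplified]
  have lt: "length \<tau>s = length ns" using t by (simp add: list_all2_lengthD)
  have t': "\<tau>s ! i permutes {1..ns ! i}" if "i < length ns" for i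
    using t that by (simp add: list_all2_conv_all_nth)
  have inj: "inj (perm_sum ns \<tau>s)" by (rule inj_perm_sum[OF lt t'])
  have "Phi (args ns (map (\<lambda>i. Redec (\<tau>s ! i) (ps ! i)) [0..<length ns])) q =
    Phi (\<lambda>i. Redec (perm_sum ns \<tau>s) (args ns ps i)) q"
  proof (rule ind_Phi_cong[OF q])
    fix i' assume "i' \<in> {1..length ns}"
    then obtain i where i: "i' = Suc i" "i < length ns" by (cases i') auto
    have p: "ps ! i \<in> pm.span (basis ` WNP_Ind (ns ! i))" using d(5) i(2) by simp
    have it: "inj (\<tau>s ! i)" using permutes_inj[OF t'[OF i(2)]] .
    have "args ns (map (\<lambda>i. Redec (\<tau>s ! i) (ps ! i)) [0..<length ns]) i' =
       Phi (\<lambda>j. basis (dot ((\<tau>s ! i) j + offset ns i))) (ps ! i)"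
      using i by (simp add: args_def Redec_conv_Phi[OF inj_shift] Phi_Redec[OF it])
    also have "\<dots> = Phi (\<lambda>j. basis (dot (perm_sum ns \<tau>s (j + offset ns i)))) (ps ! i)"
      by (rule ind_Phi_cong[OF p]) (simp only: perm_sum_block[OF i(2)] add.commute[of _ "offset ns i"])
    also have "\<dots> = Redec (perm_sum ns \<tau>s) (args ns ps i')"
      using i by (simp add: args_def Redec_conv_Phi[OF inj] Phi_Redec[OF inj_shift])
    finally show "args ns (map (\<lambda>i. Redec (\<tau>s ! i) (ps ! i)) [0..<length ns]) i' = Redec (perm_sum ns \<tau>s) (args ns ps i')" .
  qed
  then show ?thesis using q d(1) by (simp add: op_comp_WNP Redec_Phi[OF inj])
qed

lemma WNP_equivariant_outer:
  fixes q :: "nat wnp \<Rightarrow>\<^sub>0 'k::field"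
  assumes a: "op_args (WNP_operad :: ('k, nat wnp \<Rightarrow>\<^sub>0 'k) operad) ns ps"
    and q: "q \<in> pm.span (basis ` WNP_Ind (length ns))"
    and s: "\<sigma> permutes {1..length ns}"
  shows "op_comp WNP_operad ns (Redec \<sigma> q) ps =
        Redec (block_perm ns \<sigma>) (op_comp WNP_operad (reindex \<sigma> ns) q (reindex \<sigma> ps))"
proof -
  note d = op_argsD[OF a, simplified]
  let ?m = "reindex \<sigma> ns"
  have inj_s: "inj \<sigma>" using permutes_inj[OF s] .
  have inj: "inj (block_perm ns \<sigma>)" by (rule inj_block_perm[OF s])
  have "Phi (\<lambda>i. args ns ps (\<sigma> i)) q = Phi (\<lambda>i. Redec (block_perm ns \<sigma>) (args ?m (reindex \<sigma> ps) i)) q"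
  proof (rule ind_Phi_cong[OF q])
    fix i' assume i'0: "i' \<in> {1..length ns}"
    then obtain i where i: "i' = Suc i" "i < length ns" by (cases i') auto
    have si: "\<sigma> (Suc i) - 1 < length ns" using permutes_in_image[OF s, of "Suc i"] i by auto
    have mi: "?m ! i = ns ! (\<sigma> (Suc i) - 1)" using i by (simp add: nth_reindex)
    have p: "ps ! (\<sigma> (Suc i) - 1) \<in> pm.span (basis ` WNP_Ind (?m ! i))" using d(5)[OF si] mi by simp
    have "Redec (block_perm ns \<sigma>) (args ?m (reindex \<sigma> ps) i') =
      Phi (\<lambda>j. basis (dot (block_perm ns \<sigma> (j + offset ?m i)))) (ps ! (\<sigma> (Suc i) - 1))"
      using i d(1) by (simp add: args_def nth_reindex Redec_conv_Phi[OF inj] Phi_Redec[OF inj_shift])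
    also have "\<dots> = Phi (\<lambda>j. basis (dot (j + offset ns (\<sigma> (Suc i) - 1)))) (ps ! (\<sigma> (Suc i) - 1))"
      by (rule ind_Phi_cong[OF p])
        (simp only: block_perm_block[OF i(2) _ sum_list_reindex[OF s]] add.commute[of _ "offset ?m i"] add.commute[of _ "offset ns _"])
    also have "\<dots> = args ns ps (\<sigma> i')"
      using i by (simp add: args_def Redec_conv_Phi[OF inj_shift])
    finally show "args ns ps (\<sigma> i') = Redec (block_perm ns \<sigma>) (args ?m (reindex \<sigma> ps) i')" by simp
  qed
  then show ?thesis
    using q d(1) Redec_ind_closed[OF s q] by (simp add: op_comp_WNP Redec_Phi[OF inj] Phi_Redec[OF inj_s])
qed

lemma WNP_unit_inner:
  fixes p :: "nat wnp \<Rightarrow>\<^sub>0 'k::field"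
  assumes p: "p \<in> pm.span (basis ` WNP_Ind n)"
  shows "op_comp WNP_operad (replicate n 1) p (replicate n (basis (dot 1))) = p"
proof -
  have o: "offset (replicate n 1) i = i" if "i \<le> n" for i
    using that by (simp add: offset_def sum_list_replicate)
  have "Phi (args (replicate n 1) (replicate n (basis (dot 1)))) p = Phi gens p"
    by (rule ind_Phi_cong[OF p]) (auto simp: args_def gens_def o[simplified])
  then show ?thesis using p by (simp add: op_comp_WNP Phi_ident)
qed

lemma WNP_unit_outer:
  fixes p :: "nat wnp \<Rightarrow>\<^sub>0 'k::field"
  shows "op_comp WNP_operad [n] (basis (dot 1)) [p] = p"
proof -
  have "(basis (dot 1) :: nat wnp \<Rightarrow>\<^sub>0 'k) \<in> pm.span (basis ` WNP_Ind 1)"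
    by (intro pm.span_base imageI) (simp add: WNP_Ind_iff)
  then show ?thesis by (simp add: op_comp_WNP args_def Redec_ident)
qed

theorem WNP_symmetric_operad: "symmetric_operad (WNP_operad :: ('k::field, nat wnp \<Rightarrow>\<^sub>0 'k) operad)"
proof -
  let ?W = "WNP_operad :: ('k, nat wnp \<Rightarrow>\<^sub>0 'k) operad"
  have id: "(basis (dot 1) :: nat wnp \<Rightarrow>\<^sub>0 'k) \<in> pm.span (basis ` WNP_Ind 1)"
    by (intro pm.span_base imageI) (simp add: WNP_Ind_iff)
  have A: "(\<lambda>q. op_comp ?W ns q ps) \<in> lin_maps (op_space ?W (length ns)) (op_space ?W (sum_list ns))"
    if a: "op_args ?W ns ps" for ns ps
    using op_comp_WNP_closed[OF a] op_argsD(1)[OF a]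
    by (auto simp: lin_maps_def op_comp_WNP pm.span_add pm.span_scale lin_add[OF lin_Phi] lin_scale[OF lin_Phi])
  have B: "(\<lambda>x. op_comp ?W ns q (ps[i := x])) \<in> lin_maps (op_space ?W (ns ! i)) (op_space ?W (sum_list ns))"
    if a: "op_args ?W ns ps" and q: "q \<in> carrier (op_space ?W (length ns))" and i: "i < length ns" for ns ps q i
  proof -
    note d = op_argsD[OF a]
    have q': "q \<in> pm.span (basis ` WNP_Ind (length ns))" using q by simp
    have l: "lin (\<lambda>x. Phi (args ns (ps[i := x])) q)" by (rule lin_Phi_args[OF q' d(1) i])
    have e: "op_comp ?W ns q (ps[i := x]) = Phi (args ns (ps[i := x])) q" for x
      using q' d(1) by (simp add: op_comp_WNP)
    have "Phi (args ns (ps[i := x])) q \<in> pm.span (basis ` WNP_Ind (sum_list ns))"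
      if "x \<in> pm.span (basis ` WNP_Ind (ns ! i))" for x
    proof (rule op_comp_WNP_closed[OF _ q'])
      show "op_args ?W ns (ps[i := x])"
        using a that i by (auto simp: op_args_def list_all2_conv_all_nth nth_list_update)
    qed
    then show ?thesis by (simp add: lin_maps_def e lin_add[OF l] lin_scale[OF l])
  qed
  have C: "op_act ?W n \<sigma> \<in> lin_maps (op_space ?W n) (op_space ?W n)" if "\<sigma> permutes {1..n}" for n \<sigma>
    using Redec_ind_closed[OF that] by (auto simp: lin_maps_def lin_add[OF lin_Redec] lin_scale[OF lin_Redec])
  have D: "op_act ?W n id x = x" "op_act ?W n (\<sigma> \<circ> \<tau>) x = op_act ?W n \<sigma> (op_act ?W n \<tau> x)" for n x \<sigma> \<tau>
    using Redec_ident[of x] by (simp_all add: Redec_Redec id_def comp_def)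
  have F: "op_comp ?W [n] (op_ident ?W) [p] = p \<and> op_comp ?W (replicate n 1) p (replicate n (op_ident ?W)) = p"
    if "p \<in> carrier (op_space ?W n)" for n p
    using that WNP_unit_inner[of p n] WNP_unit_outer[of n p] by simp
  show ?thesis
    unfolding symmetric_operad_def
  proof (intro conjI allI impI ballI)
    show "Module.module (ring_of_type_algebra :: 'k ring) (op_space ?W n)" for n
      by (simp add: module_free_space)
  next
    show "op_ident ?W \<in> carrier (op_space ?W 1)" using id by simp
  next
    fix ns ps assume "op_args ?W ns ps"
    then show "(\<lambda>q. op_comp ?W ns q ps) \<in> lin_maps (op_space ?W (length ns)) (op_space ?W (sum_list ns))" by (rule A)
  next
    fix ns ps q i assume "op_args ?W ns ps \<and> q \<in> carrier (op_space ?W (length ns)) \<and> i < length ns"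
    then show "(\<lambda>x. op_comp ?W ns q (ps[i := x])) \<in> lin_maps (op_space ?W (ns ! i)) (op_space ?W (sum_list ns))"
      using B by blast
  next
    fix n p assume "p \<in> carrier (op_space ?W n)"
    then show "op_comp ?W [n] (op_ident ?W) [p] = p" "op_comp ?W (replicate n 1) p (replicate n (op_ident ?W)) = p"
      using F by blast+
  next
    fix mss ps rss q
    assume "op_args ?W (map length mss) ps \<and> q \<in> carrier (op_space ?W (length mss)) \<and> list_all2 (op_args ?W) mss rss"
    then show "op_comp ?W (concat mss) (op_comp ?W (map length mss) q ps) (concat rss) =
        op_comp ?W (map sum_list mss) q (map (\<lambda>i. op_comp ?W (mss ! i) (ps ! i) (rss ! i)) [0..<length mss])"
      by (intro WNP_assoc) auto
  next
    fix n \<sigma> assume "\<sigma> permutes {1..n::nat}"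
    then show "op_act ?W n \<sigma> \<in> lin_maps (op_space ?W n) (op_space ?W n)" by (rule C)
  next
    fix n x show "op_act ?W n id x = x" by (rule D)
  next
    fix n \<sigma> \<tau> x show "op_act ?W n (\<sigma> \<circ> \<tau>) x = op_act ?W n \<sigma> (op_act ?W n \<tau> x)" by (rule D)
  next
    fix ns ps q \<tau>s
    assume "op_args ?W ns ps \<and> q \<in> carrier (op_space ?W (length ns)) \<and> list_all2 (\<lambda>n \<tau>. \<tau> permutes {1..n}) ns \<tau>s"
    then show "op_comp ?W ns q (map (\<lambda>i. op_act ?W (ns ! i) (\<tau>s ! i) (ps ! i)) [0..<length ns]) =
        op_act ?W (sum_list ns) (perm_sum ns \<tau>s) (op_comp ?W ns q ps)"
      using WNP_equivariant_inner[of ns ps q \<tau>s] by simp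
  next
    fix ns ps q \<sigma>
    assume "op_args ?W ns ps \<and> q \<in> carrier (op_space ?W (length ns)) \<and> \<sigma> permutes {1..length ns}"
    then show "op_comp ?W ns (op_act ?W (length ns) \<sigma> q) ps =
        op_act ?W (sum_list ns) (block_perm ns \<sigma>) (op_comp ?W (reindex \<sigma> ns) q (reindex \<sigma> ps))"
      using WNP_equivariant_outer[of ns ps q \<sigma>] by simp
  qed
qed

section \<open>The ideal of relations\<close>

lemma minus_free_space:
  assumes "x \<in> pm.span (basis ` B)"
  shows "\<ominus>\<^bsub>free_space B\<^esub> x = - (x :: 'b \<Rightarrow>\<^sub>0 'k::field)"
  by (rule abelian_group.minus_equality[OF abelian_group_free_space])
    (use assms in \<open>auto intro: pm.span_neg\<close>)

lemma submodule_free_space_iff: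
  "submodule H (ring_of_type_algebra :: 'k::field ring) (free_space B :: ('k, 'b \<Rightarrow>\<^sub>0 'k) module) \<longleftrightarrow>
     pm.subspace H \<and> H \<subseteq> pm.span (basis ` B)"
proof
  let ?R = "ring_of_type_algebra :: 'k ring"
  assume s: "submodule H ?R (free_space B)"
  note E = module.submoduleE[OF module_free_space s]
  have c: "carrier ?R = UNIV" by (simp add: ring_of_type_algebra_def)
  obtain x where x: "x \<in> H" using E(2) by blast
  then have "scale 0 x \<in> H" using E(4)[of 0 x] c by simp
  then have "0 \<in> H" by simp
  then show "pm.subspace H \<and> H \<subseteq> pm.span (basis ` B)"
    using E(1,4,5) c by (auto simp: pm.subspace_def)
next
  assume "pm.subspace H \<and> H \<subseteq> pm.span (basis ` B)"
  then show "submodule H (ring_of_type_algebra :: 'k ring) (free_space B)"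
    by (intro module.submoduleI[OF module_free_space])
      (auto simp: pm.subspace_0 pm.subspace_add pm.subspace_scale minus_free_space pm.subspace_neg subset_iff)
qed

definition relators :: "nat \<Rightarrow> ((two_ops, nat) optree \<Rightarrow>\<^sub>0 'k::field) set" where
  "relators = (\<lambda>n. if n = 3 then {assoc_relator free_operad (generator Op1),
                            assoc_relator free_operad (generator Op2)} else {})"

definition Ev_kernel :: "nat \<Rightarrow> ((two_ops, nat) optree \<Rightarrow>\<^sub>0 'k::field) set" where
  "Ev_kernel n = {x \<in> pm.span (basis ` op_trees n). Ev x = 0}"

lemma op_comp_free_basis:
  "op_comp free_operad ns (basis t) (map basis us) = (basis (tree_comp ns t us) :: _ \<Rightarrow>\<^sub>0 'k::field)"
proof -
  have l: "listset (map keys (map (basis :: _ \<Rightarrow> _ \<Rightarrow>\<^sub>0 'k) us)) = {us}"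
    by (induction us) (auto simp: set_Cons_def)
  show ?thesis unfolding op_comp_free multi_sum_def l by simp
qed

lemma assoc_relator_free:
  "assoc_relator free_operad (generator q) =
     (basis (Node q (Node q (Leaf 1) (Leaf 2)) (Leaf 3)) - basis (Node q (Leaf 1) (Node q (Leaf 2) (Leaf 3)))
       :: (two_ops, nat) optree \<Rightarrow>\<^sub>0 'k::field)"
proof -
  let ?l = "Node q (Node q (Leaf 1) (Leaf 2)) (Leaf 3) :: (two_ops, nat) optree"
  let ?r = "Node q (Leaf 1) (Node q (Leaf 2) (Leaf 3)) :: (two_ops, nat) optree"
  let ?t = "Node q (Leaf 1) (Leaf 2) :: (two_ops, nat) optree"
  have l: "op_comp free_operad [2, 1] (basis ?t) [basis ?t, basis (Leaf 1)] = (basis ?l :: _ \<Rightarrow>\<^sub>0 'k)"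
    using op_comp_free_basis[of "[2, 1]" ?t "[?t, Leaf 1]", where 'k = 'k] by (simp add: tree_comp_def offset_def numeral_2_eq_2 numeral_3_eq_3)
  have r: "op_comp free_operad [1, 2] (basis ?t) [basis (Leaf 1), basis ?t] = (basis ?r :: _ \<Rightarrow>\<^sub>0 'k)"
    using op_comp_free_basis[of "[1, 2]" ?t "[Leaf 1, ?t]", where 'k = 'k] by (simp add: tree_comp_def offset_def numeral_2_eq_2 numeral_3_eq_3)
  have "(basis ?r :: _ \<Rightarrow>\<^sub>0 'k) \<in> pm.span (basis ` op_trees 3)"
    by (intro pm.span_base imageI) (auto simp: op_trees_def)
  then show ?thesis
    unfolding assoc_relator_def generator_def free_operad_simps l r a_minus_def
    by (simp add: minus_free_space)
qed

lemma op_comp_free_linear: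
  "lin (\<lambda>q. op_comp free_operad ns q ps :: _ \<Rightarrow>\<^sub>0 'k::field)"
  by (simp add: op_comp_free lin_lin_ext)

lemma map_leaves_ident [simp]: "map_optree id (\<lambda>l. l) t = t"
  by (induction t) (simp_all add: id_def)

text \<open>
  The leaves are numbered consecutively from left to right.  Associativity preserves the order of the
  leaves, and the composition of consecutively numbered trees is consecutively numbered if the
  outer tree is; so for numbered trees rebracketing can be expressed by compositions alone.
\<close>

fun number :: "nat \<Rightarrow> ('g, 'l) optree \<Rightarrow> ('g, nat) optree" where
  "number a (Leaf l) = Leaf a"
| "number a (Node g s t) = Node g (number a s) (number (a + length (leaves s)) t)"

lemma leaves_number: "leaves (number a t) = [a..<a + length (leaves t)]"
  by (induction t arbitrary: a) (simp_all add: upt_add_eq_append[symmetric] add.assoc[symmetric])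

lemma number_shift: "map_optree id (\<lambda>l. l + c) (number a t) = number (a + c) t"
  by (induction t arbitrary: a) (auto simp: ac_simps)

lemma map_number:
  "(\<And>i. i < length (leaves t) \<Longrightarrow> f (a + i) = leaves t ! i) \<Longrightarrow> map_optree id f (number a t) = t"
proof (induction t arbitrary: a)
  case (Leaf l)
  from Leaf[of 0] show ?case by simp
next
  case (Node g s t)
  have "map_optree id f (number a s) = s"
    by (rule Node.IH(1)) (use Node.prems in \<open>simp add: nth_append\<close>)
  moreover have "map_optree id f (number (a + length (leaves s)) t) = t"
  proof (rule Node.IH(2))
    fix i assume "i < length (leaves t)"
    then show "f (a + length (leaves s) + i) = leaves t ! i"
      using Node.prems[of "length (leaves s) + i"] by (simp add: nth_append add.assoc)
  qed
  ultimately show ?case by (simp add: id_def)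
qed

lemma number_op_trees: "number 1 t \<in> op_trees (length (leaves t))"
  by (auto simp: op_trees_def leaves_number)

lemma op_comp_free_pair:
  fixes x y :: "('g, nat) optree \<Rightarrow>\<^sub>0 'k::field"
  shows "op_comp free_operad ns (basis t) [x, y] = bilin_ext (\<lambda>a b. basis (tree_comp ns t [a, b])) x y"
proof -
  let ?B = "bilin_ext (\<lambda>a b. basis (tree_comp ns t [a, b])) :: _ \<Rightarrow> _ \<Rightarrow> (('g, nat) optree \<Rightarrow>\<^sub>0 'k)"
  let ?G = "\<lambda>zs. ?B (zs ! 0) (zs ! 1)"
  have "op_comp free_operad ns (basis t) [x, y] = multi_sum (\<lambda>us. basis (tree_comp ns t us)) [x, y]"
    by (simp add: op_comp_free)
  also have "\<dots> = multi_sum (\<lambda>us. ?G (map basis us)) [x, y]"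
  proof (rule multi_sum_cong)
    fix us :: "('g, nat) optree list" assume "length us = length [x, y]"
    then obtain a b where "us = [a, b]" by (auto simp: length_Suc_conv)
    then show "basis (tree_comp ns t us) = ?G (map basis us)" by simp
  qed
  also have "\<dots> = ?G [x, y]"
  proof (rule multilinear_expansion)
    fix zs :: "(('g, nat) optree \<Rightarrow>\<^sub>0 'k) list" and i assume "length zs = length [x, y]" "i < length [x, y]"
    then consider "i = 0" "length zs = 2" | "i = 1" "length zs = 2" by fastforce
    then show "lin (\<lambda>z. ?G (zs[i := z]))" by cases (simp_all add: bilin_ext_linear)
  qed
  finally show ?thesis by simp
qed

lemma operad_idealD:
  fixes J :: "nat \<Rightarrow> ((two_ops, nat) optree \<Rightarrow>\<^sub>0 'k::field) set"
  assumes "operad_ideal free_operad J"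
  shows "1 \<le> n \<Longrightarrow> pm.subspace (J n)"
    and "1 \<le> n \<Longrightarrow> \<sigma> permutes {1..n} \<Longrightarrow> x \<in> J n \<Longrightarrow> lin_ext (\<lambda>t. basis (map_optree id \<sigma> t)) x \<in> J n"
    and "op_args (free_operad :: ('k, (two_ops, nat) optree \<Rightarrow>\<^sub>0 'k) operad) ns ps \<Longrightarrow>
      q \<in> pm.span (basis ` op_trees (length ns)) \<Longrightarrow>
      q \<in> J (length ns) \<or> (\<exists>i<length ns. ps ! i \<in> J (ns ! i)) \<Longrightarrow> op_comp free_operad ns q ps \<in> J (sum_list ns)"
  using assms unfolding operad_ideal_def by (simp_all add: submodule_free_space_iff image_subset_iff)

text \<open>
  For an associativity step, compose the relator with the three subtrees; for a step inside a node,
  compose the node with the difference of the subtrees.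
\<close>

lemma equiv_in_ideal:
  fixes J :: "nat \<Rightarrow> ((two_ops, nat) optree \<Rightarrow>\<^sub>0 'k::field) set"
  assumes J: "operad_ideal free_operad J" and R: "relators 3 \<subseteq> J 3"
  shows "s \<approx> t \<Longrightarrow> basis (number 1 s) - basis (number 1 t) \<in> J (length (leaves s))"
proof (induction rule: assoc_equiv.induct)
  case (equiv_refl t)
  then show ?case using operad_idealD(1)[OF J, of "length (leaves t)"] length_leaves_pos[of t]
    by (simp add: pm.subspace_0 Suc_le_eq)
next
  case (equiv_sym s t)
  have "pm.subspace (J (length (leaves s)))" by (rule operad_idealD(1)[OF J]) (simp add: Suc_le_eq)
  from pm.subspace_neg[OF this equiv_sym.IH] show ?case using equiv_leaves[OF equiv_sym.hyps] by simp
next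
  case (equiv_trans s t u)
  have "pm.subspace (J (length (leaves s)))" by (rule operad_idealD(1)[OF J]) (simp add: Suc_le_eq)
  from pm.subspace_add[OF this equiv_trans.IH(1)] equiv_trans.IH(2)
  show ?case using equiv_leaves[OF equiv_trans.hyps(1)] by fastforce
next
  case (equiv_cong s s' t t' q)
  let ?m = "length (leaves s)" and ?k = "length (leaves t)"
  let ?n = "number 1 :: (two_ops, 'a) optree \<Rightarrow> (two_ops, nat) optree"
  let ?T = "Node q (Leaf 1) (Leaf 2) :: (two_ops, nat) optree"
  have ls: "length (leaves s') = ?m" "length (leaves t') = ?k"
    using equiv_leaves equiv_cong.hyps by metis+
  have tc: "tree_comp [?m, ?k] ?T [a, b] = Node q a (map_optree id (\<lambda>l. l + ?m) b)" for a b
    by (simp add: tree_comp_def offset_def)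
  have num2: "number 1 (Node q a b) = tree_comp [?m, ?k] ?T [?n a, ?n b]" if "length (leaves a) = ?m" for a b
    by (simp only: tc number.simps number_shift that)
  let ?B = "bilin_ext (\<lambda>a b. basis (tree_comp [?m, ?k] ?T [a, b])) :: _ \<Rightarrow> _ \<Rightarrow> ((two_ops, nat) optree \<Rightarrow>\<^sub>0 'k)"
  have B: "?B (basis a) (basis b) = basis (tree_comp [?m, ?k] ?T [a, b])" for a b by simp
  have pos: "1 \<le> ?m" "1 \<le> ?k" by (simp_all add: Suc_le_eq)
  have num: "(basis (?n a) :: _ \<Rightarrow>\<^sub>0 'k) \<in> pm.span (basis ` op_trees (length (leaves a)))" for a
    by (intro pm.span_base imageI number_op_trees)
  have T: "(basis ?T :: _ \<Rightarrow>\<^sub>0 'k) \<in> pm.span (basis ` op_trees (length [?m, ?k]))"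
    by (intro pm.span_base imageI) (auto simp: op_trees_def)
  have 1: "?B (basis (?n s) - basis (?n s')) (basis (?n t)) \<in> J (sum_list [?m, ?k])"
    unfolding op_comp_free_pair[symmetric]
  proof (rule operad_idealD(3)[OF J _ T])
    show "op_args (free_operad :: ('k, (two_ops, nat) optree \<Rightarrow>\<^sub>0 'k) operad) [?m, ?k] [basis (?n s) - basis (?n s'), basis (?n t)]"
      using pos num[of s] num[of s'] num[of t] ls by (simp add: op_args_def pm.span_diff)
    show "basis ?T \<in> J (length [?m, ?k]) \<or> (\<exists>i<length [?m, ?k]. [basis (?n s) - basis (?n s'), basis (?n t)] ! i \<in> J ([?m, ?k] ! i))"
      using equiv_cong.IH(1) by (intro disjI2 exI[of _ 0]) simp
  qed
  have 2: "?B (basis (?n s')) (basis (?n t) - basis (?n t')) \<in> J (sum_list [?m, ?k])"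
    unfolding op_comp_free_pair[symmetric]
  proof (rule operad_idealD(3)[OF J _ T])
    show "op_args (free_operad :: ('k, (two_ops, nat) optree \<Rightarrow>\<^sub>0 'k) operad) [?m, ?k] [basis (?n s'), basis (?n t) - basis (?n t')]"
      using pos num[of s'] num[of t'] num[of t] ls by (simp add: op_args_def pm.span_diff)
    show "basis ?T \<in> J (length [?m, ?k]) \<or> (\<exists>i<length [?m, ?k]. [basis (?n s'), basis (?n t) - basis (?n t')] ! i \<in> J ([?m, ?k] ! i))"
      using equiv_cong.IH(2) by (intro disjI2 exI[of _ 1]) simp
  qed
  have "basis (number 1 (Node q s t)) - basis (number 1 (Node q s' t')) =
    ?B (basis (?n s) - basis (?n s')) (basis (?n t)) + ?B (basis (?n s')) (basis (?n t) - basis (?n t'))"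
    by (simp only: num2 ls lin_diff[OF bilin_ext_linear(1)] lin_diff[OF bilin_ext_linear(2)] B) simp
  also have "\<dots> \<in> J (sum_list [?m, ?k])"
    by (rule pm.subspace_add[OF operad_idealD(1)[OF J] 1 2]) (use pos in simp)
  finally show ?case by simp
next
  case (equiv_assoc q s t u)
  let ?m = "length (leaves s)" and ?k = "length (leaves t)" and ?l = "length (leaves u)"
  let ?ns = "[?m, ?k, ?l]"
  let ?us = "[number 1 s, number 1 t, number 1 u]"
  let ?L = "Node q (Node q (Leaf 1) (Leaf 2)) (Leaf 3) :: (two_ops, nat) optree"
  let ?R = "Node q (Leaf 1) (Node q (Leaf 2) (Leaf 3)) :: (two_ops, nat) optree"
  have L: "tree_comp ?ns ?L ?us = number 1 (Node q (Node q s t) u)"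
    and R': "tree_comp ?ns ?R ?us = number 1 (Node q s (Node q t u))"
    by (simp_all add: tree_comp_def offset_def number_shift ac_simps)
  have T: "(basis t :: _ \<Rightarrow>\<^sub>0 'k) \<in> pm.span (basis ` op_trees (length ?ns))" if "t \<in> {?L, ?R}" for t
    using that by (intro pm.span_base imageI) (auto simp: op_trees_def)
  have pos: "1 \<le> ?m" "1 \<le> ?k" "1 \<le> ?l" by (simp_all add: Suc_le_eq)
  have num: "(basis (number 1 a) :: _ \<Rightarrow>\<^sub>0 'k) \<in> pm.span (basis ` op_trees (length (leaves a)))" for a :: "(two_ops, 'a) optree"
    by (intro pm.span_base imageI number_op_trees)
  have "op_comp free_operad ?ns (basis ?L - basis ?R :: _ \<Rightarrow>\<^sub>0 'k) (map basis ?us) \<in> J (sum_list ?ns)"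
  proof (rule operad_idealD(3)[OF J])
    show "op_args (free_operad :: ('k, (two_ops, nat) optree \<Rightarrow>\<^sub>0 'k) operad) ?ns (map basis ?us)"
      using pos num[of s] num[of t] num[of u] by (simp add: op_args_def)
    show "(basis ?L - basis ?R :: _ \<Rightarrow>\<^sub>0 'k) \<in> pm.span (basis ` op_trees (length ?ns))"
      using T by (intro pm.span_diff) auto
    have "(basis ?L - basis ?R :: _ \<Rightarrow>\<^sub>0 'k) \<in> relators 3"
      by (cases q) (simp_all add: relators_def assoc_relator_free)
    then show "basis ?L - basis ?R \<in> J (length ?ns) \<or> (\<exists>i<length ?ns. map basis ?us ! i \<in> J (?ns ! i))"
      using R by (auto simp: numeral_3_eq_3)
  qed
  then have "basis (number 1 (Node q (Node q s t) u)) - basis (number 1 (Node q s (Node q t u))) \<in> J (sum_list ?ns)"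
    by (simp only: lin_diff[OF op_comp_free_linear] op_comp_free_basis L R')
  then show ?case by (simp add: add.assoc)
qed

text \<open>
  Equivalent trees have the same list of leaves and arise from the numbered ones by the same
  permutation, under which the ideal is stable.
\<close>

lemma equiv_diff_in_ideal:
  fixes J :: "nat \<Rightarrow> ((two_ops, nat) optree \<Rightarrow>\<^sub>0 'k::field) set"
  assumes J: "operad_ideal free_operad J" and R: "relators 3 \<subseteq> J 3" and n: "1 \<le> n"
    and s: "s \<in> op_trees n" and st: "s \<approx> t"
  shows "basis s - basis t \<in> J n"
proof -
  have d: "distinct (leaves s)" "set (leaves s) = {1..n}" using s by (auto simp: op_trees_def)
  then have len: "length (leaves s) = n" using distinct_card by fastforce
  note lt = equiv_leaves[OF st]
  define \<sigma> where "\<sigma> i = (if i \<in> {1..n} then leaves s ! (i - 1) else i)" for i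
  have "bij_betw (\<lambda>i. leaves s ! (i - 1)) {1..n} {1..n}"
  proof -
    have "bij_betw (\<lambda>i. i - 1) {1..n} {..<n}"
      by (rule bij_betw_byWitness[where f' = Suc]) auto
    moreover have "bij_betw ((!) (leaves s)) {..<n} {1..n}"
      using bij_betw_nth[OF d(1)] len d(2) by simp
    ultimately show ?thesis using bij_betw_trans by (fastforce simp: comp_def)
  qed
  then have "bij_betw \<sigma> {1..n} {1..n}" by (subst bij_betw_cong[of _ _ "\<lambda>i. leaves s ! (i - 1)"]) (auto simp: \<sigma>_def)
  then have perm: "\<sigma> permutes {1..n}" by (rule bij_imp_permutes) (auto simp: \<sigma>_def)
  have m: "map_optree id \<sigma> (number 1 s) = s" "map_optree id \<sigma> (number 1 t) = t"
    by (rule map_number; use len lt in \<open>simp add: \<sigma>_def\<close>)+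
  have "basis (number 1 s) - basis (number 1 t) \<in> J n"
    using equiv_in_ideal[OF J R st] len by simp
  from operad_idealD(2)[OF J n perm this] show ?thesis
    by (simp only: lin_diff[OF lin_lin_ext] lin_ext_basis m)
qed

lemma Ev_kernel_ideal: "operad_ideal free_operad (Ev_kernel :: nat \<Rightarrow> ((two_ops, nat) optree \<Rightarrow>\<^sub>0 'k::field) set)"
  unfolding operad_ideal_def
proof (intro conjI allI impI)
  let ?K = "Ev_kernel :: nat \<Rightarrow> ((two_ops, nat) optree \<Rightarrow>\<^sub>0 'k) set"
  let ?F = "free_operad :: ('k, (two_ops, nat) optree \<Rightarrow>\<^sub>0 'k) operad"
  show "submodule (?K n) (ring_of_type_algebra :: 'k ring) (op_space ?F n)" for n
    by (auto simp: submodule_free_space_iff pm.subspace_def Ev_kernel_def lin_zero[OF lin_Ev] lin_add[OF lin_Ev]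
        lin_scale[OF lin_Ev] pm.span_zero pm.span_add pm.span_scale)
  show "op_act ?F n \<sigma> ` ?K n \<subseteq> ?K n" if "1 \<le> n" and s: "\<sigma> permutes {1..n}" for n \<sigma>
  proof (rule image_subsetI)
    fix x assume x: "x \<in> ?K n"
    have "op_act ?F n \<sigma> x \<in> pm.span (basis ` op_trees n)"
      by (rule op_act_free_closed[OF s]) (use x in \<open>simp add: Ev_kernel_def\<close>)
    moreover have "Ev (op_act ?F n \<sigma> x) = 0"
      using x Ev_act[OF permutes_inj[OF s], of n x] by (simp add: Ev_kernel_def lin_zero[OF lin_Redec])
    ultimately show "op_act ?F n \<sigma> x \<in> ?K n" by (simp add: Ev_kernel_def)
  qed
  show "op_comp ?F ns q ps \<in> ?K (sum_list ns)"
    if h: "op_args ?F ns ps \<and> q \<in> carrier (op_space ?F (length ns)) \<and>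
        (q \<in> ?K (length ns) \<or> (\<exists>i<length ns. ps ! i \<in> ?K (ns ! i)))" for ns q ps
  proof -
    have a: "op_args ?F ns ps" and q: "q \<in> pm.span (basis ` op_trees (length ns))" using h by auto
    note d = op_argsD[OF a]
    have "op_comp ?F ns q ps \<in> pm.span (basis ` op_trees (sum_list ns))"
      by (rule op_comp_free_closed[OF q d(1)]) (use d(5) in simp)
    moreover have "Phi (args ns (map Ev ps)) (Ev q) = 0"
    proof (cases "q \<in> ?K (length ns)")
      case True
      then show ?thesis by (simp add: Ev_kernel_def lin_zero[OF lin_Phi])
    next
      case False
      then obtain i where i: "i < length ns" "Ev (ps ! i) = 0" using h by (auto simp: Ev_kernel_def)
      have "map Ev ps = (map Ev ps)[i := 0]"
        using i d(1) list_update_id[of "map Ev ps" i] by simp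
      moreover have "lin (\<lambda>x. Phi (args ns ((map Ev ps)[i := x])) (Ev q))"
        by (rule lin_Phi_args[OF Ev_closed[OF d(2) q]]) (use d(1) i in auto)
      from lin_zero[OF this] have "Phi (args ns ((map Ev ps)[i := 0])) (Ev q) = 0" .
      ultimately show ?thesis by simp
    qed
    ultimately show ?thesis using Ev_comp[OF q d(1)] by (simp add: Ev_kernel_def)
  qed
qed

text \<open>
  The kernel is an ideal because \<open>Ev\<close> is compatible with the operations; conversely it is spanned by
  differences of equivalent trees, which lie in every ideal that contains the relators.
\<close>

theorem generated_ideal_eq_kernel:
  assumes n: "1 \<le> n"
  shows "generated_ideal free_operad relators n = (Ev_kernel n :: ((two_ops, nat) optree \<Rightarrow>\<^sub>0 'k::field) set)"
proof
  have "relators m \<subseteq> (Ev_kernel m :: ((two_ops, nat) optree \<Rightarrow>\<^sub>0 'k) set)" for m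
  proof (cases "m = 3")
    case True
    have "assoc_relator free_operad (generator q) \<in> (Ev_kernel 3 :: ((two_ops, nat) optree \<Rightarrow>\<^sub>0 'k) set)" for q
    proof -
      have "(basis t :: _ \<Rightarrow>\<^sub>0 'k) \<in> pm.span (basis ` op_trees 3)"
        if "t \<in> {Node q (Node q (Leaf 1) (Leaf 2)) (Leaf 3), Node q (Leaf 1) (Node q (Leaf 2) (Leaf 3))}" for t
        using that by (intro pm.span_base imageI) (auto simp: op_trees_def)
      then show ?thesis
        unfolding assoc_relator_free Ev_kernel_def
        by (simp add: pm.span_diff lin_diff[OF lin_Ev] mulop_assoc)
    qed
    then show ?thesis using True by (simp add: relators_def)
  qed (simp add: relators_def)
  then show "generated_ideal free_operad relators n \<subseteq> (Ev_kernel n :: ((two_ops, nat) optree \<Rightarrow>\<^sub>0 'k) set)"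
    unfolding generated_ideal_def using Ev_kernel_ideal by blast
  show "(Ev_kernel n :: ((two_ops, nat) optree \<Rightarrow>\<^sub>0 'k) set) \<subseteq> generated_ideal free_operad relators n"
    unfolding generated_ideal_def
  proof (rule Inter_greatest)
    fix I :: "((two_ops, nat) optree \<Rightarrow>\<^sub>0 'k) set"
    assume "I \<in> {J n |J. operad_ideal free_operad J \<and> (\<forall>m\<ge>1. relators m \<subseteq> J m)}"
    then obtain J where I: "I = J n" and J: "operad_ideal free_operad J" and R: "\<forall>m\<ge>1. relators m \<subseteq> J m" by blast
    have R3: "relators 3 \<subseteq> J 3" using R by simp
    show "Ev_kernel n \<subseteq> I"
    proof
      fix x :: "(two_ops, nat) optree \<Rightarrow>\<^sub>0 'k" assume x: "x \<in> Ev_kernel n"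
      have "x \<in> assoc_space (op_trees n)"
        by (rule kernel_subset_assoc_space)
          (use x in \<open>auto simp: Ev_kernel_def Ev_def span_basis op_trees_def dest: equiv_leaves\<close>)
      moreover have "assoc_space (op_trees n) \<subseteq> I"
        unfolding assoc_space_def I
        by (rule pm.span_minimal[OF _ operad_idealD(1)[OF J n]]) (use equiv_diff_in_ideal[OF J R3 n] in auto)
      ultimately show "x \<in> I" by blast
    qed
  qed
qed

section \<open>The isomorphism\<close>

text \<open>
  By the preceding theorem the fibres of \<open>Ev\<close> are the elements of the quotient operad.
\<close>

definition fibre :: "nat \<Rightarrow> (nat wnp \<Rightarrow>\<^sub>0 'k::field) \<Rightarrow> ((two_ops, nat) optree \<Rightarrow>\<^sub>0 'k) set" where
  "fibre n x = {y \<in> pm.span (basis ` op_trees n). Ev y = x}"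

lemma fibre_nonempty:
  fixes x :: "nat wnp \<Rightarrow>\<^sub>0 'k::field"
  assumes "1 \<le> n" "x \<in> pm.span (basis ` WNP_Ind n)" shows "fibre n x \<noteq> {}"
proof -
  have "x \<in> Ev ` pm.span (basis ` op_trees n)" using assms(2) by (simp only: Ev_image[OF assms(1)])
  then show ?thesis by (auto simp: fibre_def)
qed

lemma coset_eq_fibre:
  fixes y :: "(two_ops, nat) optree \<Rightarrow>\<^sub>0 'k::field"
  assumes n: "1 \<le> n" and y: "y \<in> pm.span (basis ` op_trees n)"
  shows "generated_ideal free_operad relators n +>\<^bsub>free_space (op_trees n)\<^esub> y = fibre n (Ev y)"
proof
  show "generated_ideal free_operad relators n +>\<^bsub>free_space (op_trees n)\<^esub> y \<subseteq> fibre n (Ev y)"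
    unfolding generated_ideal_eq_kernel[OF n] a_r_coset_def'
    using y by (auto simp: Ev_kernel_def fibre_def lin_add[OF lin_Ev] pm.span_add)
  show "fibre n (Ev y) \<subseteq> generated_ideal free_operad relators n +>\<^bsub>free_space (op_trees n)\<^esub> y"
  proof
    fix z assume "z \<in> fibre n (Ev y)"
    then have "z - y \<in> Ev_kernel n" using y by (auto simp: fibre_def Ev_kernel_def lin_diff[OF lin_Ev] pm.span_diff)
    moreover have "z = (z - y) \<oplus>\<^bsub>free_space (op_trees n)\<^esub> y" by simp
    ultimately show "z \<in> generated_ideal free_operad relators n +>\<^bsub>free_space (op_trees n)\<^esub> y"
      unfolding generated_ideal_eq_kernel[OF n] a_r_coset_def' by blast
  qed
qed

lemma TwoAs_operad_alt:
  "(TwoAs_operad :: ('k::field, ((two_ops, nat) optree \<Rightarrow>\<^sub>0 'k) set) operad) =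
     quotient_operad free_operad (generated_ideal free_operad relators)"
  by (simp add: TwoAs_operad_def relators_def)

lemma TwoAs_carrier:
  assumes n: "1 \<le> n"
  shows "carrier (op_space TwoAs_operad n) = fibre n ` (pm.span (basis ` WNP_Ind n) :: (nat wnp \<Rightarrow>\<^sub>0 'k::field) set)"
proof -
  have "carrier (op_space TwoAs_operad n) = (\<lambda>y. fibre n (Ev y)) ` (pm.span (basis ` op_trees n) :: ((two_ops, nat) optree \<Rightarrow>\<^sub>0 'k) set)"
    using coset_eq_fibre[OF n] by (force simp: TwoAs_operad_alt quotient_operad_def quotient_space_def A_RCOSETS_def')
  also have "\<dots> = fibre n ` (Ev ` pm.span (basis ` op_trees n))" by (simp add: image_image)
  finally show ?thesis by (simp only: Ev_image[OF n])
qed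

lemma TwoAs_add:
  fixes x y :: "nat wnp \<Rightarrow>\<^sub>0 'k::field"
  assumes n: "1 \<le> n" and x: "x \<in> pm.span (basis ` WNP_Ind n)" and y: "y \<in> pm.span (basis ` WNP_Ind n)"
  shows "fibre n x \<oplus>\<^bsub>op_space TwoAs_operad n\<^esub> fibre n y = fibre n (x + y)"
proof -
  have "fibre n x \<oplus>\<^bsub>op_space TwoAs_operad n\<^esub> fibre n y = (\<Union>a\<in>fibre n x. \<Union>b\<in>fibre n y. {a + b})"
    by (simp add: TwoAs_operad_alt quotient_operad_def quotient_space_def set_add_def')
  also have "\<dots> = fibre n (x + y)"
  proof
    show "(\<Union>a\<in>fibre n x. \<Union>b\<in>fibre n y. {a + b}) \<subseteq> fibre n (x + y)"
      by (auto simp: fibre_def lin_add[OF lin_Ev] pm.span_add)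
    obtain b where b: "b \<in> fibre n y" using fibre_nonempty[OF n y] by blast
    show "fibre n (x + y) \<subseteq> (\<Union>a\<in>fibre n x. \<Union>b\<in>fibre n y. {a + b})"
    proof
      fix z assume "z \<in> fibre n (x + y)"
      then have "z - b \<in> fibre n x" using b by (auto simp: fibre_def lin_diff[OF lin_Ev] pm.span_diff)
      moreover have "z = (z - b) + b" by simp
      ultimately show "z \<in> (\<Union>a\<in>fibre n x. \<Union>b\<in>fibre n y. {a + b})" using b by blast
    qed
  qed
  finally show ?thesis .
qed

lemma UN_const_fibre: "A \<noteq> {} \<Longrightarrow> (\<And>a. a \<in> A \<Longrightarrow> F a = C) \<Longrightarrow> (\<Union>a\<in>A. F a) = C"
  by auto

lemma TwoAs_smult:
  fixes x :: "nat wnp \<Rightarrow>\<^sub>0 'k::field"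
  assumes n: "1 \<le> n" and x: "x \<in> pm.span (basis ` WNP_Ind n)"
  shows "c \<odot>\<^bsub>op_space TwoAs_operad n\<^esub> fibre n x = fibre n (scale c x)"
proof -
  have "c \<odot>\<^bsub>op_space TwoAs_operad n\<^esub> fibre n x = (\<Union>a\<in>fibre n x. generated_ideal free_operad relators n +>\<^bsub>free_space (op_trees n)\<^esub> scale c a)"
    by (simp add: TwoAs_operad_alt quotient_operad_def quotient_space_def)
  also have "\<dots> = fibre n (scale c x)"
  proof (rule UN_const_fibre[OF fibre_nonempty[OF n x]])
    fix a assume a: "a \<in> fibre n x"
    then have "scale c a \<in> pm.span (basis ` op_trees n)" by (simp add: fibre_def pm.span_scale)
    from coset_eq_fibre[OF n this]
    show "generated_ideal free_operad relators n +>\<^bsub>free_space (op_trees n)\<^esub> scale c a = fibre n (scale c x)"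
      using a by (simp add: fibre_def lin_scale[OF lin_Ev])
  qed
  finally show ?thesis .
qed

lemma TwoAs_act:
  fixes x :: "nat wnp \<Rightarrow>\<^sub>0 'k::field"
  assumes n: "1 \<le> n" and x: "x \<in> pm.span (basis ` WNP_Ind n)" and s: "\<sigma> permutes {1..n}"
  shows "op_act TwoAs_operad n \<sigma> (fibre n x) = fibre n (Redec \<sigma> x)"
proof -
  let ?F = "free_operad :: ('k, (two_ops, nat) optree \<Rightarrow>\<^sub>0 'k) operad"
  have "op_act TwoAs_operad n \<sigma> (fibre n x) = (\<Union>a\<in>fibre n x. generated_ideal free_operad relators n +>\<^bsub>free_space (op_trees n)\<^esub> op_act ?F n \<sigma> a)"
    by (simp add: TwoAs_operad_alt quotient_operad_def)
  also have "\<dots> = fibre n (Redec \<sigma> x)"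
  proof (rule UN_const_fibre[OF fibre_nonempty[OF n x]])
    fix a assume a: "a \<in> fibre n x"
    have "op_act ?F n \<sigma> a \<in> pm.span (basis ` op_trees n)"
      by (rule op_act_free_closed[OF s]) (use a in \<open>simp add: fibre_def\<close>)
    from coset_eq_fibre[OF n this]
    show "generated_ideal free_operad relators n +>\<^bsub>free_space (op_trees n)\<^esub> op_act ?F n \<sigma> a = fibre n (Redec \<sigma> x)"
      using a Ev_act[OF permutes_inj[OF s], of n a] by (simp add: fibre_def)
  qed
  finally show ?thesis .
qed

lemma TwoAs_comp:
  fixes q :: "nat wnp \<Rightarrow>\<^sub>0 'k::field"
  assumes a: "op_args (WNP_operad :: ('k, nat wnp \<Rightarrow>\<^sub>0 'k) operad) ns ps"
    and q: "q \<in> pm.span (basis ` WNP_Ind (length ns))"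
  shows "op_comp TwoAs_operad ns (fibre (length ns) q) (map2 fibre ns ps) = fibre (sum_list ns) (Phi (args ns ps) q)"
proof -
  note d = op_argsD[OF a]
  let ?J = "generated_ideal free_operad relators (sum_list ns) :: ((two_ops, nat) optree \<Rightarrow>\<^sub>0 'k) set"
  let ?C = "fibre (sum_list ns) (Phi (args ns ps) q)"
  have ne: "listset (map2 fibre ns ps) \<noteq> {}"
  proof -
    have "\<forall>i\<in>{..<length ns}. \<exists>y. y \<in> fibre (ns ! i) (ps ! i)"
      using fibre_nonempty[OF d(4)] d(5) by fastforce
    then obtain f where f: "\<And>i. i < length ns \<Longrightarrow> f i \<in> fibre (ns ! i) (ps ! i)" by (metis lessThan_iff)
    have "map f [0..<length ns] \<in> listset (map2 fibre ns ps)"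
      using f d(1) by (simp add: listset_iff list_all2_conv_all_nth)
    then show ?thesis by blast
  qed
  have "op_comp TwoAs_operad ns (fibre (length ns) q) (map2 fibre ns ps) =
    (\<Union>y\<in>fibre (length ns) q. \<Union>zs\<in>listset (map2 fibre ns ps). ?J +>\<^bsub>free_space (op_trees (sum_list ns))\<^esub> op_comp free_operad ns y zs)"
    by (simp add: TwoAs_operad_alt quotient_operad_def)
  also have "\<dots> = ?C"
  proof (intro UN_const_fibre[OF fibre_nonempty[OF d(2) q]] UN_const_fibre[OF ne])
    fix y zs assume y: "y \<in> fibre (length ns) q" and zs: "zs \<in> listset (map2 fibre ns ps)"
    have len: "length zs = length ns" using length_listset[OF zs] d(1) by simp
    have zs': "zs ! i \<in> fibre (ns ! i) (ps ! i)" if "i < length ns" for i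
      using zs that d(1) len by (simp add: listset_iff list_all2_conv_all_nth)
    have ps: "map Ev zs = ps"
      by (rule nth_equalityI) (use len d(1) zs' in \<open>auto simp: fibre_def\<close>)
    have y': "y \<in> pm.span (basis ` op_trees (length ns))" "Ev y = q" using y by (auto simp: fibre_def)
    have "op_comp free_operad ns y zs \<in> pm.span (basis ` op_trees (sum_list ns))"
      by (rule op_comp_free_closed[OF y'(1) len]) (use zs' in \<open>auto simp: fibre_def\<close>)
    from coset_eq_fibre[OF d(3) this]
    show "?J +>\<^bsub>free_space (op_trees (sum_list ns))\<^esub> op_comp free_operad ns y zs = ?C"
      using Ev_comp[OF y'(1) len] ps y'(2) by simp
  qed
  finally show ?thesis .
qed

lemma TwoAs_ident: "op_ident (TwoAs_operad :: ('k::field, _) operad) = fibre 1 (basis (dot 1) :: nat wnp \<Rightarrow>\<^sub>0 'k)"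
proof -
  have "(basis (Leaf 1) :: (two_ops, nat) optree \<Rightarrow>\<^sub>0 'k) \<in> pm.span (basis ` op_trees 1)"
    by (intro pm.span_base imageI) (simp add: op_trees_def)
  from coset_eq_fibre[OF _ this] show ?thesis
    by (simp add: TwoAs_operad_alt quotient_operad_def gens_def)
qed

theorem WNP_isomorphic_TwoAs:
  "operad_isomorphic (WNP_operad :: ('k::field, nat wnp \<Rightarrow>\<^sub>0 'k) operad) (TwoAs_operad :: ('k, _) operad)"
  unfolding operad_isomorphic_def
proof (intro exI[of _ fibre] conjI allI impI)
  let ?W = "WNP_operad :: ('k, nat wnp \<Rightarrow>\<^sub>0 'k) operad"
  show "operad_hom ?W (TwoAs_operad :: ('k, _) operad) fibre"
    unfolding operad_hom_def
  proof (intro conjI allI impI ballI)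
    show "fibre n \<in> lin_maps (op_space ?W n) (op_space TwoAs_operad n)" if "1 \<le> n" for n
      using that by (auto simp: lin_maps_def TwoAs_carrier TwoAs_add TwoAs_smult)
    show "fibre 1 (op_ident ?W) = op_ident TwoAs_operad" by (simp add: TwoAs_ident)
    show "fibre (sum_list ns) (op_comp ?W ns q ps) = op_comp TwoAs_operad ns (fibre (length ns) q) (map2 fibre ns ps)"
      if "op_args ?W ns ps \<and> q \<in> carrier (op_space ?W (length ns))" for ns q ps
      using that TwoAs_comp[of ns ps q] op_argsD(1)[of ?W ns ps] by (simp add: op_comp_WNP)
    show "fibre n (op_act ?W n \<sigma> x) = op_act TwoAs_operad n \<sigma> (fibre n x)"
      if "1 \<le> n" "x \<in> carrier (op_space ?W n)" "\<sigma> permutes {1..n}" for n \<sigma> x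
      using that by (simp add: TwoAs_act)
  qed
  show "bij_betw (fibre n) (carrier (op_space ?W n)) (carrier (op_space (TwoAs_operad :: ('k, _) operad) n))" if n: "1 \<le> n" for n
  proof (rule bij_betw_imageI)
    show "inj_on (fibre n) (carrier (op_space ?W n))"
    proof (rule inj_onI)
      fix x y assume "x \<in> carrier (op_space ?W n)" and e: "fibre n x = fibre n y"
      then obtain z where "z \<in> fibre n x" "z \<in> fibre n y" using fibre_nonempty[OF n, of x] by auto
      then show "x = y" by (simp add: fibre_def)
    qed
  qed (simp add: TwoAs_carrier[OF n])
qed

theorem theorem43:
  shows "(\<forall>ns Ps. ns \<noteq> [] \<and> list_all2 (\<lambda>n P. 1 \<le> n \<and> P \<in> WNP_Ind n) ns Ps \<longrightarrow>
            (\<exists>!\<Xi> :: (nat wnp \<Rightarrow>\<^sub>0 'k::field) \<Rightarrow> (nat wnp \<Rightarrow>\<^sub>0 'k). Xi_spec ns Ps \<Xi>)) \<and>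
         symmetric_operad (WNP_operad :: ('k, nat wnp \<Rightarrow>\<^sub>0 'k) operad) \<and>
         operad_isomorphic (WNP_operad :: ('k, nat wnp \<Rightarrow>\<^sub>0 'k) operad)
           (TwoAs_operad :: ('k, ((two_ops, nat) optree \<Rightarrow>\<^sub>0 'k) set) operad)"
proof (intro conjI allI impI)
  fix ns Ps assume "ns \<noteq> [] \<and> list_all2 (\<lambda>n P. 1 \<le> n \<and> P \<in> WNP_Ind n) ns Ps"
  then have "length Ps = length ns" by (auto dest: list_all2_lengthD)
  then show "\<exists>!\<Xi> :: (nat wnp \<Rightarrow>\<^sub>0 'k) \<Rightarrow> (nat wnp \<Rightarrow>\<^sub>0 'k). Xi_spec ns Ps \<Xi>" by (rule Xi_unique)
qed (rule WNP_symmetric_operad WNP_isomorphic_TwoAs)+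

end
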